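(* Let $q>1$ be a fixed integer and let $\tau>1$ be a fixed forecast horizon. Let $h_t$ be a $q\times1$ vector of $\mathscr F_t$-measurable test functions and $Z_{m,t+\tau}=h_t\,\Delta L_{m,t+\tau}\in\mathbb R^q$, $t\ge m$. Suppose that: (1) the sequence $\{Z_{m,t+\tau}:t\ge m\}$ is strongly $\alpha$-mixing with coefficients $\alpha(k)$, and there exists $\eta>0$ such that $\sum_{k=1}^\infty\alpha(k)^{\eta/(2+\eta)}<\infty$; (2) for the same $\eta$, $\sup_{t\ge m}\mathbb E\|Z_{m,t+\tau}\|^{2+\eta}<\infty$; (3) there exists a positive definite $q\times q$ matrix $\Sigma_\tau$ such that, for every $r,s\in[0,1]$, $$n^{-1}\mathrm{Cov}\Big(\sum_{t=m}^{m+\lfloor nr\rfloor-1}Z_{m,t+\tau},\ \sum_{t=m}^{m+\lfloor ns\rfloor-1}Z_{m,t+\tau}\Big)\longrightarrow(r\wedge s)\,\Sigma_\tau\qquad(n\to\infty).$$ Then, under the null hypothesis $H_0:\ \mathbb E[\Delta L_{m,t+\tau}\mid\mathscr F_t]=0$ almost surely for all $t$, as $n\to\infty$, $$Q^{h,q}_{m,n,\tau}\Rightarrow B^q(1)^T\Big(\int_0^1\mathbb B^q(r)\mathbb B^q(r)^T\,dr\Big)^{-1}B^q(1),$$ where $B^q$ is a standard $q$-dimensional Brownian motion and $\mathbb B^q(r)=B^q(r)-rB^q(1)$.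
   Context: Setting. $W_t=(Y_t,X_t^T)^T$ is an observed process ($Y_t$ real-valued, $X_t$ a vector of predictors) and $\mathscr F_t=\sigma(W_1,\dots,W_t)$. At each forecast origin $t$, two competing forecasts $\widehat f_t,\widehat g_t$ of $Y_{t+\tau}$ are given, both $\mathscr F_t$-measurable and computed from rolling estimation windows whose lengths ($\mathscr F_t$-measurable, possibly random) are uniformly bounded by a finite constant. $L(\cdot,\cdot)$ is a prespecified real-valued (measurable) loss function, and the loss differential is $\Delta L_{m,t+\tau}=L(Y_{t+\tau},\widehat f_t)-L(Y_{t+\tau},\widehat g_t)$. The integer $m$ is the first forecast origin; the evaluation period is $t=m,\dots,T-\tau$, with $n=T-\tau-m+1$ evaluation points. Asymptotics: $m$ and $\tau$ fixed, $n\to\infty$. Mixing. $\alpha(k)$ are the usual strong mixing coefficients of the sequence: $\alpha(k)=\sup_{t}\sup\{|P(A\cap B)-P(A)P(B)|\}$, over $A$ in the $\sigma$-field generated by the terms with index $\le t$ and $B$ in the $\sigma$-field generated by the terms with index $\ge t+k$. Statistic. $\overline Z_{m,n,\tau}=n^{-1}\sum_{t=m}^{T-\tau}Z_{m,t+\tau}$; $$T^{h,q}_{m,n,\tau}(r)=\frac1{\sqrt n}\sum_{t=m}^{m+\lfloor nr\rfloor-1}\big(Z_{m,t+\tau}-\overline Z_{m,n,\tau}\big),\quad0\le r\le1;$$ $$U_{m,n,\tau}=n^{-1}\sum_{k=1}^nT^{h,q}_{m,n,\tau}(k/n)\,T^{h,q}_{m,n,\tau}(k/n)^T;$$ $$Q^{h,q}_{m,n,\tau}=n\,\overline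 Z_{m,n,\tau}^T\,U_{m,n,\tau}^{-1}\,\overline Z_{m,n,\tau}\quad\text{whenever }U_{m,n,\tau}\text{ is nonsingular},$$ with an arbitrary fixed value assigned when $U_{m,n,\tau}$ is singular. Here $\Rightarrow$ denotes convergence in distribution. *)

theory Defs
  imports "HOL-Probability.Probability"
begin

text \<open>The \<open>\<sigma>\<close>-field generated by the random elements \<open>V s\<close>, \<open>s \<in> I\<close>.\<close>

definition generated_by ::
  "'a measure \<Rightarrow> (nat \<Rightarrow> 'a \<Rightarrow> 'v::topological_space) \<Rightarrow> nat set \<Rightarrow> 'a measure" where
  "generated_by M V I =
     sigma (space M) (\<Union>s\<in>I. {V s -` A \<inter> space M | A. A \<in> sets borel})"

definition observed :: "(nat \<Rightarrow> 'a \<Rightarrow> real) \<Rightarrow> (nat \<Rightarrow> 'a \<Rightarrow> real ^ 'p) \<Rightarrow>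
    nat \<Rightarrow> 'a \<Rightarrow> real \<times> (real ^ 'p)" where
  "observed Y X t \<omega> = (Y t \<omega>, X t \<omega>)"

definition info :: "'a measure \<Rightarrow> (nat \<Rightarrow> 'a \<Rightarrow> 'v::topological_space) \<Rightarrow> nat \<Rightarrow> 'a measure" where
  "info M W t = generated_by M W {1..t}"

text \<open>The forecast issued at origin \<open>t \<ge> m\<close> is a measurable function \<open>\<phi> t k\<close> of the
  \<open>k\<close> most recent observations, where \<open>k = R t \<omega>\<close> is the window length. Subtraction is truncated,
  so \<open>{t - k<..t}\<close> contains all observations \<open>1, \<dots>, t\<close> if \<open>k\<close> exceeds \<open>t\<close>.\<close>

definition rolling_window_forecast ::
  "'a measure \<Rightarrow> (nat \<Rightarrow> 'a \<Rightarrow> 'v::topological_space) \<Rightarrow> nat \<Rightarrow> (nat \<Rightarrow> 'a \<Rightarrow> real) \<Rightarrow> bool" where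
  "rolling_window_forecast M W m f \<longleftrightarrow>
     (\<exists>(R :: nat \<Rightarrow> 'a \<Rightarrow> nat) (Rmax :: nat) (\<phi> :: nat \<Rightarrow> nat \<Rightarrow> (nat \<Rightarrow> 'v) \<Rightarrow> real).
        \<forall>t\<ge>m. R t \<in> measurable (info M W t) (count_space UNIV)
          \<and> (\<forall>\<omega>\<in>space M. R t \<omega> \<le> Rmax)
          \<and> (\<forall>k\<le>Rmax. \<phi> t k \<in> borel_measurable (PiM {t - k<..t} (\<lambda>_. borel)))
          \<and> (\<forall>\<omega>\<in>space M. f t \<omega> = \<phi> t (R t \<omega>) (\<lambda>s\<in>{t - R t \<omega><..t}. W s \<omega>)))"

definition loss_diff :: "(real \<Rightarrow> real \<Rightarrow> real) \<Rightarrow> (nat \<Rightarrow> 'a \<Rightarrow> real) \<Rightarrow> nat \<Rightarrow>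
    (nat \<Rightarrow> 'a \<Rightarrow> real) \<Rightarrow> (nat \<Rightarrow> 'a \<Rightarrow> real) \<Rightarrow> nat \<Rightarrow> 'a \<Rightarrow> real" where
  "loss_diff L Y \<tau> f g t \<omega> = L (Y (t + \<tau>) \<omega>) (f t \<omega>) - L (Y (t + \<tau>) \<omega>) (g t \<omega>)"

text \<open>Here and below the variable \<open>Z\<^bsub>m,t+\<tau>\<^esub>\<close> is indexed by the forecast origin \<open>t\<close>.\<close>

definition test_seq :: "(nat \<Rightarrow> 'a \<Rightarrow> real ^ 'q) \<Rightarrow> (nat \<Rightarrow> 'a \<Rightarrow> real) \<Rightarrow> nat \<Rightarrow> 'a \<Rightarrow> real ^ 'q" where
  "test_seq h D t \<omega> = D t \<omega> *\<^sub>R h t \<omega>"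

text \<open>Integrability is part of the null hypothesis because \<^const>\<open>real_cond_exp\<close> is total and may
  vanish for non-integrable functions.\<close>

definition null_hypothesis ::
  "'a measure \<Rightarrow> (nat \<Rightarrow> 'a measure) \<Rightarrow> nat \<Rightarrow> (nat \<Rightarrow> 'a \<Rightarrow> real) \<Rightarrow> bool" where
  "null_hypothesis M F m D \<longleftrightarrow>
     (\<forall>t\<ge>m. integrable M (D t) \<and> (AE \<omega> in M. real_cond_exp M (F t) (D t) \<omega> = 0))"

definition alpha_mixing_coeff ::
  "'a measure \<Rightarrow> nat \<Rightarrow> (nat \<Rightarrow> 'a \<Rightarrow> 'v::topological_space) \<Rightarrow> nat \<Rightarrow> real" where
  "alpha_mixing_coeff M m Z k =
     Sup {\<bar>measure M (A \<inter> B) - measure M A * measure M B\<bar> | t A B.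
            m \<le> t \<and> A \<in> sets (generated_by M Z {m..t}) \<and> B \<in> sets (generated_by M Z {t + k..})}"

definition strongly_mixing ::
  "'a measure \<Rightarrow> nat \<Rightarrow> (nat \<Rightarrow> 'a \<Rightarrow> 'v::topological_space) \<Rightarrow> bool" where
  "strongly_mixing M m Z \<longleftrightarrow> alpha_mixing_coeff M m Z \<longlonglongrightarrow> 0"

definition cross_cov :: "'a measure \<Rightarrow> ('a \<Rightarrow> real ^ 'q) \<Rightarrow> ('a \<Rightarrow> real ^ 'q) \<Rightarrow> real ^ 'q ^ 'q" where
  "cross_cov M V W = (\<chi> i j. LINT \<omega>|M.
     (V \<omega> $ i - (LINT \<omega>'|M. V \<omega>' $ i)) * (W \<omega> $ j - (LINT \<omega>'|M. W \<omega>' $ j)))"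

definition positive_definite :: "real ^ 'q ^ 'q \<Rightarrow> bool" where
  "positive_definite S \<longleftrightarrow> transpose S = S \<and> (\<forall>x. x \<noteq> 0 \<longrightarrow> x \<bullet> (S *v x) > 0)"

definition outer :: "real ^ 'q \<Rightarrow> real ^ 'q ^ 'q" where
  "outer v = (\<chi> i j. v $ i * v $ j)"

text \<open>The evaluation period \<open>t = m, \<dots>, T - \<tau>\<close> is written in terms of the number
  \<open>n = T - \<tau> - m + 1\<close> of evaluation points, that is, \<open>t \<in> {m..<m + n}\<close>.\<close>

definition partial_sum :: "nat \<Rightarrow> (nat \<Rightarrow> 'a \<Rightarrow> real ^ 'q) \<Rightarrow> nat \<Rightarrow> real \<Rightarrow> 'a \<Rightarrow> real ^ 'q" where
  "partial_sum m Z n r \<omega> = (\<Sum>t\<in>{m..<m + nat \<lfloor>real n * r\<rfloor>}. Z t \<omega>)"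

definition Zbar :: "nat \<Rightarrow> (nat \<Rightarrow> 'a \<Rightarrow> real ^ 'q) \<Rightarrow> nat \<Rightarrow> 'a \<Rightarrow> real ^ 'q" where
  "Zbar m Z n \<omega> = (1 / real n) *\<^sub>R (\<Sum>t\<in>{m..<m + n}. Z t \<omega>)"

definition T_stat :: "nat \<Rightarrow> (nat \<Rightarrow> 'a \<Rightarrow> real ^ 'q) \<Rightarrow> nat \<Rightarrow> real \<Rightarrow> 'a \<Rightarrow> real ^ 'q" where
  "T_stat m Z n r \<omega> =
     (1 / sqrt (real n)) *\<^sub>R (\<Sum>t\<in>{m..<m + nat \<lfloor>real n * r\<rfloor>}. Z t \<omega> - Zbar m Z n \<omega>)"

definition U_stat :: "nat \<Rightarrow> (nat \<Rightarrow> 'a \<Rightarrow> real ^ 'q) \<Rightarrow> nat \<Rightarrow> 'a \<Rightarrow> real ^ 'q ^ 'q" where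
  "U_stat m Z n \<omega> = (1 / real n) *\<^sub>R (\<Sum>k=1..n. outer (T_stat m Z n (real k / real n) \<omega>))"

definition Q_stat :: "real \<Rightarrow> nat \<Rightarrow> (nat \<Rightarrow> 'a \<Rightarrow> real ^ 'q) \<Rightarrow> nat \<Rightarrow> 'a \<Rightarrow> real" where
  "Q_stat c m Z n \<omega> =
     (if invertible (U_stat m Z n \<omega>)
      then real n * (Zbar m Z n \<omega> \<bullet> (matrix_inv (U_stat m Z n \<omega>) *v Zbar m Z n \<omega>))
      else c)"

definition standard_brownian_motion :: "'b measure \<Rightarrow> (real \<Rightarrow> 'b \<Rightarrow> real ^ 'q) \<Rightarrow> bool" where
  "standard_brownian_motion N B \<longleftrightarrow>
     prob_space N
     \<and> (\<forall>t\<ge>0. B t \<in> borel_measurable N)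
     \<and> (AE \<omega> in N. B 0 \<omega> = 0)
     \<and> (\<forall>\<omega>\<in>space N. continuous_on {0..} (\<lambda>t. B t \<omega>))
     \<and> (\<forall>(s :: nat \<Rightarrow> real) k. 0 \<le> s 0 \<and> mono_on {..k} s \<longrightarrow>
          prob_space.indep_vars N (\<lambda>_. borel) (\<lambda>i \<omega>. B (s (Suc i)) \<omega> - B (s i) \<omega>) {..<k})
     \<and> (\<forall>s t. 0 \<le> s \<and> s < t \<longrightarrow>
          distributed N lborel (\<lambda>\<omega>. B t \<omega> - B s \<omega>)
            (\<lambda>x. ennreal (\<Prod>i\<in>UNIV. normal_density 0 (sqrt (t - s)) (x $ i))))"

definition bridge :: "(real \<Rightarrow> 'b \<Rightarrow> real ^ 'q) \<Rightarrow> real \<Rightarrow> 'b \<Rightarrow> real ^ 'q" where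
  "bridge B r \<omega> = B r \<omega> - r *\<^sub>R B 1 \<omega>"

text \<open>On the null event where the integrated outer product is singular, \<^const>\<open>matrix_inv\<close> is a
  fixed unspecified matrix.\<close>

definition limit_var :: "(real \<Rightarrow> 'b \<Rightarrow> real ^ 'q) \<Rightarrow> 'b \<Rightarrow> real" where
  "limit_var B \<omega> =
     B 1 \<omega> \<bullet> (matrix_inv (integral {0..1} (\<lambda>r. outer (bridge B r \<omega>))) *v B 1 \<omega>)"

end

theory Submission
  imports Defs
begin

text \<open>Under the null hypothesis \<open>Z t\<close> is orthogonal to every bounded \<open>\<F>\<^sub>t\<close>-measurable variable, and
  it is \<open>\<F>\<^sub>t\<^sub>+\<^sub>\<tau>\<close>-measurable; hence products at distance at least \<open>\<tau>\<close> have mean zero, and second moments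
  of sums grow linearly. Cut a weighted sum into long blocks separated by short gaps. The characteristic
  function is multiplied at each block by nearly \<open>exp (- v / 2)\<close>, where \<open>v\<close> is the variance of the scaled
  block: the linear Taylor term vanishes by orthogonality, and mixing across the gap decouples the
  quadratic one. This gives Gaussian limits for all linear functionals of the partial sums, hence joint
  convergence at finitely many times, by tightness and the Stone--Weierstrass theorem for trigonometric
  polynomials. No tightness in a function space is needed: \<open>U\<close> is within a small \<open>L\<^sup>1\<close> distance, uniformly
  in large \<open>n\<close>, of its analogue on a fixed grid, which depends on finitely many partial sums. The limiting matrix is
  almost surely nonsingular because a vector orthogonal to the whole bridge would be orthogonal to
  second differences of Brownian motion, which are almost surely linearly independent. Finally a square
  root of \<open>\<Sigma>\<close> cancels from the quadratic form.\<close>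

section \<open>Mixing and covariances\<close>

text \<open>The null hypothesis gives \<open>Z t\<close> conditional mean zero only at its own
  origin, while \<open>Z t\<close> becomes known \<open>\<tau>\<close> steps later, so the sequence
  need not be a martingale difference sequence for the filtration to which it is adapted. The gaps
  repair this: once a gap is at least \<open>\<tau>\<close>, the whole past of \<open>Z\<close> is
  known at the first origin of the next block, and the linear Taylor term is exactly zero rather
  than small. Mixing then has to control only covariances of a bounded variable with products of two
  terms. Such products have merely a moment of order 1 + \<eta> / 2, so they are truncated at a
  level governed by \<open>\<kappa>\<close>: mixing handles the bounded part, the moments handle the
  rest. There are at most n / p blocks, so an error of order 1 / n with a small constant is
  affordable in each. In the statistic itself the obstacle is that matrix inversion breaks down at
  singular matrices; test functions are cut off near them, and the lost mass is estimated by the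
  same convergence.\<close>

lemma integrable_bounded_mult:
  fixes g V :: "'a \<Rightarrow> real"
  assumes "g \<in> borel_measurable M" "\<And>x. x \<in> space M \<Longrightarrow> \<bar>g x\<bar> \<le> d" and V: "integrable M V"
  shows "integrable M (\<lambda>x. g x * V x)"
proof (rule Bochner_Integration.integrable_bound[of _ "\<lambda>x. d * V x"])
  have "\<bar>g x\<bar> * \<bar>V x\<bar> \<le> \<bar>d\<bar> * \<bar>V x\<bar>" if "x \<in> space M" for x
    using assms(2)[OF that] by (intro mult_right_mono) auto
  then show "AE x in M. norm (g x * V x) \<le> norm (d * V x)" by (simp add: abs_mult)
qed (use assms in auto)

text \<open>Replacing the centred \<open>V\<close> by its conditional expectation \<open>W\<close>
  given \<open>G\<close> leaves the left side unchanged, and \<open>\<bar>U * W\<bar>\<close> is at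
  most \<open>c\<close> times \<open>W\<close> multiplied by its sign. The sign is
  \<open>2 * 1_A - 1\<close> for the event \<open>A\<close> on which \<open>W\<close> is
  nonnegative, so a bounded variable is traded for an event.\<close>

lemma (in prob_space) covariance_le_sign_covariance:
  fixes U V :: "'a \<Rightarrow> real"
  assumes sub: "subalgebra M G"
    and U: "U \<in> borel_measurable G" "\<And>x. x \<in> space M \<Longrightarrow> \<bar>U x\<bar> \<le> c"
    and V: "integrable M V"
  shows "\<exists>A\<in>sets G. \<bar>expectation (\<lambda>x. U x * (V x - expectation V))\<bar>
           \<le> c * expectation (\<lambda>x. (2 * indicator A x - 1) * (V x - expectation V))"
proof -
  interpret finite_measure_subalgebra M G
    by unfold_locales (use sub in \<open>auto simp: subalgebra_def\<close>)
  let ?V = "\<lambda>x. V x - expectation V"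
  define W where "W = real_cond_exp M G ?V"
  have sp: "space G = space M" using sub by (auto simp: subalgebra_def)
  have W [measurable]: "W \<in> borel_measurable G" unfolding W_def by simp
  define A where "A = {x \<in> space G. W x \<ge> 0}"
  have A: "A \<in> sets G" unfolding A_def by measurable
  have UM [measurable]: "U \<in> borel_measurable M" using measurable_from_subalg[OF sub U(1)] .
  have AM [measurable]: "A \<in> sets M" using A sub by (auto simp: subalgebra_def)
  have [measurable]: "V \<in> borel_measurable M" using V by auto
  have Vi: "integrable M ?V" using V by simp
  have ind: "(\<lambda>x. 2 * indicator A x - 1 :: real) \<in> borel_measurable G" using A by simp
  have i1: "integrable M (\<lambda>x. U x * ?V x)" by (rule integrable_bounded_mult[OF UM U(2) Vi])
  have i2: "integrable M (\<lambda>x. (2 * indicator A x - 1) * ?V x)"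
    by (rule integrable_bounded_mult[of _ _ 1, OF _ _ Vi]) (auto simp: indicator_def)
  have "\<bar>expectation (\<lambda>x. U x * ?V x)\<bar> = \<bar>expectation (\<lambda>x. U x * W x)\<bar>"
    unfolding W_def by (subst real_cond_exp_intg(2)[OF i1 U(1)]) auto
  also have "\<dots> \<le> expectation (\<lambda>x. \<bar>U x * W x\<bar>)" by (rule integral_abs_bound)
  also have "\<dots> \<le> expectation (\<lambda>x. c * ((2 * indicator A x - 1) * W x))"
  proof (rule integral_mono)
    have 1: "integrable M (\<lambda>x. U x * W x)" "integrable M (\<lambda>x. (2 * indicator A x - 1) * W x)"
      unfolding W_def using real_cond_exp_intg(1)[OF i1 U(1)] real_cond_exp_intg(1)[OF i2 ind] by auto
    show "integrable M (\<lambda>x. \<bar>U x * W x\<bar>)" using 1 by simp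
    show "integrable M (\<lambda>x. c * ((2 * indicator A x - 1) * W x))" using 1 by simp
    fix x assume x: "x \<in> space M"
    have "\<bar>W x\<bar> = (2 * indicator A x - 1) * W x" using x by (auto simp: A_def sp indicator_def)
    then show "\<bar>U x * W x\<bar> \<le> c * ((2 * indicator A x - 1) * W x)"
      using mult_right_mono[OF U(2)[OF x] abs_ge_zero[of "W x"]] by (simp add: abs_mult)
  qed
  also have "\<dots> = c * expectation (\<lambda>x. (2 * indicator A x - 1) * W x)" by simp
  also have "expectation (\<lambda>x. (2 * indicator A x - 1) * W x) = expectation (\<lambda>x. (2 * indicator A x - 1) * ?V x)"
    unfolding W_def by (rule real_cond_exp_intg(2)[OF i2 ind]) auto
  finally show ?thesis using A by blast
qed

text \<open>Covariance does not depend on which factor is centred. This allows the reduction to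
  signs to be applied to the second variable after the first has become a sign.\<close>

lemma (in prob_space) expectation_centered_swap:
  fixes U V :: "'a \<Rightarrow> real"
  assumes "integrable M U" "integrable M V" "integrable M (\<lambda>x. U x * V x)"
  shows "expectation (\<lambda>x. U x * (V x - expectation V)) = expectation (\<lambda>x. V x * (U x - expectation U))"
  using assms by (simp add: right_diff_distrib mult.commute)

text \<open>The constant is 4 because an event \<open>A\<close> enters through its sign \<open>2 * 1\<^sub>A - 1\<close>.\<close>

lemma (in prob_space) bounded_covariance_le_mixing:
  fixes U V :: "'a \<Rightarrow> real"
  assumes G: "subalgebra M G" and H: "subalgebra M H"
    and U: "U \<in> borel_measurable G" "\<And>x. x \<in> space M \<Longrightarrow> \<bar>U x\<bar> \<le> c"
    and V: "V \<in> borel_measurable H" "\<And>x. x \<in> space M \<Longrightarrow> \<bar>V x\<bar> \<le> d"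
    and mix: "\<And>A B. A \<in> sets G \<Longrightarrow> B \<in> sets H \<Longrightarrow> \<bar>prob (A \<inter> B) - prob A * prob B\<bar> \<le> a"
  shows "\<bar>expectation (\<lambda>x. U x * (V x - expectation V))\<bar> \<le> 4 * c * d * a"
proof -
  obtain x0 where x0: "x0 \<in> space M" using not_empty by auto
  have c0: "0 \<le> c" "0 \<le> d" using U(2)[OF x0] V(2)[OF x0] by auto
  have [measurable]: "V \<in> borel_measurable M" using measurable_from_subalg[OF H V(1)] .
  have Vi: "integrable M V" by (rule integrable_const_bound[of _ d]) (use V in auto)
  obtain A where A: "A \<in> sets G" and 1: "\<bar>expectation (\<lambda>x. U x * (V x - expectation V))\<bar>
           \<le> c * expectation (\<lambda>x. (2 * indicator A x - 1) * (V x - expectation V))"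
    using covariance_le_sign_covariance[OF G U Vi] by auto
  define I :: "'a \<Rightarrow> real" where "I = (\<lambda>x. 2 * indicator A x - 1)"
  have [measurable]: "A \<in> sets M" using A G by (auto simp: subalgebra_def)
  have Ib: "\<bar>I x\<bar> \<le> 1" for x by (auto simp: I_def indicator_def)
  have [measurable]: "I \<in> borel_measurable M" unfolding I_def by simp
  have Ii: "integrable M I" by (rule integrable_const_bound[of _ 1]) (use Ib in auto)
  have IVi: "integrable M (\<lambda>x. I x * V x)" by (rule integrable_bounded_mult[OF _ Ib Vi]) auto
  \<comment> \<open>Second use of the reduction, now with \<open>V\<close> as the bounded factor and
    the sign \<open>I\<close> of \<open>A\<close> as the centred one; two events remain, to which
    the mixing bound applies.\<close>
  obtain B where B: "B \<in> sets H" and 2: "\<bar>expectation (\<lambda>x. V x * (I x - expectation I))\<bar>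
           \<le> d * expectation (\<lambda>x. (2 * indicator B x - 1) * (I x - expectation I))"
    using covariance_le_sign_covariance[OF H V Ii] by auto
  have [measurable]: "B \<in> sets M" using B H by (auto simp: subalgebra_def)
  have ii [simp]: "integrable M (indicator C :: 'a \<Rightarrow> real)" if "C \<in> sets M" for C
    by (rule integrable_const_bound[of _ 1]) (use that in auto)
  have EI: "expectation I = 2 * prob A - 1" by (simp add: I_def prob_space)
  have "expectation (\<lambda>x. (2 * indicator B x - 1) * (I x - expectation I))
      = expectation (\<lambda>x. 4 * indicator (A \<inter> B) x - 4 * prob A * indicator B x - 2 * indicator A x + 2 * prob A)"
    unfolding EI by (rule Bochner_Integration.integral_cong) (auto simp: I_def indicator_def)
  also have "\<dots> = 4 * (prob (A \<inter> B) - prob A * prob B)" by (simp add: prob_space)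
  also have "\<dots> \<le> 4 * a" using mix[OF A B] by (simp add: abs_le_iff)
  finally have 3: "expectation (\<lambda>x. (2 * indicator B x - 1) * (I x - expectation I)) \<le> 4 * a" .
  have "expectation (\<lambda>x. I x * (V x - expectation V)) = expectation (\<lambda>x. V x * (I x - expectation I))"
    by (rule expectation_centered_swap[OF Ii Vi IVi])
  also have "\<dots> \<le> d * (4 * a)" using 2 mult_left_mono[OF 3 c0(2)] by linarith
  finally have "expectation (\<lambda>x. I x * (V x - expectation V)) \<le> d * (4 * a)" .
  from mult_left_mono[OF this c0(1)] 1 show ?thesis unfolding I_def by (simp add: mult_ac)
qed


section \<open>Sigma-fields generated by a family\<close>

lemma space_generated_by [simp]: "space (generated_by M V I) = space M"
  unfolding generated_by_def by (rule space_measure_of) auto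

lemma sets_generated_by:
  "sets (generated_by M V I) = sigma_sets (space M) (\<Union>s\<in>I. {V s -` A \<inter> space M | A. A \<in> sets borel})"
  unfolding generated_by_def by (rule sets_measure_of) auto

lemma generated_by_measurable: "s \<in> I \<Longrightarrow> V s \<in> borel_measurable (generated_by M V I)"
  unfolding measurable_def by (auto simp: sets_generated_by)

lemma generated_by_subset:
  assumes "space G = space M" "\<And>s. s \<in> I \<Longrightarrow> V s \<in> borel_measurable G"
  shows "sets (generated_by M V I) \<subseteq> sets G"
  unfolding sets_generated_by assms(1)[symmetric]
  by (rule sets.sigma_sets_subset) (use assms in \<open>auto simp: measurable_def\<close>)

lemma subalgebra_generated_by:
  assumes "\<And>s. s \<in> I \<Longrightarrow> V s \<in> borel_measurable M"
  shows "subalgebra M (generated_by M V I)"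
  using generated_by_subset[OF refl assms] by (simp add: subalgebra_def)

text \<open>The forecasts and the loss are forgotten here. \<open>Z_orth\<close> asks for
  integrability of the product instead of a bound on \<open>U\<close>, because it is used with a
  \<open>U\<close> that contains another term of the sequence. \<open>C\<close> bounds a nonnegative
  integral, so that integrability of the moments is a consequence, and \<open>\<alpha>\<close> is
  any null sequence that dominates the mixing coefficients.\<close>

locale predictable_mean_zero = prob_space M for M :: "'a measure" +
  fixes F :: "nat \<Rightarrow> 'a measure" and Z :: "nat \<Rightarrow> 'a \<Rightarrow> 'v::euclidean_space"
    and m \<tau> :: nat and \<eta> C :: real and \<alpha> :: "nat \<Rightarrow> real"
  assumes sub_F: "\<And>t. subalgebra M (F t)"
    and F_mono: "\<And>s t. s \<le> t \<Longrightarrow> sets (F s) \<subseteq> sets (F t)"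
    and Z_F: "\<And>t. m \<le> t \<Longrightarrow> Z t \<in> borel_measurable (F (t + \<tau>))"
    and eta: "0 < \<eta>"
    and Z_moment: "\<And>t. m \<le> t \<Longrightarrow> (\<integral>\<^sup>+\<omega>. ennreal (norm (Z t \<omega>) powr (2 + \<eta>)) \<partial>M) \<le> ennreal C"
    and C: "0 \<le> C"
    and Z_orth: "\<And>t U u. m \<le> t \<Longrightarrow> U \<in> borel_measurable (F t) \<Longrightarrow> integrable M (\<lambda>\<omega>. U \<omega> * (u \<bullet> Z t \<omega>))
        \<Longrightarrow> expectation (\<lambda>\<omega>. U \<omega> * (u \<bullet> Z t \<omega>)) = 0"
    and mixing: "\<And>s k A B. m \<le> s \<Longrightarrow> A \<in> sets (generated_by M Z {m..s}) \<Longrightarrow>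
        B \<in> sets (generated_by M Z {s + k..}) \<Longrightarrow> \<bar>prob (A \<inter> B) - prob A * prob B\<bar> \<le> \<alpha> k"
    and alpha: "\<alpha> \<longlonglongrightarrow> 0"
begin

lemma F_measurable_mono: "s \<le> t \<Longrightarrow> f \<in> borel_measurable (F s) \<Longrightarrow> f \<in> borel_measurable (F t)"
  using F_mono[of s t] sub_F[of s] sub_F[of t]
  by (auto simp: measurable_def subalgebra_def)

lemma F_measurable: "f \<in> borel_measurable (F s) \<Longrightarrow> f \<in> borel_measurable M"
  by (rule measurable_from_subalg[OF sub_F])

lemma Z_measurable [measurable (raw)]: "m \<le> t \<Longrightarrow> Z t \<in> borel_measurable M"
  by (rule F_measurable[OF Z_F])

lemma Z_moment_integrable: "m \<le> t \<Longrightarrow> integrable M (\<lambda>\<omega>. norm (Z t \<omega>) powr (2 + \<eta>))"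
  using Z_moment[of t] by (intro integrableI_nonneg) (auto simp: le_less_trans)

lemma Z_moment_le: "m \<le> t \<Longrightarrow> expectation (\<lambda>\<omega>. norm (Z t \<omega>) powr (2 + \<eta>)) \<le> C"
  using Z_moment[of t] nn_integral_eq_integral[OF Z_moment_integrable[of t]] C by simp

lemma square_le_moment: "r\<^sup>2 \<le> 1 + r powr (2 + \<eta>)" if "0 \<le> r" for r :: real
proof (cases "r \<le> 1")
  case True
  with that have "r\<^sup>2 \<le> 1" by (simp add: power_le_one)
  then show ?thesis by (simp add: add_increasing2)
next
  case False
  then have "r\<^sup>2 = r powr 2" by (simp flip: powr_numeral)
  also have "\<dots> \<le> r powr (2 + \<eta>)" using False eta by (intro powr_mono) auto
  finally show ?thesis by simp
qed

lemma
  assumes "m \<le> t"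
  shows Z_square_integrable: "integrable M (\<lambda>\<omega>. (norm (Z t \<omega>))\<^sup>2)"
    and Z_square_le: "expectation (\<lambda>\<omega>. (norm (Z t \<omega>))\<^sup>2) \<le> 1 + C"
proof -
  have [measurable]: "Z t \<in> borel_measurable M" using assms by (rule Z_measurable)
  have i: "integrable M (\<lambda>\<omega>. 1 + norm (Z t \<omega>) powr (2 + \<eta>))"
    using Z_moment_integrable[OF assms] by simp
  show 1: "integrable M (\<lambda>\<omega>. (norm (Z t \<omega>))\<^sup>2)"
    by (rule Bochner_Integration.integrable_bound[OF i]) (auto simp: square_le_moment intro: order_trans[OF _ abs_ge_self])
  have "expectation (\<lambda>\<omega>. (norm (Z t \<omega>))\<^sup>2) \<le> expectation (\<lambda>\<omega>. 1 + norm (Z t \<omega>) powr (2 + \<eta>))"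
    by (rule integral_mono[OF 1 i]) (simp add: square_le_moment)
  also have "\<dots> \<le> 1 + C" using Z_moment_le[OF assms] Z_moment_integrable[OF assms] by (simp add: prob_space)
  finally show "expectation (\<lambda>\<omega>. (norm (Z t \<omega>))\<^sup>2) \<le> 1 + C" .
qed

lemma subalgebra_generated_Z: "m \<le> u \<Longrightarrow> subalgebra M (generated_by M Z {u..})"
  by (rule subalgebra_generated_by) (auto intro: Z_measurable)

lemma subalgebra_generated_Z': "subalgebra M (generated_by M Z {m..s})"
  by (rule subalgebra_generated_by) (auto intro: Z_measurable)

text \<open>Mixing speaks of the fields generated by \<open>Z\<close>, orthogonality of the fields
  \<open>F\<close>. The two are linked by the delay: each \<open>Z t\<close> with
  \<open>t \<le> s\<close> is known at time \<open>s + \<tau>\<close>.\<close>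

lemma generated_Z_F_measurable:
  assumes "V \<in> borel_measurable (generated_by M Z {m..s})" "s + \<tau> \<le> u"
  shows "V \<in> borel_measurable (F u)"
proof -
  have sp: "space (F u) = space M" using sub_F[of u] by (simp add: subalgebra_def)
  have "sets (generated_by M Z {m..s}) \<subseteq> sets (F u)"
    by (rule generated_by_subset[OF sp]) (use assms in \<open>auto intro!: F_measurable_mono[OF _ Z_F]\<close>)
  then show ?thesis using assms(1) sp by (auto simp: measurable_def)
qed

context
  fixes a :: "nat \<Rightarrow> 'v" and b :: real
  assumes a_le: "\<And>t. norm (a t) \<le> b"
begin

text \<open>Deterministic bounded weights turn every linear functional of several partial sums into
  one scalar sum, so a single scalar limit theorem serves the Cramer-Wold argument.\<close>

definition weighted :: "nat \<Rightarrow> 'a \<Rightarrow> real" where "weighted t \<omega> = a t \<bullet> Z t \<omega>"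

lemma b_nonneg: "0 \<le> b" using a_le[of 0] norm_ge_zero order_trans by blast

lemma x_F: "m \<le> t \<Longrightarrow> weighted t \<in> borel_measurable (F (t + \<tau>))"
  unfolding weighted_def[abs_def] using Z_F[of t] by measurable

lemma weighted_measurable [measurable (raw)]: "m \<le> t \<Longrightarrow> weighted t \<in> borel_measurable M"
  by (rule F_measurable[OF x_F])

lemma weighted_abs_le: "\<bar>weighted t \<omega>\<bar> \<le> b * norm (Z t \<omega>)"
  unfolding weighted_def using Cauchy_Schwarz_ineq2[of "a t" "Z t \<omega>"] mult_right_mono[OF a_le[of t] norm_ge_zero[of "Z t \<omega>"]]
  by linarith

lemma weighted_prod_abs_le: "\<bar>weighted s \<omega> * weighted t \<omega>\<bar> \<le> b\<^sup>2 * ((norm (Z s \<omega>))\<^sup>2 + (norm (Z t \<omega>))\<^sup>2) / 2"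
proof -
  have "\<bar>weighted s \<omega> * weighted t \<omega>\<bar> \<le> (b * norm (Z s \<omega>)) * (b * norm (Z t \<omega>))"
    unfolding abs_mult using b_nonneg by (intro mult_mono weighted_abs_le) auto
  also have "\<dots> = b\<^sup>2 * (norm (Z s \<omega>) * norm (Z t \<omega>))" by (simp add: power2_eq_square)
  also have "\<dots> \<le> b\<^sup>2 * (((norm (Z s \<omega>))\<^sup>2 + (norm (Z t \<omega>))\<^sup>2) / 2)"
    using sum_squares_bound[of "norm (Z s \<omega>)" "norm (Z t \<omega>)"] by (intro mult_left_mono) auto
  finally show ?thesis by simp
qed

lemma
  assumes "m \<le> s" "m \<le> t"
  shows weighted_prod_integrable: "integrable M (\<lambda>\<omega>. weighted s \<omega> * weighted t \<omega>)"
    and weighted_prod_le: "expectation (\<lambda>\<omega>. \<bar>weighted s \<omega> * weighted t \<omega>\<bar>) \<le> b\<^sup>2 * (1 + C)"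
proof -
  note [measurable] = weighted_measurable[OF assms(1)] weighted_measurable[OF assms(2)]
  have i: "integrable M (\<lambda>\<omega>. b\<^sup>2 * ((norm (Z s \<omega>))\<^sup>2 + (norm (Z t \<omega>))\<^sup>2) / 2)"
    using Z_square_integrable assms by simp
  show 1: "integrable M (\<lambda>\<omega>. weighted s \<omega> * weighted t \<omega>)"
  proof (rule Bochner_Integration.integrable_bound[OF i])
    have "norm (weighted s \<omega> * weighted t \<omega>) \<le> norm (b\<^sup>2 * ((norm (Z s \<omega>))\<^sup>2 + (norm (Z t \<omega>))\<^sup>2) / 2)" for \<omega>
      unfolding real_norm_def by (rule order_trans[OF weighted_prod_abs_le abs_ge_self])
    then show "AE \<omega> in M. norm (weighted s \<omega> * weighted t \<omega>) \<le> norm (b\<^sup>2 * ((norm (Z s \<omega>))\<^sup>2 + (norm (Z t \<omega>))\<^sup>2) / 2)"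
      by simp
  qed measurable
  have "expectation (\<lambda>\<omega>. \<bar>weighted s \<omega> * weighted t \<omega>\<bar>) \<le> expectation (\<lambda>\<omega>. b\<^sup>2 * ((norm (Z s \<omega>))\<^sup>2 + (norm (Z t \<omega>))\<^sup>2) / 2)"
    by (intro integral_mono i integrable_abs 1 weighted_prod_abs_le)
  also have "\<dots> = b\<^sup>2 * (expectation (\<lambda>\<omega>. (norm (Z s \<omega>))\<^sup>2) + expectation (\<lambda>\<omega>. (norm (Z t \<omega>))\<^sup>2)) / 2"
    using Z_square_integrable assms by simp
  also have "\<dots> \<le> b\<^sup>2 * ((1 + C) + (1 + C)) / 2"
    using Z_square_le assms by (intro divide_right_mono mult_left_mono add_mono) auto
  also have "\<dots> = b\<^sup>2 * (1 + C)" by (simp add: field_simps)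
  finally show "expectation (\<lambda>\<omega>. \<bar>weighted s \<omega> * weighted t \<omega>\<bar>) \<le> b\<^sup>2 * (1 + C)" .
qed

lemma weighted_integrable: assumes "m \<le> t" shows "integrable M (weighted t)"
proof -
  note [measurable] = weighted_measurable[OF assms]
  show ?thesis by (rule square_integrable_imp_integrable) (use weighted_prod_integrable[OF assms assms] in \<open>auto simp: power2_eq_square\<close>)
qed

lemma bounded_times_x_expectation:
  assumes "m \<le> t" and W: "W \<in> borel_measurable (F t)" "\<And>\<omega>. \<omega> \<in> space M \<Longrightarrow> \<bar>W \<omega>\<bar> \<le> w"
  shows "expectation (\<lambda>\<omega>. W \<omega> * weighted t \<omega>) = 0"
  unfolding weighted_def
  by (rule Z_orth[OF assms(1) W(1)])
    (rule integrable_bounded_mult[OF F_measurable[OF W(1)] W(2) weighted_integrable[OF assms(1), unfolded weighted_def[abs_def]]])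

text \<open>The later term is orthogonal to everything known at its origin \<open>t\<close>, and the
  delay \<open>\<tau>\<close> makes \<open>W * weighted s\<close> known there. This product may be
  unbounded; its integrability against \<open>weighted t\<close> comes from second moments.\<close>

lemma weighted_orthogonal:
  assumes "m \<le> s" "s + \<tau> \<le> t"
    and W: "W \<in> borel_measurable (F s)" "\<And>\<omega>. \<omega> \<in> space M \<Longrightarrow> \<bar>W \<omega>\<bar> \<le> w"
  shows "expectation (\<lambda>\<omega>. W \<omega> * (weighted s \<omega> * weighted t \<omega>)) = 0"
proof -
  have W': "W \<in> borel_measurable (F t)" by (rule F_measurable_mono[OF _ W(1)]) (use assms in auto)
  have x': "weighted s \<in> borel_measurable (F t)" by (rule F_measurable_mono[OF _ x_F]) (use assms in auto)
  have mt: "m \<le> t" using assms by simp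
  have i: "integrable M (\<lambda>\<omega>. W \<omega> * (weighted s \<omega> * weighted t \<omega>))"
    by (rule integrable_bounded_mult[OF F_measurable[OF W(1)] W(2) weighted_prod_integrable[OF assms(1) mt]])
  have "expectation (\<lambda>\<omega>. (W \<omega> * weighted s \<omega>) * (a t \<bullet> Z t \<omega>)) = 0"
  proof (rule Z_orth[OF mt])
    show "(\<lambda>\<omega>. W \<omega> * weighted s \<omega>) \<in> borel_measurable (F t)" using W' x' by (rule borel_measurable_times)
    show "integrable M (\<lambda>\<omega>. W \<omega> * weighted s \<omega> * (a t \<bullet> Z t \<omega>))" using i by (simp add: weighted_def mult.assoc)
  qed
  then show ?thesis by (simp add: weighted_def mult.assoc)
qed

text \<open>Only pairs of indices at distance less than \<open>\<tau>\<close> contribute to the expanded square.\<close>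

lemma expectation_weighted_square_le:
  fixes d :: real
  assumes "m \<le> u" "finite I" "I \<subseteq> {u..}"
    and W: "W \<in> borel_measurable (F u)" "\<And>\<omega>. \<omega> \<in> space M \<Longrightarrow> \<bar>W \<omega>\<bar> \<le> w"
    and d: "\<And>s t. s \<in> I \<Longrightarrow> t \<in> I \<Longrightarrow> \<bar>expectation (\<lambda>\<omega>. W \<omega> * (weighted s \<omega> * weighted t \<omega>))\<bar> \<le> d" and "0 \<le> d"
  shows "integrable M (\<lambda>\<omega>. W \<omega> * (\<Sum>t\<in>I. weighted t \<omega>)\<^sup>2)"
    and "\<bar>expectation (\<lambda>\<omega>. W \<omega> * (\<Sum>t\<in>I. weighted t \<omega>)\<^sup>2)\<bar> \<le> 2 * \<tau> * card I * d"
proof -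
  have mI: "m \<le> t" "u \<le> t" if "t \<in> I" for t using that assms by auto
  have WM: "W \<in> borel_measurable M" by (rule F_measurable[OF W(1)])
  have i: "integrable M (\<lambda>\<omega>. W \<omega> * (weighted s \<omega> * weighted t \<omega>))" if "s \<in> I" "t \<in> I" for s t
    by (rule integrable_bounded_mult[OF WM W(2) weighted_prod_integrable]) (use mI that in auto)
  have eq: "W \<omega> * (\<Sum>t\<in>I. weighted t \<omega>)\<^sup>2 = (\<Sum>s\<in>I. \<Sum>t\<in>I. W \<omega> * (weighted s \<omega> * weighted t \<omega>))" for \<omega>
    unfolding power2_eq_square sum_product by (simp add: sum_distrib_left)
  show "integrable M (\<lambda>\<omega>. W \<omega> * (\<Sum>t\<in>I. weighted t \<omega>)\<^sup>2)"
    unfolding eq using i by (intro Bochner_Integration.integrable_sum) auto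
  have 0: "\<bar>expectation (\<lambda>\<omega>. W \<omega> * (weighted s \<omega> * weighted t \<omega>))\<bar> \<le> (if t < s + \<tau> \<and> s < t + \<tau> then d else 0)"
    if st: "s \<in> I" "t \<in> I" for s t
  proof -
    consider "t < s + \<tau> \<and> s < t + \<tau>" | "s + \<tau> \<le> t" | "t + \<tau> \<le> s" by linarith
    then show ?thesis
    proof cases
      case 1 then show ?thesis using d[OF st] by simp
    next
      case 2
      have "expectation (\<lambda>\<omega>. W \<omega> * (weighted s \<omega> * weighted t \<omega>)) = 0"
        by (rule weighted_orthogonal[OF _ 2 F_measurable_mono[OF _ W(1)] W(2)]) (use mI st in auto)
      then show ?thesis using \<open>0 \<le> d\<close> by simp
    next
      case 3
      have "expectation (\<lambda>\<omega>. W \<omega> * (weighted t \<omega> * weighted s \<omega>)) = 0"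
        by (rule weighted_orthogonal[OF _ 3 F_measurable_mono[OF _ W(1)] W(2)]) (use mI st in auto)
      then show ?thesis using \<open>0 \<le> d\<close> by (simp add: mult.commute[of "weighted s _"])
    qed
  qed
  have c: "card {t\<in>I. t < s + \<tau> \<and> s < t + \<tau>} \<le> 2 * \<tau>" for s
  proof -
    \<comment> \<open>\<open>Suc s - \<tau>\<close> is truncated at 0, which can only shorten the
      window of indices at distance less than \<open>\<tau>\<close> from \<open>s\<close>.\<close>
    have "card {t\<in>I. t < s + \<tau> \<and> s < t + \<tau>} \<le> card {Suc s - \<tau>..<s + \<tau>}"
      by (rule card_mono) auto
    then show ?thesis by simp
  qed
  have c': "real (card {t\<in>I. t < s + \<tau> \<and> s < t + \<tau>}) \<le> real (2 * \<tau>)" for s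
    using c[of s] by (rule of_nat_mono)
  have "\<bar>expectation (\<lambda>\<omega>. W \<omega> * (\<Sum>t\<in>I. weighted t \<omega>)\<^sup>2)\<bar>
      = \<bar>\<Sum>s\<in>I. \<Sum>t\<in>I. expectation (\<lambda>\<omega>. W \<omega> * (weighted s \<omega> * weighted t \<omega>))\<bar>"
    unfolding eq using i by (subst Bochner_Integration.integral_sum) (auto simp: Bochner_Integration.integral_sum)
  also have "\<dots> \<le> (\<Sum>s\<in>I. \<bar>\<Sum>t\<in>I. expectation (\<lambda>\<omega>. W \<omega> * (weighted s \<omega> * weighted t \<omega>))\<bar>)"
    by (rule sum_abs)
  also have "\<dots> \<le> (\<Sum>s\<in>I. \<Sum>t\<in>I. (if t < s + \<tau> \<and> s < t + \<tau> then d else 0))"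
    by (rule sum_mono, rule order_trans[OF sum_abs], rule sum_mono) (rule 0)
  also have "\<dots> = (\<Sum>s\<in>I. card {t\<in>I. t < s + \<tau> \<and> s < t + \<tau>} * d)"
    using assms(2) by (intro sum.cong refl) (simp add: sum.If_cases Int_def)
  also have "\<dots> \<le> (\<Sum>s\<in>I. (2 * \<tau>) * d)"
    using \<open>0 \<le> d\<close> by (intro sum_mono mult_right_mono c')
  finally show "\<bar>expectation (\<lambda>\<omega>. W \<omega> * (\<Sum>t\<in>I. weighted t \<omega>)\<^sup>2)\<bar> \<le> 2 * \<tau> * card I * d"
    by (simp add: mult_ac)
qed

lemma
  assumes "finite I" "I \<subseteq> {m..}"
  shows weighted_sum_square_integrable: "integrable M (\<lambda>\<omega>. (\<Sum>t\<in>I. weighted t \<omega>)\<^sup>2)"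
    and weighted_sum_square_le: "expectation (\<lambda>\<omega>. (\<Sum>t\<in>I. weighted t \<omega>)\<^sup>2) \<le> 2 * \<tau> * card I * (b\<^sup>2 * (1 + C))"
proof -
  have d: "\<bar>expectation (\<lambda>\<omega>. 1 * (weighted s \<omega> * weighted t \<omega>))\<bar> \<le> b\<^sup>2 * (1 + C)" if "s \<in> I" "t \<in> I" for s t
  proof -
    have "\<bar>expectation (\<lambda>\<omega>. 1 * (weighted s \<omega> * weighted t \<omega>))\<bar> \<le> expectation (\<lambda>\<omega>. \<bar>weighted s \<omega> * weighted t \<omega>\<bar>)"
      by simp
    also have "\<dots> \<le> b\<^sup>2 * (1 + C)" using that assms by (intro weighted_prod_le) auto
    finally show ?thesis .
  qed
  note * = expectation_weighted_square_le[OF order_refl assms, of "\<lambda>_. 1" 1, OF _ _ d, simplified]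
  show "integrable M (\<lambda>\<omega>. (\<Sum>t\<in>I. weighted t \<omega>)\<^sup>2)" using * C by auto
  show "expectation (\<lambda>\<omega>. (\<Sum>t\<in>I. weighted t \<omega>)\<^sup>2) \<le> 2 * \<tau> * card I * (b\<^sup>2 * (1 + C))"
    using *(2) C by (auto simp: abs_le_iff)
qed

text \<open>The clipping level \<open>b\<^sup>2 * \<kappa>\<^sup>2\<close> is chosen so that it can
  be exceeded only if the larger norm \<open>r\<close> exceeds \<open>\<kappa>\<close>. Then
  \<open>r\<^sup>2\<close> is at most \<open>\<kappa> powr (- \<eta>) * r powr (2 + \<eta>)\<close>,
  which is integrable.\<close>

lemma weighted_prod_truncation_le:
  assumes "0 < \<kappa>"
  shows "\<bar>weighted i \<omega> * weighted j \<omega> - max (- (b\<^sup>2 * \<kappa>\<^sup>2)) (min (b\<^sup>2 * \<kappa>\<^sup>2) (weighted i \<omega> * weighted j \<omega>))\<bar>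
    \<le> b\<^sup>2 * \<kappa> powr (- \<eta>) * (norm (Z i \<omega>) powr (2 + \<eta>) + norm (Z j \<omega>) powr (2 + \<eta>))"
proof (cases "\<bar>weighted i \<omega> * weighted j \<omega>\<bar> \<le> b\<^sup>2 * \<kappa>\<^sup>2")
  case True
  then show ?thesis by (auto simp: abs_le_iff)
next
  case False
  define r where "r = max (norm (Z i \<omega>)) (norm (Z j \<omega>))"
  have r0: "0 \<le> r" unfolding r_def by (simp add: le_max_iff_disj)
  have "\<bar>weighted i \<omega> * weighted j \<omega>\<bar> \<le> (b * norm (Z i \<omega>)) * (b * norm (Z j \<omega>))"
    unfolding abs_mult using b_nonneg by (intro mult_mono weighted_abs_le) auto
  also have "\<dots> \<le> (b * r) * (b * r)" using b_nonneg r0 by (intro mult_mono mult_left_mono mult_nonneg_nonneg) (auto simp: r_def)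
  finally have le: "\<bar>weighted i \<omega> * weighted j \<omega>\<bar> \<le> b\<^sup>2 * r\<^sup>2" by (simp add: power2_eq_square mult_ac)
  with False have "b\<^sup>2 * \<kappa>\<^sup>2 < b\<^sup>2 * r\<^sup>2" by linarith
  then have "\<kappa>\<^sup>2 < r\<^sup>2" by (simp add: mult_less_cancel_left)
  then have kr: "\<kappa> < r" using r0 by (rule power2_less_imp_less)
  have "r\<^sup>2 = r powr (2 + \<eta>) * r powr (- \<eta>)"
    using kr assms by (simp flip: powr_add powr_numeral)
  also have "\<dots> \<le> r powr (2 + \<eta>) * \<kappa> powr (- \<eta>)"
    using kr assms eta by (intro mult_left_mono powr_mono2') auto
  also have "r powr (2 + \<eta>) \<le> norm (Z i \<omega>) powr (2 + \<eta>) + norm (Z j \<omega>) powr (2 + \<eta>)"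
    unfolding r_def by (simp add: max_def)
  finally have r2: "r\<^sup>2 \<le> (norm (Z i \<omega>) powr (2 + \<eta>) + norm (Z j \<omega>) powr (2 + \<eta>)) * \<kappa> powr (- \<eta>)"
    by (simp add: mult_right_mono)
  have "\<bar>weighted i \<omega> * weighted j \<omega> - max (- (b\<^sup>2 * \<kappa>\<^sup>2)) (min (b\<^sup>2 * \<kappa>\<^sup>2) (weighted i \<omega> * weighted j \<omega>))\<bar> \<le> \<bar>weighted i \<omega> * weighted j \<omega>\<bar>"
    using zero_le_mult_iff[of "b\<^sup>2" "\<kappa>\<^sup>2"] by (auto simp: max_def min_def abs_if)
  also note le
  also have "b\<^sup>2 * r\<^sup>2 \<le> b\<^sup>2 * ((norm (Z i \<omega>) powr (2 + \<eta>) + norm (Z j \<omega>) powr (2 + \<eta>)) * \<kappa> powr (- \<eta>))"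
    by (rule mult_left_mono[OF r2]) simp
  finally show ?thesis by (simp add: mult_ac)
qed

text \<open>The first summand is the mixing bound for the clipped product,
  \<open>4 * 1 * (b\<^sup>2 * \<kappa>\<^sup>2) * \<alpha> k\<close>. The second is the clipping
  error: a factor 2 for the centred bounded variable and two moments bounded by \<open>C\<close>. It
  takes the place of Davydov's inequality; \<open>\<kappa>\<close> stays free so that the tail can
  be made small before the gap \<open>k\<close> is chosen.\<close>

definition covariance_bound :: "real \<Rightarrow> nat \<Rightarrow> real" where
  "covariance_bound \<kappa> k = 4 * b\<^sup>2 * (\<kappa>\<^sup>2 * \<alpha> k + C * \<kappa> powr (- \<eta>))"

text \<open>\<open>U\<close> will be the cosine or sine of the sum over all earlier blocks. Both
  later indices lie beyond the gap, so the clipped product is measurable for the future field and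
  the bounded mixing estimate applies to it.\<close>

lemma weighted_prod_covariance_le:
  assumes "m \<le> s" "s + k \<le> i" "s + k \<le> j" "0 < \<kappa>"
    and U: "U \<in> borel_measurable (generated_by M Z {m..s})" "\<And>\<omega>. \<omega> \<in> space M \<Longrightarrow> \<bar>U \<omega>\<bar> \<le> 1"
  shows "\<bar>expectation (\<lambda>\<omega>. (U \<omega> - expectation U) * (weighted i \<omega> * weighted j \<omega>))\<bar> \<le> covariance_bound \<kappa> k"
proof -
  define V where "V = (\<lambda>\<omega>. weighted i \<omega> * weighted j \<omega>)"
  define V' where "V' = (\<lambda>\<omega>. max (- (b\<^sup>2 * \<kappa>\<^sup>2)) (min (b\<^sup>2 * \<kappa>\<^sup>2) (V \<omega>)))"
  have mij: "m \<le> i" "m \<le> j" using assms by auto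
  have UM [measurable]: "U \<in> borel_measurable M" by (rule measurable_from_subalg[OF subalgebra_generated_Z' U(1)])
  have Ui: "integrable M U" by (rule integrable_const_bound[of _ 1]) (use U in auto)
  have EU: "\<bar>expectation U\<bar> \<le> 1"
  proof (rule order_trans[OF integral_abs_bound])
    show "expectation (\<lambda>\<omega>. \<bar>U \<omega>\<bar>) \<le> 1"
      using integral_mono[of M "\<lambda>\<omega>. \<bar>U \<omega>\<bar>" "\<lambda>_. 1"] Ui U(2) by (simp add: prob_space)
  qed
  have Vi: "integrable M V" unfolding V_def by (rule weighted_prod_integrable[OF mij])
  have [measurable]: "V \<in> borel_measurable M" using Vi by auto
  have V'M [measurable]: "V' \<in> borel_measurable M" unfolding V'_def by measurable
  have V'b: "\<bar>V' \<omega>\<bar> \<le> b\<^sup>2 * \<kappa>\<^sup>2" for \<omega>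
    using zero_le_mult_iff[of "b\<^sup>2" "\<kappa>\<^sup>2"] unfolding V'_def by (auto simp: max_def min_def abs_if)
  have V'i: "integrable M V'" by (rule integrable_const_bound[of _ "b\<^sup>2 * \<kappa>\<^sup>2"]) (use V'b in auto)
  have [measurable]: "Z i \<in> borel_measurable (generated_by M Z {s + k..})"
    "Z j \<in> borel_measurable (generated_by M Z {s + k..})"
    by (rule generated_by_measurable; use assms in simp)+
  have V'H: "V' \<in> borel_measurable (generated_by M Z {s + k..})"
    unfolding V'_def V_def weighted_def by measurable
  have "\<bar>expectation (\<lambda>\<omega>. U \<omega> * (V' \<omega> - expectation V'))\<bar> \<le> 4 * 1 * (b\<^sup>2 * \<kappa>\<^sup>2) * \<alpha> k"
    by (rule bounded_covariance_le_mixing[OF subalgebra_generated_Z'[of s] subalgebra_generated_Z[of "s + k"] U V'H V'b mixing])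
      (use assms in auto)
  moreover have "integrable M (\<lambda>\<omega>. U \<omega> * V' \<omega>)" by (rule integrable_bounded_mult[OF UM U(2) V'i])
  then have "expectation (\<lambda>\<omega>. U \<omega> * (V' \<omega> - expectation V')) = expectation (\<lambda>\<omega>. V' \<omega> * (U \<omega> - expectation U))"
    by (rule expectation_centered_swap[OF Ui V'i])
  ultimately have 1: "\<bar>expectation (\<lambda>\<omega>. (U \<omega> - expectation U) * V' \<omega>)\<bar> \<le> 4 * (b\<^sup>2 * \<kappa>\<^sup>2) * \<alpha> k"
    by (simp add: mult.commute)
  define E where "E = (\<lambda>\<omega>. b\<^sup>2 * \<kappa> powr (- \<eta>) * (norm (Z i \<omega>) powr (2 + \<eta>) + norm (Z j \<omega>) powr (2 + \<eta>)))"
  have Ei: "integrable M E" unfolding E_def using Z_moment_integrable mij by simp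
  have VE: "\<bar>V \<omega> - V' \<omega>\<bar> \<le> E \<omega>" for \<omega>
    unfolding V_def V'_def E_def by (rule weighted_prod_truncation_le[OF assms(4)])
  have Ub: "\<bar>U \<omega> - expectation U\<bar> \<le> 2" if "\<omega> \<in> space M" for \<omega> using U(2)[OF that] EU by linarith
  have UV: "integrable M (\<lambda>\<omega>. (U \<omega> - expectation U) * V \<omega>)" "integrable M (\<lambda>\<omega>. (U \<omega> - expectation U) * V' \<omega>)"
    "integrable M (\<lambda>\<omega>. (U \<omega> - expectation U) * (V \<omega> - V' \<omega>))"
    by (rule integrable_bounded_mult[OF _ Ub]; use Vi V'i in simp)+
  have "\<bar>expectation (\<lambda>\<omega>. (U \<omega> - expectation U) * (V \<omega> - V' \<omega>))\<bar>
     \<le> expectation (\<lambda>\<omega>. \<bar>(U \<omega> - expectation U) * (V \<omega> - V' \<omega>)\<bar>)" by (rule integral_abs_bound)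
  also have "\<dots> \<le> expectation (\<lambda>\<omega>. 2 * E \<omega>)"
    by (rule integral_mono[OF integrable_abs[OF UV(3)]])
      (use Ei in \<open>auto simp: abs_mult intro!: mult_mono Ub VE\<close>)
  also have "\<dots> = 2 * (b\<^sup>2 * \<kappa> powr (- \<eta>) * (expectation (\<lambda>\<omega>. norm (Z i \<omega>) powr (2 + \<eta>)) + expectation (\<lambda>\<omega>. norm (Z j \<omega>) powr (2 + \<eta>))))"
    unfolding E_def using Z_moment_integrable mij by simp
  also have "\<dots> \<le> 2 * (b\<^sup>2 * \<kappa> powr (- \<eta>) * (C + C))"
    using Z_moment_le mij by (intro mult_left_mono add_mono) auto
  finally have 2: "\<bar>expectation (\<lambda>\<omega>. (U \<omega> - expectation U) * (V \<omega> - V' \<omega>))\<bar> \<le> 4 * b\<^sup>2 * (C * \<kappa> powr (- \<eta>))"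
    by (simp add: algebra_simps)
  have "expectation (\<lambda>\<omega>. (U \<omega> - expectation U) * V \<omega>) = expectation (\<lambda>\<omega>. (U \<omega> - expectation U) * V' \<omega>)
    + expectation (\<lambda>\<omega>. (U \<omega> - expectation U) * (V \<omega> - V' \<omega>))"
    using UV by (subst Bochner_Integration.integral_add[symmetric]) (auto simp: algebra_simps)
  with 1 2 have "\<bar>expectation (\<lambda>\<omega>. (U \<omega> - expectation U) * V \<omega>)\<bar> \<le> 4 * (b\<^sup>2 * \<kappa>\<^sup>2) * \<alpha> k + 4 * b\<^sup>2 * (C * \<kappa> powr (- \<eta>))"
    by linarith
  also have "\<dots> = covariance_bound \<kappa> k" unfolding covariance_bound_def by (simp add: algebra_simps)
  finally show ?thesis unfolding V_def .
qed

text \<open>The sum is at most \<open>b * card I\<close> times its largest norm, and the power of a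
  maximum is at most the sum of the powers. The dependence on \<open>card I\<close> is wasteful,
  which is harmless for blocks of fixed length: the factor \<open>n powr (- \<eta> / 2)\<close>
  later outweighs it.\<close>

lemma
  assumes "finite I" "I \<subseteq> {m..}"
  shows weighted_sum_moment_integrable: "integrable M (\<lambda>\<omega>. \<bar>\<Sum>t\<in>I. weighted t \<omega>\<bar> powr (2 + \<eta>))"
    and weighted_sum_moment_le: "expectation (\<lambda>\<omega>. \<bar>\<Sum>t\<in>I. weighted t \<omega>\<bar> powr (2 + \<eta>)) \<le> (b * card I) powr (2 + \<eta>) * card I * C"
proof -
  have mI: "m \<le> t" if "t \<in> I" for t using that assms by auto
  have [measurable]: "(\<lambda>\<omega>. \<Sum>t\<in>I. weighted t \<omega>) \<in> borel_measurable M"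
    using mI by (intro borel_measurable_sum) auto
  have i: "integrable M (\<lambda>\<omega>. (b * card I) powr (2 + \<eta>) * (\<Sum>t\<in>I. norm (Z t \<omega>) powr (2 + \<eta>)))"
    using mI by (intro integrable_mult_right Bochner_Integration.integrable_sum Z_moment_integrable) auto
  have le: "\<bar>\<Sum>t\<in>I. weighted t \<omega>\<bar> powr (2 + \<eta>) \<le> (b * card I) powr (2 + \<eta>) * (\<Sum>t\<in>I. norm (Z t \<omega>) powr (2 + \<eta>))" for \<omega>
  proof (cases "I = {}")
    case False
    define r where "r = Max ((\<lambda>t. norm (Z t \<omega>)) ` I)"
    have "r \<in> (\<lambda>t. norm (Z t \<omega>)) ` I" unfolding r_def using False assms by (intro Max_in) auto
    then obtain t0 where t0: "t0 \<in> I" "r = norm (Z t0 \<omega>)" by auto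
    have "\<bar>\<Sum>t\<in>I. weighted t \<omega>\<bar> \<le> (\<Sum>t\<in>I. \<bar>weighted t \<omega>\<bar>)" by (rule sum_abs)
    also have "\<dots> \<le> (\<Sum>t\<in>I. b * r)"
    proof (rule sum_mono)
      fix t assume "t \<in> I"
      then have "norm (Z t \<omega>) \<le> r" unfolding r_def using assms by (intro Max_ge) auto
      then show "\<bar>weighted t \<omega>\<bar> \<le> b * r" using weighted_abs_le[of t \<omega>] mult_left_mono[OF _ b_nonneg] order_trans by blast
    qed
    also have "\<dots> = b * card I * r" by simp
    finally have "\<bar>\<Sum>t\<in>I. weighted t \<omega>\<bar> powr (2 + \<eta>) \<le> (b * card I * r) powr (2 + \<eta>)"
      using eta by (intro powr_mono2) auto
    also have "\<dots> = (b * card I) powr (2 + \<eta>) * norm (Z t0 \<omega>) powr (2 + \<eta>)"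
      using b_nonneg t0 by (simp add: powr_mult)
    also have "\<dots> \<le> (b * card I) powr (2 + \<eta>) * (\<Sum>t\<in>I. norm (Z t \<omega>) powr (2 + \<eta>))"
      using t0 assms by (intro mult_left_mono member_le_sum) auto
    finally show ?thesis .
  qed (use eta in simp)
  show 1: "integrable M (\<lambda>\<omega>. \<bar>\<Sum>t\<in>I. weighted t \<omega>\<bar> powr (2 + \<eta>))"
    by (rule Bochner_Integration.integrable_bound[OF i]) (measurable, rule AE_I2, use le in \<open>auto intro: order_trans[OF _ abs_ge_self]\<close>)
  have "expectation (\<lambda>\<omega>. \<bar>\<Sum>t\<in>I. weighted t \<omega>\<bar> powr (2 + \<eta>))
     \<le> expectation (\<lambda>\<omega>. (b * card I) powr (2 + \<eta>) * (\<Sum>t\<in>I. norm (Z t \<omega>) powr (2 + \<eta>)))"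
    by (rule integral_mono[OF 1 i le])
  also have "\<dots> = (b * card I) powr (2 + \<eta>) * (\<Sum>t\<in>I. expectation (\<lambda>\<omega>. norm (Z t \<omega>) powr (2 + \<eta>)))"
    using mI by (subst integral_mult_right_zero, subst Bochner_Integration.integral_sum) (auto intro: Z_moment_integrable)
  also have "\<dots> \<le> (b * card I) powr (2 + \<eta>) * (\<Sum>t\<in>I. C)"
    using mI by (intro mult_left_mono sum_mono Z_moment_le) auto
  finally show "expectation (\<lambda>\<omega>. \<bar>\<Sum>t\<in>I. weighted t \<omega>\<bar> powr (2 + \<eta>)) \<le> (b * card I) powr (2 + \<eta>) * card I * C"
    by simp
qed

end

end

section \<open>Central limit theorem for weighted sums\<close>

text \<open>Serves to replace the second-order Taylor value \<open>1 - y\<close> by a Gaussian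
  factor. The upper half follows from \<open>exp (- y) \<le> 1 / (1 + y)\<close>.\<close>

lemma abs_one_minus_exp_le:
  fixes y :: real assumes "0 \<le> y" shows "\<bar>1 - y - exp (- y)\<bar> \<le> y\<^sup>2"
proof -
  have 1: "1 - y \<le> exp (- y)" using exp_ge_add_one_self[of "- y"] by simp
  have "exp (- y) \<le> 1 / (1 + y)"
    using exp_ge_add_one_self[of y] assms by (simp add: exp_minus field_simps)
  also have "\<dots> \<le> 1 - y + y\<^sup>2" using assms by (simp add: field_simps power2_eq_square)
  finally show ?thesis using 1 by simp
qed

lemma abs_exp_minus_diff_le:
  fixes a b :: real assumes "0 \<le> a" "0 \<le> b" shows "\<bar>exp (- a) - exp (- b)\<bar> \<le> \<bar>a - b\<bar>"
proof -
  have *: "\<bar>exp (- a) - exp (- b)\<bar> \<le> b - a" if "0 \<le> a" "a \<le> b" for a b :: real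
  proof -
    have "exp (- a) - exp (- b) = exp (- a) * (1 - exp (- (b - a)))" by (simp add: right_diff_distrib flip: exp_add)
    also have "1 - exp (- (b - a)) \<le> b - a" using exp_ge_add_one_self[of "- (b - a)"] by linarith
    then have "exp (- a) * (1 - exp (- (b - a))) \<le> 1 * (b - a)"
      using that by (intro mult_mono) auto
    finally show ?thesis using that by simp
  qed
  show ?thesis using *[of a b] *[of b a] assms by (cases "a \<le> b") (auto simp: abs_minus_commute)
qed

text \<open>Up to \<open>\<delta>\<close> the cubic remainder is at most
  \<open>\<delta> * y\<^sup>2\<close>; beyond \<open>\<delta>\<close> the quadratic remainder
  \<open>y\<^sup>2\<close> is absorbed by the power \<open>2 + \<eta>\<close>. This is the Lindeberg
  dichotomy in a form suited to moments of order \<open>2 + \<eta>\<close>.\<close>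

lemma iexp_quadratic_remainder_le:
  fixes y \<delta> \<eta> :: real
  assumes "0 < \<delta>" "0 < \<eta>"
  shows "cmod (iexp y - (1 + \<i> * y - y\<^sup>2 / 2)) \<le> \<delta> * y\<^sup>2 + \<delta> powr (- \<eta>) * \<bar>y\<bar> powr (2 + \<eta>)"
proof -
  have eq: "(\<Sum>k\<le>2. (\<i> * complex_of_real y) ^ k / fact k) = 1 + \<i> * y - y\<^sup>2 / 2"
    by (simp add: numeral_2_eq_2 power2_eq_square mult_ac flip: of_real_mult)
  show ?thesis
  proof (cases "\<bar>y\<bar> \<le> \<delta>")
    case True
    have "cmod (iexp y - (1 + \<i> * y - y\<^sup>2 / 2)) \<le> \<bar>y\<bar> ^ 3 / fact 3"
      using iexp_approx1[of y 2] unfolding eq by (simp add: numeral_3_eq_3)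
    also have "\<dots> \<le> \<bar>y\<bar> ^ 3" by (simp add: fact_numeral)
    also have "\<dots> = \<bar>y\<bar> * y\<^sup>2" by (simp add: power2_eq_square power3_eq_cube)
    also have "\<dots> \<le> \<delta> * y\<^sup>2" using True by (intro mult_right_mono) auto
    finally show ?thesis using assms by (simp add: add_increasing2)
  next
    case False
    have "cmod (iexp y - (1 + \<i> * y - y\<^sup>2 / 2)) \<le> y\<^sup>2"
      using iexp_approx2[of y 2] unfolding eq by (simp add: fact_numeral)
    also have "y\<^sup>2 = \<bar>y\<bar> powr 2" using False assms by simp
    also have "\<dots> = \<bar>y\<bar> powr (- \<eta>) * \<bar>y\<bar> powr (2 + \<eta>)" by (simp flip: powr_add)
    also have "\<dots> \<le> \<delta> powr (- \<eta>) * \<bar>y\<bar> powr (2 + \<eta>)"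
      using False assms by (intro mult_right_mono powr_mono2') auto
    finally show ?thesis using assms by (simp add: add_increasing)
  qed
qed

context prob_space
begin

text \<open>Orthogonality and mixing are available for real variables; the complex expectation is
  therefore handled through its cosine and sine parts.\<close>

lemma
  fixes V g :: "'a \<Rightarrow> real"
  assumes "V \<in> borel_measurable M" "integrable M g"
  shows integrable_iexp_mult: "integrable M (\<lambda>\<omega>. iexp (V \<omega>) * g \<omega>)"
    and expectation_iexp_mult: "integral\<^sup>L M (\<lambda>\<omega>. iexp (V \<omega>) * g \<omega>)
      = of_real (expectation (\<lambda>\<omega>. cos (V \<omega>) * g \<omega>)) + \<i> * of_real (expectation (\<lambda>\<omega>. sin (V \<omega>) * g \<omega>))"
proof -
  note [measurable] = assms(1)
  have 1: "integrable M (\<lambda>\<omega>. cos (V \<omega>) * g \<omega>)" by (rule integrable_bounded_mult[of _ _ 1]) (use assms in auto)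
  have 2: "integrable M (\<lambda>\<omega>. sin (V \<omega>) * g \<omega>)" by (rule integrable_bounded_mult[of _ _ 1]) (use assms in auto)
  have eq: "iexp (V \<omega>) * g \<omega> = of_real (cos (V \<omega>) * g \<omega>) + \<i> * of_real (sin (V \<omega>) * g \<omega>)" for \<omega>
    by (simp add: exp_Euler cos_of_real sin_of_real algebra_simps)
  show "integrable M (\<lambda>\<omega>. iexp (V \<omega>) * g \<omega>)" unfolding eq
    using 1 2 by (intro Bochner_Integration.integrable_add integrable_mult_right integrable_of_real) auto
  show "integral\<^sup>L M (\<lambda>\<omega>. iexp (V \<omega>) * g \<omega>)
      = of_real (expectation (\<lambda>\<omega>. cos (V \<omega>) * g \<omega>)) + \<i> * of_real (expectation (\<lambda>\<omega>. sin (V \<omega>) * g \<omega>))"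
    unfolding eq using 1 2
    by (subst Bochner_Integration.integral_add)
       (auto simp del: of_real_mult intro!: integrable_mult_right integrable_of_real)
qed

text \<open>\<open>iexp\<close> is 1-Lipschitz, and a distance \<open>d\<close> is at most
  \<open>\<delta> + d\<^sup>2 / \<delta>\<close>. The free \<open>\<delta>\<close> avoids square
  roots of expectations.\<close>

lemma expectation_iexp_diff_le:
  fixes V W :: "'a \<Rightarrow> real"
  assumes [measurable]: "V \<in> borel_measurable M" "W \<in> borel_measurable M"
    and D: "integrable M (\<lambda>\<omega>. (V \<omega> - W \<omega>)\<^sup>2)" and \<delta>: "0 < \<delta>"
  shows "cmod (integral\<^sup>L M (\<lambda>\<omega>. iexp (V \<omega>)) - integral\<^sup>L M (\<lambda>\<omega>. iexp (W \<omega>)))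
    \<le> \<delta> + expectation (\<lambda>\<omega>. (V \<omega> - W \<omega>)\<^sup>2) / \<delta>"
proof -
  have i: "integrable M (\<lambda>\<omega>. iexp (X \<omega>))" if [measurable]: "X \<in> borel_measurable M" for X :: "'a \<Rightarrow> real"
    by (rule integrable_const_bound[of _ 1]) auto
  have le: "cmod (iexp (V \<omega>) - iexp (W \<omega>)) \<le> \<delta> + (V \<omega> - W \<omega>)\<^sup>2 / \<delta>" for \<omega>
  proof -
    have "iexp (V \<omega>) - iexp (W \<omega>) = iexp (W \<omega>) * (iexp (V \<omega> - W \<omega>) - 1)"
      by (simp add: algebra_simps flip: exp_add)
    then have "cmod (iexp (V \<omega>) - iexp (W \<omega>)) = cmod (iexp (V \<omega> - W \<omega>) - 1)" by (simp add: norm_mult)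
    also have "\<dots> \<le> \<bar>V \<omega> - W \<omega>\<bar>" using iexp_approx1[of "V \<omega> - W \<omega>" 0] by simp
    also have "\<dots> \<le> \<delta> + (V \<omega> - W \<omega>)\<^sup>2 / \<delta>"
    proof (cases "\<bar>V \<omega> - W \<omega>\<bar> \<le> \<delta>")
      case False
      then have "\<bar>V \<omega> - W \<omega>\<bar> * \<delta> \<le> \<bar>V \<omega> - W \<omega>\<bar> * \<bar>V \<omega> - W \<omega>\<bar>" by (intro mult_left_mono) auto
      then have "\<bar>V \<omega> - W \<omega>\<bar> \<le> (V \<omega> - W \<omega>)\<^sup>2 / \<delta>" using \<delta> by (simp add: field_simps power2_eq_square)
      then show ?thesis using \<delta> by linarith
    qed (use \<delta> in \<open>simp add: add_increasing2\<close>)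
    finally show ?thesis .
  qed
  have "cmod (integral\<^sup>L M (\<lambda>\<omega>. iexp (V \<omega>)) - integral\<^sup>L M (\<lambda>\<omega>. iexp (W \<omega>)))
    = cmod (integral\<^sup>L M (\<lambda>\<omega>. iexp (V \<omega>) - iexp (W \<omega>)))"
    by (simp add: Bochner_Integration.integral_diff i)
  also have "\<dots> \<le> expectation (\<lambda>\<omega>. cmod (iexp (V \<omega>) - iexp (W \<omega>)))" by (rule integral_norm_bound)
  also have "\<dots> \<le> expectation (\<lambda>\<omega>. \<delta> + (V \<omega> - W \<omega>)\<^sup>2 / \<delta>)"
    using D by (intro integral_mono le) (auto intro!: integrable_norm Bochner_Integration.integrable_diff i)
  also have "\<dots> = \<delta> + expectation (\<lambda>\<omega>. (V \<omega> - W \<omega>)\<^sup>2) / \<delta>" using D by (simp add: prob_space)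
  finally show ?thesis .
qed

end

section \<open>Characteristic function after one further block\<close>

context predictable_mean_zero
begin

context
  fixes a :: "nat \<Rightarrow> 'v" and b :: real
  assumes a_le: "\<And>t. norm (a t) \<le> b"
begin

text \<open>Second-order expansion of the factor that the new block contributes. The four error
  terms are, in order, the failure of the quadratic term to decouple, the two parts of the Taylor
  remainder, and the passage from \<open>1 - c\<^sup>2 * v / 2\<close> to the exponential.
  \<open>V\<close> is a function of \<open>Z\<close> up to time \<open>s\<close>, a gap before
  \<open>u\<close>.\<close>

lemma char_step:
  assumes s: "m \<le> s" "s + k \<le> u" "s + \<tau> \<le> u" and I: "finite I" "I \<subseteq> {u..}"
    and V: "V \<in> borel_measurable (generated_by M Z {m..s})"
    and pos: "0 < \<kappa>" "0 < \<delta>" "0 < c" and D: "0 \<le> covariance_bound b \<kappa> k"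
  defines "v \<equiv> expectation (\<lambda>\<omega>. (\<Sum>t\<in>I. weighted a t \<omega>)\<^sup>2)"
  shows "cmod (integral\<^sup>L M (\<lambda>\<omega>. iexp (V \<omega> + c * (\<Sum>t\<in>I. weighted a t \<omega>)))
       - integral\<^sup>L M (\<lambda>\<omega>. iexp (V \<omega>)) * of_real (exp (- (c\<^sup>2 * v / 2))))
    \<le> c\<^sup>2 * (2 * \<tau> * card I * covariance_bound b \<kappa> k) + \<delta> * (c\<^sup>2 * v)
      + \<delta> powr (- \<eta>) * (c powr (2 + \<eta>) * ((b * card I) powr (2 + \<eta>) * card I * C)) + (c\<^sup>2 * v / 2)\<^sup>2"
proof -
  note a = a_le
  define \<xi> where "\<xi> = (\<lambda>\<omega>. \<Sum>t\<in>I. weighted a t \<omega>)"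
  define D where "D = covariance_bound b \<kappa> k"
  have mu: "m \<le> u" using s by simp
  have Im: "I \<subseteq> {m..}" using I mu by auto
  have [measurable]: "V \<in> borel_measurable M"
    by (rule measurable_from_subalg[OF subalgebra_generated_Z' V])
  have VF: "V \<in> borel_measurable (F u)" by (rule generated_Z_F_measurable[OF V s(3)])
  have weighted: "integrable M (weighted a t)" if "t \<in> I" for t using Im that by (intro weighted_integrable[OF a]) auto
  have \<xi>i: "integrable M \<xi>" unfolding \<xi>_def using weighted by (intro Bochner_Integration.integrable_sum) auto
  have [measurable]: "\<xi> \<in> borel_measurable M" using \<xi>i by auto
  have \<xi>2: "integrable M (\<lambda>\<omega>. (\<xi> \<omega>)\<^sup>2)" unfolding \<xi>_def by (rule weighted_sum_square_integrable[OF a I(1) Im])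
  have \<xi>p: "integrable M (\<lambda>\<omega>. \<bar>\<xi> \<omega>\<bar> powr (2 + \<eta>))" unfolding \<xi>_def by (rule weighted_sum_moment_integrable[OF a I(1) Im])
  have \<xi>p': "expectation (\<lambda>\<omega>. \<bar>\<xi> \<omega>\<bar> powr (2 + \<eta>)) \<le> (b * card I) powr (2 + \<eta>) * card I * C"
    unfolding \<xi>_def by (rule weighted_sum_moment_le[OF a I(1) Im])
  have v_eq: "v = expectation (\<lambda>\<omega>. (\<xi> \<omega>)\<^sup>2)" unfolding v_def \<xi>_def ..
  have v0: "0 \<le> v" unfolding v_def by (rule Bochner_Integration.integral_nonneg) simp
  \<comment> \<open>Every term of the block has an origin not before \<open>u\<close>, so it is
    orthogonal to all bounded \<open>F u\<close>-measurable variables.\<close>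
  have lin: "expectation (\<lambda>\<omega>. W \<omega> * \<xi> \<omega>) = 0"
    if W: "W \<in> borel_measurable (F u)" "\<And>\<omega>. \<bar>W \<omega>\<bar> \<le> 1" for W :: "'a \<Rightarrow> real"
  proof -
    have WM: "W \<in> borel_measurable M" by (rule F_measurable[OF W(1)])
    have "expectation (\<lambda>\<omega>. W \<omega> * \<xi> \<omega>) = (\<Sum>t\<in>I. expectation (\<lambda>\<omega>. W \<omega> * weighted a t \<omega>))"
      unfolding \<xi>_def sum_distrib_left
      by (rule Bochner_Integration.integral_sum) (rule integrable_bounded_mult[OF WM W(2) weighted])
    also have "\<dots> = 0"
    proof (rule sum.neutral, rule ballI)
      fix t assume "t \<in> I"
      then have "u \<le> t" "m \<le> t" using I Im by auto
      then show "expectation (\<lambda>\<omega>. W \<omega> * weighted a t \<omega>) = 0"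
        by (intro bounded_times_x_expectation[OF a _ F_measurable_mono[OF _ W(1)] W(2)]) auto
    qed
    finally show ?thesis .
  qed
  \<comment> \<open>Centring \<open>W\<close> turns the difference into a covariance. The centred
    variable is still known at \<open>u\<close>, so only the pairs closer than \<open>\<tau>\<close>
    contribute and the bound is linear in the block length.\<close>
  have quad: "\<bar>expectation (\<lambda>\<omega>. W \<omega> * (\<xi> \<omega>)\<^sup>2) - expectation W * v\<bar> \<le> 2 * \<tau> * card I * D"
    if W: "W \<in> borel_measurable (generated_by M Z {m..s})" "\<And>\<omega>. \<bar>W \<omega>\<bar> \<le> 1" for W :: "'a \<Rightarrow> real"
  proof -
    have [measurable]: "W \<in> borel_measurable M"
      by (rule measurable_from_subalg[OF subalgebra_generated_Z' W(1)])
    have WF: "W \<in> borel_measurable (F u)" by (rule generated_Z_F_measurable[OF W(1) s(3)])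
    have "integrable M (\<lambda>\<omega>. W \<omega> * (\<xi> \<omega>)\<^sup>2)" by (rule integrable_bounded_mult[OF _ W(2) \<xi>2]) simp
    then have "expectation (\<lambda>\<omega>. W \<omega> * (\<xi> \<omega>)\<^sup>2) - expectation W * v = expectation (\<lambda>\<omega>. (W \<omega> - expectation W) * (\<xi> \<omega>)\<^sup>2)"
      using \<xi>2 unfolding v_eq by (simp add: left_diff_distrib)
    also have "\<bar>\<dots>\<bar> \<le> 2 * \<tau> * card I * D" unfolding \<xi>_def
    proof (rule expectation_weighted_square_le(2)[OF a mu I])
      show "(\<lambda>\<omega>. W \<omega> - expectation W) \<in> borel_measurable (F u)" using WF by simp
      show "\<bar>W \<omega> - expectation W\<bar> \<le> 1 + \<bar>expectation W\<bar>" for \<omega> using W(2)[of \<omega>] by linarith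
      show "\<bar>expectation (\<lambda>\<omega>. (W \<omega> - expectation W) * (weighted a i \<omega> * weighted a j \<omega>))\<bar> \<le> D" if "i \<in> I" "j \<in> I" for i j
        unfolding D_def by (rule weighted_prod_covariance_le[OF a s(1) _ _ pos(1) W]) (use that s I in auto)
    qed (use D in \<open>simp add: D_def\<close>)
    finally show ?thesis .
  qed
  have bd: "\<bar>cos (V \<omega>)\<bar> \<le> 1" "\<bar>sin (V \<omega>)\<bar> \<le> 1" for \<omega> by auto
  define R where "R = (\<lambda>\<omega>. iexp (c * \<xi> \<omega>) - (1 + \<i> * (c * \<xi> \<omega>) - (c * \<xi> \<omega>)\<^sup>2 / 2))"
  define \<phi> where "\<phi> = integral\<^sup>L M (\<lambda>\<omega>. iexp (V \<omega>))"
  define \<phi>2 where "\<phi>2 = integral\<^sup>L M (\<lambda>\<omega>. iexp (V \<omega>) * ((\<xi> \<omega>)\<^sup>2))"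
  have \<phi>le: "cmod \<phi> \<le> 1"
  proof -
    have "cmod \<phi> \<le> expectation (\<lambda>\<omega>. cmod (iexp (V \<omega>)))" unfolding \<phi>_def by (rule integral_norm_bound)
    then show ?thesis by (simp add: prob_space)
  qed
  have \<phi>eq: "\<phi> = of_real (expectation (\<lambda>\<omega>. cos (V \<omega>))) + \<i> * of_real (expectation (\<lambda>\<omega>. sin (V \<omega>)))"
    using expectation_iexp_mult[of V "\<lambda>_. 1"] by (simp add: \<phi>_def)
  have e1: "integral\<^sup>L M (\<lambda>\<omega>. iexp (V \<omega>) * \<xi> \<omega>) = 0"
    using lin[of "\<lambda>\<omega>. cos (V \<omega>)"] lin[of "\<lambda>\<omega>. sin (V \<omega>)"] VF bd by (subst expectation_iexp_mult[OF _ \<xi>i]) auto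
  \<comment> \<open>The outer factor 2 comes from adding the cosine and sine parts; it cancels
    against the \<open>c\<^sup>2 / 2\<close> of the expansion.\<close>
  have e2: "cmod (\<phi>2 - \<phi> * v) \<le> 2 * (2 * \<tau> * card I * D)"
  proof -
    let ?a = "expectation (\<lambda>\<omega>. cos (V \<omega>) * (\<xi> \<omega>)\<^sup>2) - expectation (\<lambda>\<omega>. cos (V \<omega>)) * v"
    let ?b = "expectation (\<lambda>\<omega>. sin (V \<omega>) * (\<xi> \<omega>)\<^sup>2) - expectation (\<lambda>\<omega>. sin (V \<omega>)) * v"
    have "\<phi>2 - \<phi> * v = of_real ?a + \<i> * of_real ?b"
      unfolding \<phi>2_def \<phi>eq by (subst expectation_iexp_mult[OF _ \<xi>2]) (auto simp: algebra_simps)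
    also have "cmod \<dots> \<le> \<bar>?a\<bar> + \<bar>?b\<bar>"
      using norm_triangle_ineq[of "of_real ?a" "\<i> * of_real ?b"] by (simp add: norm_mult del: of_real_diff)
    also have "\<dots> \<le> 2 * \<tau> * card I * D + 2 * \<tau> * card I * D"
      using V bd by (intro add_mono quad) auto
    finally show ?thesis by (simp add: algebra_simps)
  qed
  have Rle: "cmod (R \<omega>) \<le> \<delta> * (c\<^sup>2 * (\<xi> \<omega>)\<^sup>2) + \<delta> powr (- \<eta>) * (c powr (2 + \<eta>) * \<bar>\<xi> \<omega>\<bar> powr (2 + \<eta>))" for \<omega>
    using iexp_quadratic_remainder_le[OF pos(2) eta, of "c * \<xi> \<omega>"] pos(3)
    unfolding R_def by (simp add: power_mult_distrib abs_mult powr_mult)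
  have bi: "integrable M (\<lambda>\<omega>. \<delta> * (c\<^sup>2 * (\<xi> \<omega>)\<^sup>2) + \<delta> powr (- \<eta>) * (c powr (2 + \<eta>) * \<bar>\<xi> \<omega>\<bar> powr (2 + \<eta>)))"
    using \<xi>2 \<xi>p by simp
  have Ri: "integrable M (\<lambda>\<omega>. iexp (V \<omega>) * R \<omega>)"
    by (rule Bochner_Integration.integrable_bound[OF bi])
      (unfold R_def, measurable, rule AE_I2, use Rle in \<open>auto simp: norm_mult R_def intro: order_trans[OF _ abs_ge_self]\<close>)
  have "cmod (integral\<^sup>L M (\<lambda>\<omega>. iexp (V \<omega>) * R \<omega>)) \<le> expectation (\<lambda>\<omega>. cmod (iexp (V \<omega>) * R \<omega>))"
    by (rule integral_norm_bound)
  also have "\<dots> \<le> expectation (\<lambda>\<omega>. \<delta> * (c\<^sup>2 * (\<xi> \<omega>)\<^sup>2) + \<delta> powr (- \<eta>) * (c powr (2 + \<eta>) * \<bar>\<xi> \<omega>\<bar> powr (2 + \<eta>)))"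
    by (rule integral_mono[OF integrable_norm[OF Ri] bi]) (use Rle in \<open>simp add: norm_mult\<close>)
  also have "\<dots> = \<delta> * (c\<^sup>2 * v) + \<delta> powr (- \<eta>) * (c powr (2 + \<eta>) * expectation (\<lambda>\<omega>. \<bar>\<xi> \<omega>\<bar> powr (2 + \<eta>)))"
    using \<xi>2 \<xi>p by (simp add: v_eq)
  also have "\<dots> \<le> \<delta> * (c\<^sup>2 * v) + \<delta> powr (- \<eta>) * (c powr (2 + \<eta>) * ((b * card I) powr (2 + \<eta>) * card I * C))"
    using \<xi>p' by (intro add_left_mono mult_left_mono) auto
  finally have R: "cmod (integral\<^sup>L M (\<lambda>\<omega>. iexp (V \<omega>) * R \<omega>))
    \<le> \<delta> * (c\<^sup>2 * v) + \<delta> powr (- \<eta>) * (c powr (2 + \<eta>) * ((b * card I) powr (2 + \<eta>) * card I * C))" .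
  have exp_eq: "iexp (V \<omega> + c * \<xi> \<omega>) = iexp (V \<omega>) * R \<omega> + (iexp (V \<omega>) + (\<i> * c) * (iexp (V \<omega>) * \<xi> \<omega>)
      - (c\<^sup>2 / 2) * (iexp (V \<omega>) * ((\<xi> \<omega>)\<^sup>2)))" for \<omega>
    unfolding R_def by (simp add: distrib_left exp_add algebra_simps power2_eq_square)
  have Vi: "integrable M (\<lambda>\<omega>. iexp (V \<omega>))" by (rule integrable_const_bound[of _ 1]) auto
  note i1 = integrable_iexp_mult[OF _ \<xi>i, of V] and i2 = integrable_iexp_mult[OF _ \<xi>2, of V]
  have "integral\<^sup>L M (\<lambda>\<omega>. iexp (V \<omega> + c * \<xi> \<omega>)) = integral\<^sup>L M (\<lambda>\<omega>. iexp (V \<omega>) * R \<omega>) + (\<phi> + (\<i> * c) * 0 - (c\<^sup>2 / 2) * \<phi>2)"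
    unfolding exp_eq \<phi>_def \<phi>2_def e1[symmetric] using Ri Vi i1 i2 by simp
  note J = this
  have "integral\<^sup>L M (\<lambda>\<omega>. iexp (V \<omega> + c * \<xi> \<omega>)) - \<phi> * of_real (exp (- (c\<^sup>2 * v / 2)))
     = integral\<^sup>L M (\<lambda>\<omega>. iexp (V \<omega>) * R \<omega>) - (c\<^sup>2 / 2) * (\<phi>2 - \<phi> * v) + \<phi> * of_real (1 - c\<^sup>2 * v / 2 - exp (- (c\<^sup>2 * v / 2)))"
    unfolding J by (simp add: algebra_simps diff_divide_distrib)
  also have "cmod \<dots> \<le> cmod (integral\<^sup>L M (\<lambda>\<omega>. iexp (V \<omega>) * R \<omega>)) + c\<^sup>2 / 2 * cmod (\<phi>2 - \<phi> * v)
      + cmod \<phi> * \<bar>1 - c\<^sup>2 * v / 2 - exp (- (c\<^sup>2 * v / 2))\<bar>"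
  proof -
    have "cmod (p - (c\<^sup>2 / 2) * q + \<phi> * of_real r) \<le> cmod p + c\<^sup>2 / 2 * cmod q + cmod \<phi> * \<bar>r\<bar>" for p q :: complex and r :: real
    proof -
      have "cmod (p - (c\<^sup>2 / 2) * q + \<phi> * of_real r) \<le> cmod p + cmod ((c\<^sup>2 / 2) * q) + cmod (\<phi> * of_real r)"
        by (meson add_right_mono norm_triangle_ineq norm_triangle_ineq4 order_trans)
      then show ?thesis by (simp add: norm_mult norm_divide norm_power)
    qed
    then show ?thesis .
  qed
  also have "\<dots> \<le> (\<delta> * (c\<^sup>2 * v) + \<delta> powr (- \<eta>) * (c powr (2 + \<eta>) * ((b * card I) powr (2 + \<eta>) * card I * C)))
     + c\<^sup>2 / 2 * (2 * (2 * \<tau> * card I * D)) + 1 * (c\<^sup>2 * v / 2)\<^sup>2"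
    using v0 by (intro add_mono R mult_mono e2 \<phi>le abs_one_minus_exp_le) auto
  finally show ?thesis unfolding \<phi>_def \<xi>_def D_def by (simp add: algebra_simps)
qed

end
end

section \<open>Blocks separated by gaps\<close>

context predictable_mean_zero
begin

lemma alpha_nonneg: "0 \<le> \<alpha> k"
  using mixing[of m "{}" "{}" k] by simp

context
  fixes a :: "nat \<Rightarrow> 'v" and b :: real
  assumes a_le: "\<And>t. norm (a t) \<le> b"
begin

lemma covariance_bound_nonneg: "0 \<le> covariance_bound b \<kappa> k"
  unfolding covariance_bound_def[OF a_le] using alpha_nonneg C by simp

definition variance_const :: real where "variance_const = 2 * \<tau> * (b\<^sup>2 * (1 + C))"

lemma variance_const_nonneg: "0 \<le> variance_const"
  unfolding variance_const_def using C by simp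

lemma weighted_sum_square_le': "finite I \<Longrightarrow> I \<subseteq> {m..} \<Longrightarrow> expectation (\<lambda>\<omega>. (\<Sum>t\<in>I. weighted a t \<omega>)\<^sup>2) \<le> variance_const * card I"
  using weighted_sum_square_le[OF a_le, of I] by (simp add: variance_const_def mult_ac)

text \<open>All cross products have distance at least \<open>\<tau>\<close>, so variances add
  exactly. The Gaussian factors of successive blocks then multiply to the factor of the whole sum,
  without a further error.\<close>

lemma weighted_sum_square_Un:
  assumes I: "finite I" "I \<subseteq> {m..s}" and J: "finite J" "J \<subseteq> {u..}" and su: "s + \<tau> \<le> u" "s < u"
  shows "expectation (\<lambda>\<omega>. (\<Sum>t\<in>I \<union> J. weighted a t \<omega>)\<^sup>2)
    = expectation (\<lambda>\<omega>. (\<Sum>t\<in>I. weighted a t \<omega>)\<^sup>2) + expectation (\<lambda>\<omega>. (\<Sum>t\<in>J. weighted a t \<omega>)\<^sup>2)"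
proof (cases "I = {}")
  case False
  then have ms: "m \<le> s" using I by force
  have mI: "m \<le> t" if "t \<in> I" for t using that I by auto
  have mJ: "m \<le> t" if "t \<in> J" for t using that J ms su by auto
  have i: "integrable M (\<lambda>\<omega>. weighted a t \<omega> * weighted a t' \<omega>)" if "t \<in> I" "t' \<in> J" for t t'
    by (rule weighted_prod_integrable[OF a_le mI[OF that(1)] mJ[OF that(2)]])
  have "expectation (\<lambda>\<omega>. (\<Sum>t\<in>I. weighted a t \<omega>) * (\<Sum>t\<in>J. weighted a t \<omega>))
    = (\<Sum>t\<in>I. \<Sum>t'\<in>J. expectation (\<lambda>\<omega>. weighted a t \<omega> * weighted a t' \<omega>))"
    unfolding sum_product using i by (simp add: Bochner_Integration.integral_sum)
  also have "\<dots> = 0"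
  proof (intro sum.neutral ballI)
    fix t t' assume t: "t \<in> I" "t' \<in> J"
    then have "t \<le> s" "u \<le> t'" using I J by auto
    then have tt': "t + \<tau> \<le> t'" using su by simp
    have "expectation (\<lambda>\<omega>. 1 * (weighted a t \<omega> * weighted a t' \<omega>)) = 0"
      by (rule weighted_orthogonal[OF a_le mI[OF t(1)] tt', of _ 1]) auto
    then show "expectation (\<lambda>\<omega>. weighted a t \<omega> * weighted a t' \<omega>) = 0" by simp
  qed
  finally have 0: "expectation (\<lambda>\<omega>. (\<Sum>t\<in>I. weighted a t \<omega>) * (\<Sum>t\<in>J. weighted a t \<omega>)) = 0" .
  have i': "integrable M (\<lambda>\<omega>. (\<Sum>t\<in>I. weighted a t \<omega>) * (\<Sum>t\<in>J. weighted a t \<omega>))"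
    unfolding sum_product using i by (intro Bochner_Integration.integrable_sum) auto
  have sI: "integrable M (\<lambda>\<omega>. (\<Sum>t\<in>I. weighted a t \<omega>)\<^sup>2)" "integrable M (\<lambda>\<omega>. (\<Sum>t\<in>J. weighted a t \<omega>)\<^sup>2)"
    using mI mJ I J by (auto intro!: weighted_sum_square_integrable[OF a_le])
  have "I \<inter> J = {}" using I J su by force
  then have "(\<Sum>t\<in>I \<union> J. weighted a t \<omega>)\<^sup>2 = (\<Sum>t\<in>I. weighted a t \<omega>)\<^sup>2 + (\<Sum>t\<in>J. weighted a t \<omega>)\<^sup>2 + 2 * ((\<Sum>t\<in>I. weighted a t \<omega>) * (\<Sum>t\<in>J. weighted a t \<omega>))" for \<omega>
    using I J by (simp add: sum.union_disjoint power2_sum)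
  then show ?thesis using sI i' 0 by simp
qed simp

text \<open>The one-block error with \<open>card I = p\<close> and the variance replaced by its
  linear bound \<open>variance_const * p\<close>, so that it is the same for all blocks.\<close>

definition block_error :: "real \<Rightarrow> real \<Rightarrow> real \<Rightarrow> nat \<Rightarrow> nat \<Rightarrow> real" where
  "block_error c \<kappa> \<delta> p g = c\<^sup>2 * (2 * \<tau> * p * covariance_bound b \<kappa> g) + \<delta> * (c\<^sup>2 * (variance_const * p))
      + \<delta> powr (- \<eta>) * (c powr (2 + \<eta>) * ((b * p) powr (2 + \<eta>) * p * C)) + (c\<^sup>2 * (variance_const * p) / 2)\<^sup>2"

text \<open>Each period of length \<open>p + g\<close> begins with its gap. Hence the block of
  period \<open>j\<close> starts \<open>g\<close> after \<open>m + j * (p + g)\<close>, a time that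
  is at least \<open>m\<close> and bounds all earlier blocks, so the induction step is the same for
  \<open>j = 0\<close>.\<close>

definition blocks :: "nat \<Rightarrow> nat \<Rightarrow> nat \<Rightarrow> nat set" where
  "blocks p g j = (\<Union>i<j. {m + i * (p + g) + g..<m + Suc i * (p + g)})"

lemma blocks_Suc: "blocks p g (Suc j) = blocks p g j \<union> {m + j * (p + g) + g..<m + Suc j * (p + g)}"
  unfolding blocks_def by (simp add: lessThan_Suc Un_commute)

lemma blocks_subset: "blocks p g j \<subseteq> {m..<m + j * (p + g)}"
proof (induction j)
  case (Suc j) then show ?case unfolding blocks_Suc by auto
qed (simp add: blocks_def)

lemma finite_blocks: "finite (blocks p g j)" unfolding blocks_def by simp

lemma card_blocks: "card (blocks p g j) = j * p"
proof (induction j)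
  case (Suc j)
  have "blocks p g j \<inter> {m + j * (p + g) + g..<m + Suc j * (p + g)} = {}"
    using blocks_subset[of p g j] by auto
  then show ?case unfolding blocks_Suc using Suc by (subst card_Un_disjoint) (auto simp: finite_blocks)
qed (simp add: blocks_def)

text \<open>Errors add up instead of compounding, because the error inherited from the first
  \<open>j\<close> blocks is multiplied by a Gaussian factor that is at most 1.\<close>

lemma char_blocks:
  assumes p: "0 < p" and g: "\<tau> \<le> g" "0 < g" and pos: "0 < \<kappa>" "0 < \<delta>" "0 < c"
  shows "cmod (integral\<^sup>L M (\<lambda>\<omega>. iexp (c * (\<Sum>t\<in>blocks p g j. weighted a t \<omega>)))
       - of_real (exp (- (c\<^sup>2 * expectation (\<lambda>\<omega>. (\<Sum>t\<in>blocks p g j. weighted a t \<omega>)\<^sup>2) / 2))))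
    \<le> j * block_error c \<kappa> \<delta> p g"
proof (induction j)
  case 0
  then show ?case by (simp add: blocks_def prob_space)
next
  case (Suc j)
  define V where "V = (\<lambda>\<omega>. c * (\<Sum>t\<in>blocks p g j. weighted a t \<omega>))"
  define I where "I = {m + j * (p + g) + g..<m + Suc j * (p + g)}"
  define s where "s = m + j * (p + g)"
  define A where "A = c\<^sup>2 * expectation (\<lambda>\<omega>. (\<Sum>t\<in>blocks p g j. weighted a t \<omega>)\<^sup>2) / 2"
  define v where "v = expectation (\<lambda>\<omega>. (\<Sum>t\<in>I. weighted a t \<omega>)\<^sup>2)"
  have Ip: "card I = p" "finite I" "I \<subseteq> {s + g..}" unfolding I_def s_def by auto
  have disj: "blocks p g j \<inter> I = {}" using blocks_subset[of p g j] unfolding I_def by auto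
  have bs: "blocks p g j \<subseteq> {m..s}" using blocks_subset[of p g j] unfolding s_def by auto
  have Vm: "V \<in> borel_measurable (generated_by M Z {m..s})"
    unfolding V_def weighted_def[OF a_le]
    by (intro borel_measurable_times borel_measurable_sum borel_measurable_inner borel_measurable_const generated_by_measurable)
      (use bs in auto)
  have "I \<subseteq> {m..}" using Ip unfolding s_def by auto
  then have v: "v \<le> variance_const * p" unfolding v_def using weighted_sum_square_le'[OF Ip(2)] Ip(1) by simp
  have v0: "0 \<le> v" unfolding v_def by (rule Bochner_Integration.integral_nonneg) simp
  have sq: "expectation (\<lambda>\<omega>. (\<Sum>t\<in>blocks p g (Suc j). weighted a t \<omega>)\<^sup>2) = expectation (\<lambda>\<omega>. (\<Sum>t\<in>blocks p g j. weighted a t \<omega>)\<^sup>2) + v"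
    unfolding blocks_Suc v_def I_def[symmetric]
    by (rule weighted_sum_square_Un[OF finite_blocks bs Ip(2,3)]) (use g in auto)
  have Veq: "c * (\<Sum>t\<in>blocks p g (Suc j). weighted a t \<omega>) = V \<omega> + c * (\<Sum>t\<in>I. weighted a t \<omega>)" for \<omega>
    unfolding blocks_Suc V_def I_def[symmetric] using disj Ip(2) by (simp add: sum.union_disjoint finite_blocks distrib_left)
  have "cmod (integral\<^sup>L M (\<lambda>\<omega>. iexp (V \<omega> + c * (\<Sum>t\<in>I. weighted a t \<omega>))) - integral\<^sup>L M (\<lambda>\<omega>. iexp (V \<omega>)) * of_real (exp (- (c\<^sup>2 * v / 2))))
    \<le> c\<^sup>2 * (2 * \<tau> * p * covariance_bound b \<kappa> g) + \<delta> * (c\<^sup>2 * v)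
      + \<delta> powr (- \<eta>) * (c powr (2 + \<eta>) * ((b * p) powr (2 + \<eta>) * p * C)) + (c\<^sup>2 * v / 2)\<^sup>2"
    using char_step[OF a_le _ _ _ Ip(2,3) Vm pos covariance_bound_nonneg] g unfolding Ip(1) v_def s_def by auto
  also have "\<dots> \<le> block_error c \<kappa> \<delta> p g"
    unfolding block_error_def using v v0 pos
    by (intro add_mono mult_left_mono power_mono divide_right_mono order_refl) auto
  finally have 1: "cmod (integral\<^sup>L M (\<lambda>\<omega>. iexp (V \<omega> + c * (\<Sum>t\<in>I. weighted a t \<omega>))) - integral\<^sup>L M (\<lambda>\<omega>. iexp (V \<omega>)) * of_real (exp (- (c\<^sup>2 * v / 2)))) \<le> block_error c \<kappa> \<delta> p g" .
  have "cmod ((integral\<^sup>L M (\<lambda>\<omega>. iexp (V \<omega>)) - of_real (exp (- A))) * of_real (exp (- (c\<^sup>2 * v / 2)))) \<le> j * block_error c \<kappa> \<delta> p g * 1"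
    unfolding norm_mult
  proof (rule mult_mono)
    show "cmod (integral\<^sup>L M (\<lambda>\<omega>. iexp (V \<omega>)) - of_real (exp (- A))) \<le> j * block_error c \<kappa> \<delta> p g"
      using Suc unfolding V_def A_def .
    then show "0 \<le> j * block_error c \<kappa> \<delta> p g" using norm_ge_zero order_trans by blast
  qed (use v0 in auto)
  with 1 have "cmod ((integral\<^sup>L M (\<lambda>\<omega>. iexp (V \<omega> + c * (\<Sum>t\<in>I. weighted a t \<omega>))) - integral\<^sup>L M (\<lambda>\<omega>. iexp (V \<omega>)) * of_real (exp (- (c\<^sup>2 * v / 2))))
     + (integral\<^sup>L M (\<lambda>\<omega>. iexp (V \<omega>)) - of_real (exp (- A))) * of_real (exp (- (c\<^sup>2 * v / 2)))) \<le> block_error c \<kappa> \<delta> p g + j * block_error c \<kappa> \<delta> p g * 1"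
    by (intro norm_triangle_le add_mono)
  moreover have "of_real (exp (- A)) * of_real (exp (- (c\<^sup>2 * v / 2))) = complex_of_real (exp (- (c\<^sup>2 * (expectation (\<lambda>\<omega>. (\<Sum>t\<in>blocks p g j. weighted a t \<omega>)\<^sup>2) + v) / 2)))"
    unfolding A_def by (simp flip: of_real_mult exp_add add: algebra_simps add_divide_distrib del: of_real_exp)
  ultimately show ?case unfolding Veq sq by (simp add: left_diff_distrib algebra_simps)
qed

text \<open>Three comparisons: the full sum with the sum over blocks, the latter with a Gaussian of
  the same variance, and the two variances. \<open>\<rho>\<close> bounds the proportion of indices
  outside the blocks, \<open>g / p\<close> from the gaps and \<open>(p + g) / n\<close> from the
  incomplete last period.\<close>

lemma char_weighted_sum_bound:
  fixes n :: nat
  assumes p: "0 < p" and g: "\<tau> \<le> g" "0 < g" and pos: "0 < \<kappa>" "0 < \<delta>" and n: "0 < n"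
  defines "\<rho> \<equiv> real g / p + real (p + g) / n"
  shows "cmod (integral\<^sup>L M (\<lambda>\<omega>. iexp ((\<Sum>t\<in>{m..<m + n}. weighted a t \<omega>) / sqrt n))
       - of_real (exp (- (expectation (\<lambda>\<omega>. (\<Sum>t\<in>{m..<m + n}. weighted a t \<omega>)\<^sup>2) / n / 2))))
    \<le> 2 * \<tau> * covariance_bound b \<kappa> g + \<delta> * variance_const
      + \<delta> powr (- \<eta>) * (real n powr (- \<eta> / 2) * ((b * p) powr (2 + \<eta>) * C)) + variance_const\<^sup>2 * p / (4 * n)
      + (\<delta> + variance_const * \<rho> / \<delta>) + (\<delta> * variance_const + (1 + 1 / \<delta>) * (variance_const * \<rho>)) / 2"
proof -
  define k where "k = n div (p + g)"
  define J where "J = blocks p g k"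
  define R where "R = {m..<m + n} - J"
  define S where "S = (\<lambda>\<omega>. \<Sum>t\<in>{m..<m + n}. weighted a t \<omega>)"
  define V where "V = (\<lambda>\<omega>. \<Sum>t\<in>J. weighted a t \<omega>)"
  define r where "r = (\<lambda>\<omega>. \<Sum>t\<in>R. weighted a t \<omega>)"
  define K where "K = variance_const"
  have K0: "0 \<le> K" unfolding K_def by (rule variance_const_nonneg)
  have kn: "k * (p + g) \<le> n" unfolding k_def by (rule div_times_less_eq_dividend)
  have Jsub: "J \<subseteq> {m..<m + n}" using blocks_subset[of p g k] kn unfolding J_def by auto
  have fin: "finite J" "finite R" unfolding J_def R_def by (auto simp: finite_blocks)
  have sub: "J \<subseteq> {m..}" "R \<subseteq> {m..}" using Jsub unfolding R_def by auto
  have S_eq: "S \<omega> = V \<omega> + r \<omega>" for \<omega>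
    unfolding S_def V_def r_def R_def using Jsub fin(1) by (subst sum.subset_diff[of J]) auto
  have kpn: "k * p \<le> n" using kn by (simp add: add_mult_distrib2)
  have cR: "card R = n - k * p" unfolding R_def using Jsub fin(1) by (simp add: card_Diff_subset J_def card_blocks)
  have kp: "real k \<le> real n / p"
    using kpn p by (simp add: pos_le_divide_eq flip: of_nat_mult)
  have R\<rho>: "real (card R) \<le> \<rho> * n"
  proof -
    have "n < k * (p + g) + (p + g)" unfolding k_def using p dividend_less_div_times[of "p + g" n] by (simp add: add.commute)
    then have "card R \<le> k * g + (p + g)" unfolding cR by (simp add: algebra_simps)
    then have "real (card R) \<le> real k * g + real (p + g)" by (metis of_nat_add of_nat_le_iff of_nat_mult)
    also have "\<dots> \<le> real n / p * g + real (p + g)" using kp by (intro add_right_mono mult_right_mono) auto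
    also have "\<dots> = \<rho> * n" unfolding \<rho>_def using n by (simp add: field_simps)
    finally show ?thesis .
  qed
  have \<rho>0: "0 \<le> \<rho>" unfolding \<rho>_def by simp
  have [measurable]: "S \<in> borel_measurable M" "V \<in> borel_measurable M"
    unfolding S_def V_def using sub by (auto intro!: borel_measurable_sum weighted_measurable[OF a_le])
  have V2: "integrable M (\<lambda>\<omega>. (V \<omega>)\<^sup>2)" unfolding V_def by (rule weighted_sum_square_integrable[OF a_le fin(1) sub(1)])
  have r2: "integrable M (\<lambda>\<omega>. (r \<omega>)\<^sup>2)" unfolding r_def by (rule weighted_sum_square_integrable[OF a_le fin(2) sub(2)])
  have S2: "integrable M (\<lambda>\<omega>. (S \<omega>)\<^sup>2)" unfolding S_def by (rule weighted_sum_square_integrable[OF a_le]) auto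
  have EV: "expectation (\<lambda>\<omega>. (V \<omega>)\<^sup>2) \<le> K * n"
  proof -
    have "expectation (\<lambda>\<omega>. (V \<omega>)\<^sup>2) \<le> K * card J" unfolding V_def K_def by (rule weighted_sum_square_le'[OF fin(1) sub(1)])
    also have "card J \<le> n" using kpn by (simp add: J_def card_blocks)
    then have "K * card J \<le> K * n" using K0 by (intro mult_left_mono) auto
    finally show ?thesis .
  qed
  have Er: "expectation (\<lambda>\<omega>. (r \<omega>)\<^sup>2) \<le> K * (\<rho> * n)"
    using weighted_sum_square_le'[OF fin(2) sub(2)] mult_left_mono[OF R\<rho> K0] unfolding r_def K_def by linarith
  have nn: "0 \<le> expectation (\<lambda>\<omega>. (V \<omega>)\<^sup>2)" "0 \<le> expectation (\<lambda>\<omega>. (S \<omega>)\<^sup>2)"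
    by (rule Bochner_Integration.integral_nonneg, simp)+
  have c: "(1 / sqrt n)\<^sup>2 = 1 / real n" using n by (simp add: power_divide)
  \<comment> \<open>With \<open>c = 1 / sqrt n\<close> each block contributes a remainder of order
    \<open>n powr (- \<eta> / 2) / n\<close>; after summing over at most \<open>n / p\<close> blocks
    the power \<open>- \<eta> / 2\<close> survives.\<close>
  have cp: "(1 / sqrt n) powr (2 + \<eta>) = real n powr (- \<eta> / 2) / n"
  proof -
    have "1 / sqrt n = real n powr (- (1 / 2))" by (simp only: powr_minus_divide powr_half_sqrt of_nat_0_le_iff)
    then have "(1 / sqrt n) powr (2 + \<eta>) = real n powr (- (1 / 2) * (2 + \<eta>))" by (simp only: powr_powr)
    also have "- (1 / 2) * (2 + \<eta>) = - \<eta> / 2 - 1" by (simp add: field_simps)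
    also have "real n powr (- \<eta> / 2 - 1) = real n powr (- \<eta> / 2) / n" using n by (simp only: powr_diff) simp
    finally show ?thesis .
  qed
  let ?\<phi>S = "integral\<^sup>L M (\<lambda>\<omega>. iexp (S \<omega> / sqrt n))" and ?\<phi>V = "integral\<^sup>L M (\<lambda>\<omega>. iexp (V \<omega> / sqrt n))"
  have eqr: "(S \<omega> / sqrt n - V \<omega> / sqrt n)\<^sup>2 = (r \<omega>)\<^sup>2 / n" for \<omega>
    by (simp add: S_eq power_divide flip: diff_divide_distrib)
  have "integrable M (\<lambda>\<omega>. (S \<omega> / sqrt n - V \<omega> / sqrt n)\<^sup>2)" unfolding eqr using r2 by simp
  then have "cmod (?\<phi>S - ?\<phi>V) \<le> \<delta> + expectation (\<lambda>\<omega>. (S \<omega> / sqrt n - V \<omega> / sqrt n)\<^sup>2) / \<delta>"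
    by (intro expectation_iexp_diff_le pos(2)) measurable
  also have "expectation (\<lambda>\<omega>. (S \<omega> / sqrt n - V \<omega> / sqrt n)\<^sup>2) = expectation (\<lambda>\<omega>. (r \<omega>)\<^sup>2) / n"
    unfolding eqr by simp
  also have "\<delta> + expectation (\<lambda>\<omega>. (r \<omega>)\<^sup>2) / n / \<delta> \<le> \<delta> + K * \<rho> / \<delta>"
    using Er n pos by (intro add_left_mono divide_right_mono) (auto simp: divide_le_eq mult_ac)
  finally have 1: "cmod (?\<phi>S - ?\<phi>V) \<le> \<delta> + K * \<rho> / \<delta>" .
  have "cmod (?\<phi>V - of_real (exp (- (expectation (\<lambda>\<omega>. (V \<omega>)\<^sup>2) / n / 2)))) \<le> k * block_error (1 / sqrt n) \<kappa> \<delta> p g"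
    using char_blocks[OF p g pos, of "1 / sqrt n" k] n unfolding J_def[symmetric] V_def c by simp
  also have "\<dots> \<le> real n / p * block_error (1 / sqrt n) \<kappa> \<delta> p g"
    using pos C K0 covariance_bound_nonneg unfolding block_error_def K_def[symmetric]
    by (intro mult_right_mono kp add_nonneg_nonneg mult_nonneg_nonneg) auto
  also have "\<dots> = 2 * \<tau> * covariance_bound b \<kappa> g + \<delta> * K
      + \<delta> powr (- \<eta>) * (real n powr (- \<eta> / 2) * ((b * p) powr (2 + \<eta>) * C)) + K\<^sup>2 * p / (4 * n)"
    unfolding block_error_def c cp K_def[symmetric] using n p by (simp add: field_simps power2_eq_square)
  finally have 2: "cmod (?\<phi>V - of_real (exp (- (expectation (\<lambda>\<omega>. (V \<omega>)\<^sup>2) / n / 2))))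
     \<le> 2 * \<tau> * covariance_bound b \<kappa> g + \<delta> * K
      + \<delta> powr (- \<eta>) * (real n powr (- \<eta> / 2) * ((b * p) powr (2 + \<eta>) * C)) + K\<^sup>2 * p / (4 * n)" .
  \<comment> \<open>\<open>S\<^sup>2 - V\<^sup>2 = 2 * V * r + r\<^sup>2\<close>, and the cross term
    is split with weight \<open>\<delta>\<close>, so that the large \<open>V\<close> carries a small
    factor and the small \<open>r\<close> a large one.\<close>
  have pw: "\<bar>(S \<omega>)\<^sup>2 - (V \<omega>)\<^sup>2\<bar> \<le> \<delta> * (V \<omega>)\<^sup>2 + (1 + 1 / \<delta>) * (r \<omega>)\<^sup>2" for \<omega>
  proof -
    have "0 \<le> (\<delta> * \<bar>V \<omega>\<bar> - \<bar>r \<omega>\<bar>)\<^sup>2" by simp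
    then have "2 * \<delta> * (\<bar>V \<omega>\<bar> * \<bar>r \<omega>\<bar>) \<le> \<delta>\<^sup>2 * (V \<omega>)\<^sup>2 + (r \<omega>)\<^sup>2" by (simp add: power2_diff power_mult_distrib)
    then have "2 * \<bar>V \<omega> * r \<omega>\<bar> \<le> \<delta> * (V \<omega>)\<^sup>2 + (r \<omega>)\<^sup>2 / \<delta>"
      using pos by (simp add: field_simps power2_eq_square abs_mult)
    moreover have "(S \<omega>)\<^sup>2 - (V \<omega>)\<^sup>2 = 2 * (V \<omega> * r \<omega>) + (r \<omega>)\<^sup>2" unfolding S_eq by (simp add: power2_sum)
    moreover have "(1 + 1 / \<delta>) * (r \<omega>)\<^sup>2 = (r \<omega>)\<^sup>2 + (r \<omega>)\<^sup>2 / \<delta>" by (simp add: distrib_right)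
    moreover have "0 \<le> (r \<omega>)\<^sup>2" by simp
    ultimately show ?thesis
      using abs_ge_self[of "V \<omega> * r \<omega>"] abs_ge_minus_self[of "V \<omega> * r \<omega>"] unfolding abs_le_iff by linarith
  qed
  have "\<bar>expectation (\<lambda>\<omega>. (S \<omega>)\<^sup>2) - expectation (\<lambda>\<omega>. (V \<omega>)\<^sup>2)\<bar> = \<bar>expectation (\<lambda>\<omega>. (S \<omega>)\<^sup>2 - (V \<omega>)\<^sup>2)\<bar>"
    using S2 V2 by simp
  also have "\<dots> \<le> expectation (\<lambda>\<omega>. \<bar>(S \<omega>)\<^sup>2 - (V \<omega>)\<^sup>2\<bar>)" by (rule integral_abs_bound)
  also have "\<dots> \<le> expectation (\<lambda>\<omega>. \<delta> * (V \<omega>)\<^sup>2 + (1 + 1 / \<delta>) * (r \<omega>)\<^sup>2)"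
    using S2 V2 r2 by (intro integral_mono pw) auto
  also have "\<dots> = \<delta> * expectation (\<lambda>\<omega>. (V \<omega>)\<^sup>2) + (1 + 1 / \<delta>) * expectation (\<lambda>\<omega>. (r \<omega>)\<^sup>2)" using V2 r2 by simp
  also have "\<dots> \<le> \<delta> * (K * n) + (1 + 1 / \<delta>) * (K * (\<rho> * n))"
    using EV Er pos by (intro add_mono mult_left_mono) auto
  finally have SV: "\<bar>expectation (\<lambda>\<omega>. (S \<omega>)\<^sup>2) - expectation (\<lambda>\<omega>. (V \<omega>)\<^sup>2)\<bar> \<le> (\<delta> * K + (1 + 1 / \<delta>) * (K * \<rho>)) * n"
    by (simp add: algebra_simps)
  have "cmod (complex_of_real (exp (- (expectation (\<lambda>\<omega>. (V \<omega>)\<^sup>2) / n / 2))) - of_real (exp (- (expectation (\<lambda>\<omega>. (S \<omega>)\<^sup>2) / n / 2))))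
     \<le> \<bar>expectation (\<lambda>\<omega>. (V \<omega>)\<^sup>2) / n / 2 - expectation (\<lambda>\<omega>. (S \<omega>)\<^sup>2) / n / 2\<bar>"
    unfolding of_real_diff[symmetric] norm_of_real using nn by (intro abs_exp_minus_diff_le) auto
  also have "\<dots> = \<bar>expectation (\<lambda>\<omega>. (S \<omega>)\<^sup>2) - expectation (\<lambda>\<omega>. (V \<omega>)\<^sup>2)\<bar> / n / 2"
    by (simp add: abs_minus_commute flip: diff_divide_distrib)
  also have "\<dots> \<le> (\<delta> * K + (1 + 1 / \<delta>) * (K * \<rho>)) / 2"
    using SV n by (intro divide_right_mono) (auto simp: divide_le_eq)
  finally have 3: "cmod (complex_of_real (exp (- (expectation (\<lambda>\<omega>. (V \<omega>)\<^sup>2) / n / 2))) - of_real (exp (- (expectation (\<lambda>\<omega>. (S \<omega>)\<^sup>2) / n / 2))))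
     \<le> (\<delta> * K + (1 + 1 / \<delta>) * (K * \<rho>)) / 2" .
  show ?thesis using norm_triangle_le[OF add_mono[OF norm_triangle_le[OF add_mono[OF 1 2]] 3]]
    unfolding S_def[symmetric] K_def[symmetric] by (simp add: S_def algebra_simps)
qed

end

text \<open>Block length \<open>p\<close> and gap \<open>g\<close> stay fixed while \<open>n\<close> grows, so \<open>\<alpha> \<longlonglongrightarrow> 0\<close> suffices and no rate is
  needed; the parameters are chosen in the order \<open>\<delta>\<close>, \<open>\<kappa>\<close>, \<open>g\<close>, \<open>p\<close>.\<close>

theorem char_weighted_sum_tendsto:
  fixes a :: "nat \<Rightarrow> nat \<Rightarrow> 'v"
  assumes a: "\<And>n t. norm (a n t) \<le> b"
    and v: "(\<lambda>n. expectation (\<lambda>\<omega>. (\<Sum>t\<in>{m..<m + n}. a n t \<bullet> Z t \<omega>)\<^sup>2) / n) \<longlonglongrightarrow> v"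
  shows "(\<lambda>n. integral\<^sup>L M (\<lambda>\<omega>. iexp ((\<Sum>t\<in>{m..<m + n}. a n t \<bullet> Z t \<omega>) / sqrt n))) \<longlonglongrightarrow> of_real (exp (- v / 2))"
proof -
  note weighted = weighted_def[OF a]
  define K where "K = variance_const b"
  have K0: "0 \<le> K" unfolding K_def by (rule variance_const_nonneg[OF a])
  define S where "S = (\<lambda>n \<omega>. \<Sum>t\<in>{m..<m + n}. a n t \<bullet> Z t \<omega>)"
  define w where "w = (\<lambda>n. of_real (exp (- (expectation (\<lambda>\<omega>. (S n \<omega>)\<^sup>2) / n / 2))) :: complex)"
  have "(\<lambda>n. integral\<^sup>L M (\<lambda>\<omega>. iexp (S n \<omega> / sqrt n)) - w n) \<longlonglongrightarrow> 0"
  proof (rule LIMSEQ_I)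
    fix \<epsilon> :: real assume \<epsilon>: "0 < \<epsilon>"
    \<comment> \<open>Dividing by \<open>K + 1\<close> bounds the three terms
      \<open>\<delta> * K\<close>, \<open>\<delta>\<close> and \<open>\<delta> * K / 2\<close> of
      the estimate at once and covers \<open>K = 0\<close>.\<close>
    define \<delta> where "\<delta> = \<epsilon> / 8 / (K + 1)"
    have \<delta>: "0 < \<delta>" unfolding \<delta>_def using \<epsilon> K0 by simp
    have \<delta>1: "\<delta> * K + \<delta> + \<delta> * K / 2 < \<epsilon> / 4"
    proof -
      have "\<delta> * K + \<delta> = \<delta> * (K + 1)" by (simp add: distrib_left)
      also have "\<dots> = \<epsilon> / 8" using nonzero_eq_divide_eq[of "K + 1" \<delta> "\<epsilon> / 8"] \<delta>_def K0 by linarith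
      finally have "\<delta> * K + \<delta> = \<epsilon> / 8" .
      moreover have "0 \<le> \<delta> * K" using \<delta> K0 by simp
      ultimately show ?thesis using \<epsilon> \<delta> by linarith
    qed
    have "((\<lambda>\<kappa>. 2 * \<tau> * (4 * b\<^sup>2 * (C * \<kappa> powr (- \<eta>)))) \<longlongrightarrow> 2 * \<tau> * (4 * b\<^sup>2 * (C * 0))) at_top"
      by (intro tendsto_intros tendsto_neg_powr filterlim_ident) (use eta in auto)
    then have "\<forall>\<^sub>F \<kappa> in at_top. 2 * \<tau> * (4 * b\<^sup>2 * (C * \<kappa> powr (- \<eta>))) < \<epsilon> / 8"
      by (rule order_tendstoD(2)) (use \<epsilon> in simp)
    then have "\<forall>\<^sub>F \<kappa> in at_top. 2 * \<tau> * (4 * b\<^sup>2 * (C * \<kappa> powr (- \<eta>))) < \<epsilon> / 8 \<and> 0 < \<kappa>"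
      by (intro eventually_conj eventually_gt_at_top)
    then obtain \<kappa> :: real where \<kappa>: "2 * \<tau> * (4 * b\<^sup>2 * (C * \<kappa> powr (- \<eta>))) < \<epsilon> / 8" "0 < \<kappa>"
      using eventually_happens by force
    have "(\<lambda>g. 2 * \<tau> * (4 * b\<^sup>2 * (\<kappa>\<^sup>2 * \<alpha> g))) \<longlonglongrightarrow> 2 * \<tau> * (4 * b\<^sup>2 * (\<kappa>\<^sup>2 * 0))"
      by (intro tendsto_intros alpha)
    then have "\<forall>\<^sub>F g in sequentially. 2 * \<tau> * (4 * b\<^sup>2 * (\<kappa>\<^sup>2 * \<alpha> g)) < \<epsilon> / 8"
      by (rule order_tendstoD(2)) (use \<epsilon> in simp)
    then have "\<forall>\<^sub>F g in sequentially. 2 * \<tau> * (4 * b\<^sup>2 * (\<kappa>\<^sup>2 * \<alpha> g)) < \<epsilon> / 8 \<and> \<tau> + 1 \<le> g"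
      by (intro eventually_conj eventually_ge_at_top)
    then obtain g where g: "2 * \<tau> * (4 * b\<^sup>2 * (\<kappa>\<^sup>2 * \<alpha> g)) < \<epsilon> / 8" "\<tau> \<le> g" "0 < g"
      using eventually_happens by fastforce
    have D: "2 * \<tau> * covariance_bound b \<kappa> g < \<epsilon> / 4"
      using g(1) \<kappa>(1) unfolding covariance_bound_def[OF a] by (simp add: algebra_simps)
    have "(\<lambda>p. K * (real g / p) / \<delta> + (1 + 1 / \<delta>) * (K * (real g / p)) / 2) \<longlonglongrightarrow> K * 0 / \<delta> + (1 + 1 / \<delta>) * (K * 0) / 2"
      by (intro tendsto_intros lim_const_over_n) (use \<delta> in auto)
    then have "\<forall>\<^sub>F p in sequentially. K * (real g / real p) / \<delta> + (1 + 1 / \<delta>) * (K * (real g / p)) / 2 < \<epsilon> / 4"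
      by (rule order_tendstoD(2)) (use \<epsilon> in simp)
    then have "\<forall>\<^sub>F p in sequentially. K * (real g / real p) / \<delta> + (1 + 1 / \<delta>) * (K * (real g / p)) / 2 < \<epsilon> / 4 \<and> 0 < p"
      by (intro eventually_conj eventually_gt_at_top)
    then obtain p :: nat where p: "K * (real g / real p) / \<delta> + (1 + 1 / \<delta>) * (K * (real g / p)) / 2 < \<epsilon> / 4" "0 < p"
      using eventually_happens by force
    define \<rho> where "\<rho> = (\<lambda>n. real g / p + real (p + g) / real n)"
    define B where "B = (\<lambda>n. 2 * \<tau> * covariance_bound b \<kappa> g + \<delta> * K
      + \<delta> powr (- \<eta>) * (real n powr (- \<eta> / 2) * ((b * p) powr (2 + \<eta>) * C)) + K\<^sup>2 * p / (4 * real n)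
      + (\<delta> + K * \<rho> n / \<delta>) + (\<delta> * K + (1 + 1 / \<delta>) * (K * \<rho> n)) / 2)"
    have \<rho>lim: "\<rho> \<longlonglongrightarrow> real g / p + 0" unfolding \<rho>_def by (intro tendsto_intros lim_const_over_n)
    have n0: "(\<lambda>n. real n powr (- \<eta> / 2)) \<longlonglongrightarrow> 0"
      using eta by (intro tendsto_neg_powr filterlim_real_sequentially) auto
    have n1: "(\<lambda>n. K\<^sup>2 * p / (4 * real n)) \<longlonglongrightarrow> 0"
      using lim_const_over_n[of "K\<^sup>2 * p / 4"] by simp
    \<comment> \<open>The terms with a negative power of \<open>n\<close> vanish and
      \<open>\<rho>\<close> tends to \<open>g / p\<close>. Three groups remain, each below
      \<open>\<epsilon> / 4\<close>.\<close>
    have "B \<longlonglongrightarrow> 2 * \<tau> * covariance_bound b \<kappa> g + \<delta> * K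
      + \<delta> powr (- \<eta>) * (0 * ((b * p) powr (2 + \<eta>) * C)) + 0
      + (\<delta> + K * (real g / p + 0) / \<delta>) + (\<delta> * K + (1 + 1 / \<delta>) * (K * (real g / p + 0))) / 2"
      unfolding B_def by (intro tendsto_intros \<rho>lim n0 n1) (use \<delta> in auto)
    moreover have "2 * \<tau> * covariance_bound b \<kappa> g + \<delta> * K
      + \<delta> powr (- \<eta>) * (0 * ((b * p) powr (2 + \<eta>) * C)) + 0
      + (\<delta> + K * (real g / p + 0) / \<delta>) + (\<delta> * K + (1 + 1 / \<delta>) * (K * (real g / p + 0))) / 2 < \<epsilon>"
      using D \<delta>1 p(1) \<epsilon> unfolding add_0_right mult_zero_left mult_zero_right add_divide_distrib by linarith
    ultimately have "\<forall>\<^sub>F n in sequentially. B n < \<epsilon>" by (rule order_tendstoD(2))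
    then have "\<forall>\<^sub>F n in sequentially. B n < \<epsilon> \<and> 0 < n" by (intro eventually_conj eventually_gt_at_top)
    then obtain n0 where n0: "\<And>n. n0 \<le> n \<Longrightarrow> B n < \<epsilon> \<and> 0 < n" unfolding eventually_sequentially by blast
    have "norm (integral\<^sup>L M (\<lambda>\<omega>. iexp (S n \<omega> / sqrt n)) - w n - 0) < \<epsilon>" if "n0 \<le> n" for n
    proof -
      have "norm (integral\<^sup>L M (\<lambda>\<omega>. iexp (S n \<omega> / sqrt n)) - w n) \<le> B n"
        using char_weighted_sum_bound[where a = "a n" and n = n, OF a p(2) g(2,3) \<kappa>(2) \<delta>] n0[OF that]
        unfolding S_def w_def weighted B_def \<rho>_def K_def by simp
      then show ?thesis using n0[OF that] by simp
    qed
    then show "\<exists>no. \<forall>n\<ge>no. norm (integral\<^sup>L M (\<lambda>\<omega>. iexp (S n \<omega> / sqrt n)) - w n - 0) < \<epsilon>" by blast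
  qed
  moreover have "w \<longlonglongrightarrow> of_real (exp (- (v / 2)))"
    unfolding w_def using v unfolding S_def[symmetric] by (intro tendsto_intros) (auto simp: S_def)
  ultimately show ?thesis
    using tendsto_add[of "\<lambda>n. integral\<^sup>L M (\<lambda>\<omega>. iexp (S n \<omega> / sqrt n)) - w n" 0 sequentially w] by (simp add: S_def)
qed

end

section \<open>Convergence of finitely many coordinates\<close>

text \<open>Real counterparts of linear combinations of exponentials. Sums and multiples generate
  the set, so convergence of expectations passes to all of it by linearity; closure under products,
  which Stone-Weierstrass requires, is proved separately. Vectors are functions on the naturals of
  which the first \<open>l\<close> values matter, so \<open>l\<close> can be chosen inside a
  proof.\<close>

inductive_set trig :: "nat \<Rightarrow> ((nat \<Rightarrow> 'v::euclidean_space) \<Rightarrow> real) set" for l where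
  trig_cos: "(\<lambda>x. cos (\<Sum>i<l. u i \<bullet> x i)) \<in> trig l"
| trig_sin: "(\<lambda>x. sin (\<Sum>i<l. u i \<bullet> x i)) \<in> trig l"
| trig_add: "f \<in> trig l \<Longrightarrow> g \<in> trig l \<Longrightarrow> (\<lambda>x. f x + g x) \<in> trig l"
| trig_scale: "f \<in> trig l \<Longrightarrow> (\<lambda>x. c * f x) \<in> trig l"

lemma trig_const: "(\<lambda>x. c) \<in> trig l"
  using trig_scale[OF trig_cos[of "\<lambda>_. 0" l], of c] by simp

lemma linear_form_add_diff:
  fixes u v x :: "nat \<Rightarrow> 'v::euclidean_space"
  shows "(\<Sum>i<l. u i \<bullet> x i) + (\<Sum>i<l. v i \<bullet> x i) = (\<Sum>i<l. (u i + v i) \<bullet> x i)"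
    and "(\<Sum>i<l. u i \<bullet> x i) - (\<Sum>i<l. v i \<bullet> x i) = (\<Sum>i<l. (u i - v i) \<bullet> x i)"
  by (simp_all add: inner_add_left inner_diff_left sum.distrib sum_subtractf)

text \<open>Product-to-sum formulas: sums and differences of linear forms are linear forms, whose
  cosines and sines are again generators.\<close>

lemma trig_mult_basic:
  assumes "f \<in> trig l"
  shows "(\<lambda>x. f x * cos (\<Sum>i<l. u i \<bullet> x i)) \<in> trig l" and "(\<lambda>x. f x * sin (\<Sum>i<l. u i \<bullet> x i)) \<in> trig l"
proof -
  let ?L = "\<lambda>u (x :: nat \<Rightarrow> 'a). \<Sum>i<l. u i \<bullet> x i"
  have cosI: "(\<lambda>x. cos (?L v x + ?L w x)) \<in> trig l" "(\<lambda>x. cos (?L v x - ?L w x)) \<in> trig l" for v w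
    unfolding linear_form_add_diff by (rule trig_cos)+
  have sinI: "(\<lambda>x. sin (?L v x + ?L w x)) \<in> trig l" "(\<lambda>x. sin (?L v x - ?L w x)) \<in> trig l" for v w
    unfolding linear_form_add_diff by (rule trig_sin)+
  have "(\<lambda>x. f x * cos (?L u x)) \<in> trig l \<and> (\<lambda>x. f x * sin (?L u x)) \<in> trig l"
    using assms
  proof induction
    case (trig_cos v)
    show ?case
      using trig_scale[OF trig_add[OF cosI(2)[of v u] cosI(1)[of v u]], of "1 / 2"]
        trig_scale[OF trig_add[OF sinI(1)[of v u] trig_scale[OF sinI(2)[of v u], of "- 1"]], of "1 / 2"]
      by (simp add: cos_times_cos cos_times_sin)
  next
    case (trig_sin v)
    show ?case
      using trig_scale[OF trig_add[OF sinI(1)[of v u] sinI(2)[of v u]], of "1 / 2"]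
        trig_scale[OF trig_add[OF cosI(2)[of v u] trig_scale[OF cosI(1)[of v u], of "- 1"]], of "1 / 2"]
      by (simp add: sin_times_cos sin_times_sin)
  next
    case (trig_add f g)
    then show ?case by (auto simp: distrib_right intro: trig.trig_add)
  next
    case (trig_scale f c)
    then show ?case by (auto simp: mult.assoc intro: trig.trig_scale)
  qed
  then show "(\<lambda>x. f x * cos (?L u x)) \<in> trig l" "(\<lambda>x. f x * sin (?L u x)) \<in> trig l" by auto
qed

lemma trig_mult:
  assumes f: "f \<in> trig l" and g: "g \<in> trig l" shows "(\<lambda>x. f x * g x) \<in> trig l"
  using g
proof induction
  case (trig_add g h)
  then show ?case by (auto simp: distrib_left intro: trig.trig_add)
next
  case (trig_scale g c)
  from trig.trig_scale[OF trig_scale.IH, of c] show ?case by (simp add: mult_ac)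
qed (intro trig_mult_basic f)+

lemma trig_polynomial:
  assumes "real_polynomial_function p" "f \<in> trig l" shows "(\<lambda>x. p (f x)) \<in> trig l"
  using assms(1)
proof induction
  case (linear p)
  then obtain c where "p = (\<lambda>x. x * c)" by (metis real_bounded_linear)
  then show ?case using trig_scale[OF assms(2), of c] by (simp add: mult.commute)
qed (auto intro: trig_const trig_add trig_mult)

lemma continuous_on_trig:
  assumes "f \<in> trig l" shows "continuous_on UNIV f"
  using assms
proof induction
  case (trig_cos u)
  show ?case by (intro continuous_intros continuous_on_product_coordinates)
next
  case (trig_sin u)
  show ?case by (intro continuous_intros continuous_on_product_coordinates)
qed (auto intro: continuous_intros)

lemma trig_bounded:
  assumes "f \<in> trig l" shows "\<exists>G. \<forall>x. \<bar>f x\<bar> \<le> G"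
  using assms
proof induction
  case (trig_add f g)
  then obtain F G where "\<forall>x. \<bar>f x\<bar> \<le> F" "\<forall>x. \<bar>g x\<bar> \<le> G" by auto
  then have "\<forall>x. \<bar>f x + g x\<bar> \<le> F + G" by (meson abs_triangle_ineq add_mono order_trans)
  then show ?case by blast
next
  case (trig_scale f c)
  then obtain F where "\<forall>x. \<bar>f x\<bar> \<le> F" by auto
  then have "\<forall>x. \<bar>c * f x\<bar> \<le> \<bar>c\<bar> * F" by (auto simp: abs_mult intro: mult_left_mono)
  then show ?case by blast
qed (auto intro: exI[of _ 1])

text \<open>Coordinates from \<open>l\<close> on are fixed to 0. This makes the box compact in the
  product topology and lets functions of the first \<open>l\<close> coordinates separate its
  points.\<close>

definition coord_box :: "nat \<Rightarrow> real \<Rightarrow> (nat \<Rightarrow> 'v::euclidean_space) set" where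
  "coord_box l K = {x. (\<forall>i<l. norm (x i) \<le> K) \<and> (\<forall>i\<ge>l. x i = 0)}"

lemma compact_coord_box: "compact (coord_box l K :: (nat \<Rightarrow> 'a::euclidean_space) set)"
proof -
  have "(coord_box l K :: (nat \<Rightarrow> 'a) set) = Pi\<^sub>E UNIV (\<lambda>i. if i < l then cball 0 K else {0})"
  proof (rule set_eqI)
    fix x :: "nat \<Rightarrow> 'a"
    have 1: "x i \<in> (if i < l then cball 0 K else {0}) \<longleftrightarrow> (if i < l then norm (x i) \<le> K else x i = 0)" for i
      by (cases "i < l") simp_all
    have "x \<in> Pi\<^sub>E UNIV (\<lambda>i. if i < l then cball 0 K else {0}) \<longleftrightarrow> (\<forall>i. if i < l then norm (x i) \<le> K else x i = 0)"
      unfolding PiE_UNIV_domain Pi_iff by (simp only: 1 ball_UNIV)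
    then show "x \<in> coord_box l K \<longleftrightarrow> x \<in> Pi\<^sub>E UNIV (\<lambda>i. if i < l then cball 0 K else {0})"
      unfolding coord_box_def mem_Collect_eq if_bool_eq_conj not_less by blast
  qed
  moreover have "compactin (product_topology (\<lambda>i. euclidean) UNIV) (Pi\<^sub>E UNIV (\<lambda>i::nat. if i < l then cball 0 K else {0::'a}))"
    unfolding compactin_PiE by auto
  ultimately show ?thesis by (simp add: euclidean_product_topology)
qed

text \<open>A linear form is scaled so that its values at the two points differ by exactly 1. Equal
  cosines and sines would give \<open>cos 1 = 1\<close>.\<close>

lemma trig_separates:
  fixes x y :: "nat \<Rightarrow> 'v::euclidean_space"
  assumes "x \<in> coord_box l K" "y \<in> coord_box l K" "x \<noteq> y"
  shows "\<exists>f\<in>trig l. f x \<noteq> f y"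
proof (rule ccontr)
  assume "\<not> ?thesis"
  then have eq: "f x = f y" if "f \<in> trig l" for f using that by auto
  obtain i where i: "x i \<noteq> y i" using assms(3) by auto
  then have il: "i < l" using assms by (auto simp: coord_box_def not_less[symmetric])
  define w where "w = x i - y i"
  define u where "u = (\<lambda>j. if j = i then (1 / (w \<bullet> w)) *\<^sub>R w else 0)"
  have L: "(\<Sum>j<l. u j \<bullet> z j) = (1 / (w \<bullet> w)) * (w \<bullet> z i)" for z
  proof -
    have "(\<Sum>j<l. u j \<bullet> z j) = (\<Sum>j<l. if j = i then (1 / (w \<bullet> w)) * (w \<bullet> z i) else 0)"
      by (rule sum.cong) (auto simp: u_def)
    then show ?thesis using il by simp
  qed
  have ww: "w \<bullet> w \<noteq> 0" using i by (simp add: w_def)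
  define p q where "p = (1 / (w \<bullet> w)) * (w \<bullet> x i)" and "q = (1 / (w \<bullet> w)) * (w \<bullet> y i)"
  have "p - q = (1 / (w \<bullet> w)) * (w \<bullet> x i - w \<bullet> y i)" unfolding p_def q_def by (rule right_diff_distrib[symmetric])
  also have "w \<bullet> x i - w \<bullet> y i = w \<bullet> w" by (simp add: w_def inner_diff_right)
  finally have "p - q = (1 / (w \<bullet> w)) * (w \<bullet> w)" .
  then have pq: "p - q = 1" using ww by simp
  have "cos p = cos q" "sin p = sin q"
    using eq[OF trig_cos[of u]] eq[OF trig_sin[of u]] unfolding L p_def q_def by auto
  then have "cos (p - q) = 1" by (simp add: cos_diff flip: power2_eq_square)
  moreover have "cos (1 :: real) < cos 0" using pi_gt3 by (intro cos_monotone_0_pi) auto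
  ultimately show False unfolding pq by simp
qed

text \<open>Composing with a polynomial that approximates a truncation keeps the approximant bounded
  outside the box.\<close>

lemma trig_approximation:
  fixes \<Phi> :: "(nat \<Rightarrow> 'v::euclidean_space) \<Rightarrow> real"
  assumes \<Phi>: "continuous_on UNIV \<Phi>" "\<And>x. \<bar>\<Phi> x\<bar> \<le> c" and e: "0 < e"
  obtains h where "h \<in> trig l" "\<And>x. x \<in> coord_box l K \<Longrightarrow> \<bar>\<Phi> x - h x\<bar> \<le> 2 * e" "\<And>x. \<bar>h x\<bar> \<le> c + e"
proof -
  have "\<exists>g. g \<in> trig l \<and> (\<forall>x\<in>coord_box l K. \<bar>\<Phi> x - g x\<bar> < e)"
  proof (rule Stone_Weierstrass_HOL[where P = "\<lambda>f. f \<in> trig l"])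
    show "compact (coord_box l K :: (nat \<Rightarrow> 'v) set)" by (rule compact_coord_box)
    show "continuous_on (coord_box l K) \<Phi>" using \<Phi>(1) by (rule continuous_on_subset) simp
    show "\<exists>f. f \<in> trig l \<and> f x \<noteq> f y" if "x \<in> coord_box l K \<and> y \<in> coord_box l K \<and> x \<noteq> y" for x y :: "nat \<Rightarrow> 'v"
      using trig_separates[of x l K y] that by blast
    show "continuous_on (coord_box l K) f" if "f \<in> trig l" for f :: "(nat \<Rightarrow> 'v) \<Rightarrow> real"
      using continuous_on_trig[OF that] by (rule continuous_on_subset) simp
  qed (auto intro: trig_const trig_add trig_mult e)
  then obtain g where g: "g \<in> trig l" "\<And>x. x \<in> coord_box l K \<Longrightarrow> \<bar>\<Phi> x - g x\<bar> < e" by blast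
  obtain G where G: "\<And>x. \<bar>g x\<bar> \<le> G" using trig_bounded[OF g(1)] by blast
  \<comment> \<open>Truncation to the range allowed for \<open>\<Phi>\<close> does not increase the
    distance to \<open>\<Phi>\<close>, and its polynomial approximation is required only on the
    bounded range of \<open>g\<close>.\<close>
  define t where "t = (\<lambda>y. max (- c) (min c y))"
  have "0 \<le> c" using abs_ge_zero \<Phi>(2) by (rule order_trans)
  obtain p where p: "real_polynomial_function p" "\<And>y. y \<in> {-G..G} \<Longrightarrow> \<bar>t y - p y\<bar> < e"
  proof (rule Stone_Weierstrass_real_polynomial_function[of "{-G..G}" t e])
    show "continuous_on {-G..G} t" unfolding t_def by (intro continuous_intros)
  qed (use e in auto)
  have gG: "g x \<in> {-G..G}" for x using G[of x] by auto
  show ?thesis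
  proof (rule that)
    show "(\<lambda>x. p (g x)) \<in> trig l" by (rule trig_polynomial[OF p(1) g(1)])
    show "\<bar>\<Phi> x - p (g x)\<bar> \<le> 2 * e" if "x \<in> coord_box l K" for x
    proof -
      have "\<bar>\<Phi> x - t (g x)\<bar> \<le> \<bar>\<Phi> x - g x\<bar>" using \<Phi>(2)[of x] unfolding t_def by auto
      then show ?thesis using p(2)[OF gG[of x]] g(2)[OF that] by linarith
    qed
    show "\<bar>p (g x)\<bar> \<le> c + e" for x
    proof -
      have "\<bar>t (g x)\<bar> \<le> c" using \<open>0 \<le> c\<close> unfolding t_def by auto
      then show ?thesis using p(2)[OF gG[of x]] by linarith
    qed
  qed
qed

lemma (in prob_space) expectation_diff_le:
  fixes f h :: "'a \<Rightarrow> real"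
  assumes "integrable M f" "integrable M h" "B \<in> sets M"
    and "\<And>\<omega>. \<omega> \<in> space M \<Longrightarrow> \<bar>f \<omega> - h \<omega>\<bar> \<le> a + b * indicator B \<omega>"
  shows "\<bar>expectation f - expectation h\<bar> \<le> a + b * prob B"
proof -
  have iB: "integrable M (\<lambda>\<omega>. a + b * indicator B \<omega>)"
    by (intro Bochner_Integration.integrable_add integrable_mult_right integrable_const integrable_const_bound[of _ 1])
      (use assms(3) in auto)
  have iB': "integrable M (indicator B :: 'a \<Rightarrow> real)" by (rule integrable_const_bound[of _ 1]) (use assms(3) in auto)
  have "\<bar>expectation f - expectation h\<bar> = \<bar>expectation (\<lambda>\<omega>. f \<omega> - h \<omega>)\<bar>" using assms by simp
  also have "\<dots> \<le> expectation (\<lambda>\<omega>. \<bar>f \<omega> - h \<omega>\<bar>)" by (rule integral_abs_bound)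
  also have "\<dots> \<le> expectation (\<lambda>\<omega>. a + b * indicator B \<omega>)"
    using assms by (intro integral_mono iB) auto
  also have "\<dots> = a + b * prob B" using assms(3) iB' by (simp add: prob_space)
  finally show ?thesis .
qed

lemma (in prob_space) integrable_bounded_continuous:
  fixes \<Phi> :: "(nat \<Rightarrow> 'v::euclidean_space) \<Rightarrow> real"
  assumes \<Phi>: "continuous_on UNIV \<Phi>" "\<And>x. \<bar>\<Phi> x\<bar> \<le> c" and X: "\<And>i. (\<lambda>\<omega>. X \<omega> i) \<in> borel_measurable M"
  shows "integrable M (\<lambda>\<omega>. \<Phi> (X \<omega>))"
proof (rule integrable_const_bound[of _ c])
  have "X \<in> borel_measurable M" using X by (rule measurable_coordinatewise_then_product)
  then show "(\<lambda>\<omega>. \<Phi> (X \<omega>)) \<in> borel_measurable M"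
    using borel_measurable_continuous_onI[OF \<Phi>(1)] by (rule measurable_compose)
qed (use \<Phi>(2) in auto)

lemma trig_expectation_tendsto:
  fixes X :: "nat \<Rightarrow> 'a \<Rightarrow> nat \<Rightarrow> 'v::euclidean_space" and Y :: "'b \<Rightarrow> nat \<Rightarrow> 'v"
  assumes "prob_space M" "prob_space N"
    and X: "\<And>n i. (\<lambda>\<omega>. X n \<omega> i) \<in> borel_measurable M" and Y: "\<And>i. (\<lambda>\<omega>. Y \<omega> i) \<in> borel_measurable N"
    and char: "\<And>u. (\<lambda>n. integral\<^sup>L M (\<lambda>\<omega>. iexp (\<Sum>i<l. u i \<bullet> X n \<omega> i))) \<longlonglongrightarrow> integral\<^sup>L N (\<lambda>\<omega>. iexp (\<Sum>i<l. u i \<bullet> Y \<omega> i))"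
    and f: "f \<in> trig l"
  shows "(\<lambda>n. integral\<^sup>L M (\<lambda>\<omega>. f (X n \<omega>))) \<longlonglongrightarrow> integral\<^sup>L N (\<lambda>\<omega>. f (Y \<omega>))"
proof -
  interpret M: prob_space M by fact
  interpret N: prob_space N by fact
  have iM: "integrable M (\<lambda>\<omega>. f (X n \<omega>))" if "f \<in> trig l" for f n
    using trig_bounded[OF that] continuous_on_trig[OF that] M.integrable_bounded_continuous X by blast
  have iN: "integrable N (\<lambda>\<omega>. f (Y \<omega>))" if "f \<in> trig l" for f
    using trig_bounded[OF that] continuous_on_trig[OF that] N.integrable_bounded_continuous Y by blast
  note [measurable] = X Y
  have eM: "integrable M (\<lambda>\<omega>. iexp (\<Sum>i<l. u i \<bullet> X n \<omega> i))" for u n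
    by (rule M.integrable_const_bound[of _ 1]) auto
  have eN: "integrable N (\<lambda>\<omega>. iexp (\<Sum>i<l. u i \<bullet> Y \<omega> i))" for u
    by (rule N.integrable_const_bound[of _ 1]) auto
  have re: "Re (iexp y) = cos y" "Im (iexp y) = sin y" for y by (simp_all add: Re_exp Im_exp)
  show ?thesis using f
  proof induction
    case (trig_cos u)
    from tendsto_Re[OF char[of u]] show ?case
      by (simp only: integral_Re[OF eM, symmetric] integral_Re[OF eN, symmetric] re)
  next
    case (trig_sin u)
    from tendsto_Im[OF char[of u]] show ?case
      by (simp only: integral_Im[OF eM, symmetric] integral_Im[OF eN, symmetric] re)
  next
    case (trig_add f g)
    then show ?case by (simp add: Bochner_Integration.integral_add iM iN tendsto_add)
  next
    case (trig_scale f c)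
    then show ?case by (simp add: tendsto_mult_left)
  qed
qed

text \<open>On a compact box a trigonometric polynomial replaces \<open>\<Phi>\<close>; outside,
  both are bounded and tightness makes the probability small. Tightness is a hypothesis, rather than
  a consequence of continuity of the limiting characteristic function, because second moments supply
  it in the application.\<close>

theorem levy_continuity_finite_dimensional:
  fixes X :: "nat \<Rightarrow> 'a \<Rightarrow> nat \<Rightarrow> 'v::euclidean_space" and Y :: "'b \<Rightarrow> nat \<Rightarrow> 'v"
    and \<Phi> :: "(nat \<Rightarrow> 'v) \<Rightarrow> real"
  assumes M: "prob_space M" and N: "prob_space N"
    and X: "\<And>n i. (\<lambda>\<omega>. X n \<omega> i) \<in> borel_measurable M" and Y: "\<And>i. (\<lambda>\<omega>. Y \<omega> i) \<in> borel_measurable N"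
    and X0: "\<And>n \<omega> i. l \<le> i \<Longrightarrow> X n \<omega> i = 0" and Y0: "\<And>\<omega> i. l \<le> i \<Longrightarrow> Y \<omega> i = 0"
    and tight: "\<And>e. 0 < e \<Longrightarrow> \<exists>K. \<forall>n. measure M {\<omega>\<in>space M. \<exists>i<l. K < norm (X n \<omega> i)} \<le> e"
    and char: "\<And>u. (\<lambda>n. integral\<^sup>L M (\<lambda>\<omega>. iexp (\<Sum>i<l. u i \<bullet> X n \<omega> i))) \<longlonglongrightarrow> integral\<^sup>L N (\<lambda>\<omega>. iexp (\<Sum>i<l. u i \<bullet> Y \<omega> i))"
    and \<Phi>: "continuous_on UNIV \<Phi>" "\<And>x. \<bar>\<Phi> x\<bar> \<le> c"
  shows "(\<lambda>n. integral\<^sup>L M (\<lambda>\<omega>. \<Phi> (X n \<omega>))) \<longlonglongrightarrow> integral\<^sup>L N (\<lambda>\<omega>. \<Phi> (Y \<omega>))"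
proof (rule LIMSEQ_I)
  fix r :: real assume r: "0 < r"
  interpret M: prob_space M by fact
  interpret N: prob_space N by fact
  note [measurable] = X Y
  have c0: "0 \<le> c" using abs_ge_zero \<Phi>(2) by (rule order_trans)
  \<comment> \<open>Each of the two approximation errors is \<open>2 * e + (2 * c + e) * p\<close>
    with \<open>p \<le> e\<close>, at most \<open>e * (2 * c + 4)\<close> because
    \<open>e \<le> 1\<close>; the choice makes this at most \<open>r / 4\<close>.\<close>
  define e where "e = min 1 (r / (4 * (2 * c + 4)))"
  have e: "0 < e" "e \<le> 1" "4 * (e * (2 * c + 4)) \<le> r"
  proof -
    show "0 < e" "e \<le> 1" using r c0 by (auto simp: e_def)
    have "e * (4 * (2 * c + 4)) \<le> r / (4 * (2 * c + 4)) * (4 * (2 * c + 4))"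
      unfolding e_def using c0 by (intro mult_right_mono) auto
    also have "\<dots> = r" using c0 by simp
    finally show "4 * (e * (2 * c + 4)) \<le> r" by (simp add: mult_ac)
  qed
  obtain K1 where K1: "\<And>n. measure M {\<omega>\<in>space M. \<exists>i<l. K1 < norm (X n \<omega> i)} \<le> e" using tight[OF e(1)] by blast
  \<comment> \<open>A single law is tight: the exceptional sets decrease to the empty set.\<close>
  obtain K2 where K2: "measure N {\<omega>\<in>space N. \<exists>i<l. K2 < norm (Y \<omega> i)} \<le> e"
  proof -
    define A where "A = (\<lambda>k::nat. {\<omega>\<in>space N. \<exists>i<l. real k < norm (Y \<omega> i)})"
    have "(\<Inter>k. A k) = {}"
    proof -
      have "\<exists>k. \<omega> \<notin> A k" for \<omega>
      proof -
        obtain k :: nat where "(\<Sum>i<l. norm (Y \<omega> i)) \<le> real k" using real_arch_simple by blast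
        then have "\<forall>i<l. norm (Y \<omega> i) \<le> real k" using member_le_sum[of _ "{..<l}" "\<lambda>i. norm (Y \<omega> i)"] by force
        then have "\<omega> \<notin> A k" by (auto simp: A_def not_less)
        then show ?thesis ..
      qed
      then show ?thesis by auto
    qed
    moreover have "(\<lambda>k. measure N (A k)) \<longlonglongrightarrow> measure N (\<Inter>k. A k)"
    proof (rule N.finite_Lim_measure_decseq)
      show "range A \<subseteq> sets N" unfolding A_def by auto
      show "decseq A" unfolding A_def decseq_def by (auto intro: le_less_trans[rotated])
    qed
    ultimately have "(\<lambda>k. measure N (A k)) \<longlonglongrightarrow> 0" by simp
    from order_tendstoD(2)[OF this e(1)] obtain k where "measure N (A k) < e"
      using eventually_happens by force
    then show ?thesis using that[of "real k"] unfolding A_def by simp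
  qed
  define K where "K = max K1 K2"
  obtain h where h: "h \<in> trig l" "\<And>x. x \<in> coord_box l K \<Longrightarrow> \<bar>\<Phi> x - h x\<bar> \<le> 2 * e" "\<And>x. \<bar>h x\<bar> \<le> c + e"
    using trig_approximation[OF \<Phi> e(1)] by blast
  note hc = continuous_on_trig[OF h(1)]
  have pw: "\<bar>\<Phi> x - h x\<bar> \<le> 2 * e + (2 * c + e) * (if x \<in> coord_box l K then 0 else 1)" for x
    using h(2)[of x] h(3)[of x] \<Phi>(2)[of x] e by auto
  have bound: "2 * e + (2 * c + e) * p \<le> r / 4" if "p \<le> e" for p
  proof -
    have "2 * e + (2 * c + e) * p \<le> 2 * e + (2 * c + 1) * e"
      using that c0 e by (intro add_left_mono order_trans[OF mult_left_mono mult_right_mono]) auto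
    also have "\<dots> \<le> e * (2 * c + 4)" using e by (simp add: algebra_simps)
    finally show ?thesis using e(3) by simp
  qed
  have 1: "\<bar>M.expectation (\<lambda>\<omega>. \<Phi> (X n \<omega>)) - M.expectation (\<lambda>\<omega>. h (X n \<omega>))\<bar> \<le> r / 4" for n
  proof -
    let ?B = "{\<omega>\<in>space M. \<exists>i<l. K < norm (X n \<omega> i)}"
    have "\<bar>M.expectation (\<lambda>\<omega>. \<Phi> (X n \<omega>)) - M.expectation (\<lambda>\<omega>. h (X n \<omega>))\<bar> \<le> 2 * e + (2 * c + e) * M.prob ?B"
    proof (rule M.expectation_diff_le)
      fix \<omega> assume "\<omega> \<in> space M"
      then show "\<bar>\<Phi> (X n \<omega>) - h (X n \<omega>)\<bar> \<le> 2 * e + (2 * c + e) * indicator ?B \<omega>"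
        using pw[of "X n \<omega>"] X0[of _ n \<omega>] by (auto simp: indicator_def coord_box_def not_le split: if_splits)
    qed (auto intro!: M.integrable_bounded_continuous[OF \<Phi>] M.integrable_bounded_continuous[OF hc h(3)])
    also have "M.prob ?B \<le> M.prob {\<omega>\<in>space M. \<exists>i<l. K1 < norm (X n \<omega> i)}"
      by (rule M.finite_measure_mono) (auto simp: K_def)
    then have "2 * e + (2 * c + e) * M.prob ?B \<le> r / 4" using K1[of n] by (intro bound) auto
    finally show ?thesis .
  qed
  have 2: "\<bar>N.expectation (\<lambda>\<omega>. \<Phi> (Y \<omega>)) - N.expectation (\<lambda>\<omega>. h (Y \<omega>))\<bar> \<le> r / 4"
  proof -
    let ?B = "{\<omega>\<in>space N. \<exists>i<l. K < norm (Y \<omega> i)}"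
    have "\<bar>N.expectation (\<lambda>\<omega>. \<Phi> (Y \<omega>)) - N.expectation (\<lambda>\<omega>. h (Y \<omega>))\<bar> \<le> 2 * e + (2 * c + e) * N.prob ?B"
    proof (rule N.expectation_diff_le)
      fix \<omega> assume "\<omega> \<in> space N"
      then show "\<bar>\<Phi> (Y \<omega>) - h (Y \<omega>)\<bar> \<le> 2 * e + (2 * c + e) * indicator ?B \<omega>"
        using pw[of "Y \<omega>"] Y0[of _ \<omega>] by (auto simp: indicator_def coord_box_def not_le split: if_splits)
    qed (auto intro!: N.integrable_bounded_continuous[OF \<Phi>] N.integrable_bounded_continuous[OF hc h(3)])
    also have "N.prob ?B \<le> N.prob {\<omega>\<in>space N. \<exists>i<l. K2 < norm (Y \<omega> i)}"
      by (rule N.finite_measure_mono) (auto simp: K_def)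
    then have "2 * e + (2 * c + e) * N.prob ?B \<le> r / 4" using K2 by (intro bound) auto
    finally show ?thesis .
  qed
  obtain n0 where n0: "\<And>n. n0 \<le> n \<Longrightarrow> norm (M.expectation (\<lambda>\<omega>. h (X n \<omega>)) - N.expectation (\<lambda>\<omega>. h (Y \<omega>))) < r / 4"
    using LIMSEQ_D[OF trig_expectation_tendsto[OF M N X Y char h(1)], of "r / 4"] r by auto
  show "\<exists>no. \<forall>n\<ge>no. norm (M.expectation (\<lambda>\<omega>. \<Phi> (X n \<omega>)) - N.expectation (\<lambda>\<omega>. \<Phi> (Y \<omega>))) < r"
  proof (intro exI allI impI)
    fix n assume "n0 \<le> n"
    from n0[OF this] 1[of n] 2 r show "norm (M.expectation (\<lambda>\<omega>. \<Phi> (X n \<omega>)) - N.expectation (\<lambda>\<omega>. \<Phi> (Y \<omega>))) < r"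
      unfolding real_norm_def by linarith
  qed
qed

section \<open>Brownian increments and the bridge\<close>

text \<open>Lebesgue measure on \<open>real ^ 'q\<close> is the image of a product measure indexed
  by basis vectors. The factors \<open>F\<close> are indexed by coordinates, so \<open>G\<close>
  relabels them along the bijection of \<open>i\<close> with \<open>axis i 1\<close>.\<close>

lemma integral_prod_cart:
  fixes F :: "'q::finite \<Rightarrow> real \<Rightarrow> complex"
  assumes F: "\<And>i. integrable lborel (F i)"
  shows "(\<integral>x. (\<Prod>i\<in>UNIV. F i (x $ i)) \<partial>(lborel :: (real ^ 'q) measure)) = (\<Prod>i\<in>UNIV. \<integral>y. F i y \<partial>lborel)"
    and "integrable (lborel :: (real ^ 'q) measure) (\<lambda>x. \<Prod>i\<in>UNIV. F i (x $ i))"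
proof -
  let ?B = "Basis :: (real ^ 'q) set"
  define G where "G = (\<lambda>b::real ^ 'q. F (SOME i. b = axis i 1))"
  have G: "G (axis i 1) = F i" for i
  proof -
    have "(SOME j. axis i (1::real) = axis j 1) = i" by (rule some_equality) (auto simp: axis_eq_axis)
    then show ?thesis by (simp add: G_def)
  qed
  interpret product_sigma_finite "\<lambda>_. lborel :: real measure" ..
  have Gi: "integrable lborel (G b)" for b by (simp add: G_def F)
  have [measurable]: "F i \<in> borel_measurable borel" for i using F[of i] by auto
  have Bas: "?B = range (\<lambda>i. axis i 1)" by (auto simp: Basis_vec_def)
  have inj: "inj (\<lambda>i. axis i (1::real) :: real ^ 'q)" by (auto simp: inj_on_def axis_eq_axis)
  have prod_eq: "(\<Prod>b\<in>?B. h b) = (\<Prod>i\<in>UNIV. h (axis i 1))" for h :: "real ^ 'q \<Rightarrow> complex"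
    unfolding Bas by (rule prod.reindex_cong[OF inj]) auto
  have pt: "(\<Prod>i\<in>UNIV. F i ((\<Sum>b\<in>?B. f b *\<^sub>R b) $ i)) = (\<Prod>b\<in>?B. G b (f b))" for f
  proof -
    have "(\<Sum>b\<in>?B. f b *\<^sub>R b) $ i = f (axis i 1)" for i
    proof -
      have "(\<Sum>b\<in>?B. f b *\<^sub>R b) $ i = (\<Sum>b\<in>?B. f b *\<^sub>R b) \<bullet> axis i 1" by (simp add: inner_axis)
      also have "\<dots> = f (axis i 1)" by (rule inner_sum_left_Basis) (auto simp: Bas)
      finally show ?thesis .
    qed
    then show ?thesis by (simp add: prod_eq G)
  qed
  have m: "(\<lambda>f. \<Sum>b\<in>?B. f b *\<^sub>R b) \<in> measurable (Pi\<^sub>M ?B (\<lambda>b. lborel)) borel" by measurable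
  have m2: "(\<lambda>x::real ^ 'q. \<Prod>i\<in>UNIV. F i (x $ i)) \<in> borel_measurable borel" by measurable
  show "(\<integral>x. (\<Prod>i\<in>UNIV. F i (x $ i)) \<partial>(lborel :: (real ^ 'q) measure)) = (\<Prod>i\<in>UNIV. \<integral>y. F i y \<partial>lborel)"
    unfolding lborel_eq[where 'a = "real ^ 'q"] integral_distr[OF m m2] pt
    by (subst product_integral_prod) (auto simp: Gi prod_eq G)
  show "integrable (lborel :: (real ^ 'q) measure) (\<lambda>x. \<Prod>i\<in>UNIV. F i (x $ i))"
    unfolding lborel_eq[where 'a = "real ^ 'q"] integrable_distr_eq[OF m m2] pt
    by (rule product_integrable_prod) (auto simp: Gi)
qed

lemma normal_density_scale: "0 < \<sigma> \<Longrightarrow> normal_density 0 \<sigma> (\<sigma> * y) * \<sigma> = std_normal_density y"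
  by (simp add: normal_density_def real_sqrt_mult power_mult_distrib field_simps)

lemma
  assumes "0 < \<sigma>"
  shows integrable_normal_char: "integrable lborel (\<lambda>y. normal_density 0 \<sigma> y *\<^sub>R iexp (u * y))"
    and integral_normal_char: "(\<integral>y. normal_density 0 \<sigma> y *\<^sub>R iexp (u * y) \<partial>lborel) = of_real (exp (- (\<sigma> * u)\<^sup>2 / 2))"
proof -
  show "integrable lborel (\<lambda>y. normal_density 0 \<sigma> y *\<^sub>R iexp (u * y))"
    by (rule Bochner_Integration.integrable_bound[OF integrable_normal_density[OF assms, of 0]]) auto
  have "(\<integral>y. normal_density 0 \<sigma> y *\<^sub>R iexp (u * y) \<partial>lborel)
     = \<bar>\<sigma>\<bar> *\<^sub>R (\<integral>y. normal_density 0 \<sigma> (0 + \<sigma> * y) *\<^sub>R iexp (u * (0 + \<sigma> * y)) \<partial>lborel)"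
    by (rule lborel_integral_real_affine) (use assms in auto)
  also have "\<dots> = (\<integral>y. \<bar>\<sigma>\<bar> *\<^sub>R (normal_density 0 \<sigma> (0 + \<sigma> * y) *\<^sub>R iexp (u * (0 + \<sigma> * y))) \<partial>lborel)"
    by (rule integral_scaleR_right[symmetric])
  also have "\<dots> = (\<integral>y. std_normal_density y *\<^sub>R iexp ((\<sigma> * u) * y) \<partial>lborel)"
    using normal_density_scale[OF assms] assms
    by (intro Bochner_Integration.integral_cong refl) (simp add: mult_ac scaleR_conv_of_real flip: of_real_mult)
  also have "\<dots> = char std_normal_distribution (\<sigma> * u)"
    unfolding char_def by (subst integral_density) auto
  finally show "(\<integral>y. normal_density 0 \<sigma> y *\<^sub>R iexp (u * y) \<partial>lborel) = of_real (exp (- (\<sigma> * u)\<^sup>2 / 2))"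
    by (simp add: char_std_normal_distribution)
qed

lemma char_normal_vector:
  fixes D :: "'b \<Rightarrow> real ^ 'q"
  assumes D: "distributed N lborel D (\<lambda>x. ennreal (\<Prod>i\<in>UNIV. normal_density 0 \<sigma> (x $ i)))" and \<sigma>: "0 < \<sigma>"
  shows "(\<integral>\<omega>. iexp (u \<bullet> D \<omega>) \<partial>N) = of_real (exp (- \<sigma>\<^sup>2 * (norm u)\<^sup>2 / 2))"
proof -
  have Dm: "D \<in> measurable N lborel" using D by (rule distributed_measurable)
  have "(\<integral>\<omega>. iexp (u \<bullet> D \<omega>) \<partial>N) = (\<integral>x. iexp (u \<bullet> x) \<partial>distr N lborel D)"
    by (rule integral_distr[OF Dm, symmetric]) simp
  also have "\<dots> = (\<integral>x. (\<Prod>i\<in>UNIV. normal_density 0 \<sigma> (x $ i)) *\<^sub>R iexp (u \<bullet> x) \<partial>lborel)"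
    unfolding distributed_distr_eq_density[OF D]
    by (rule integral_density) (auto intro!: borel_measurable_prod prod_nonneg)
  also have "\<dots> = (\<integral>x. (\<Prod>i\<in>UNIV. normal_density 0 \<sigma> (x $ i) *\<^sub>R iexp (u $ i * x $ i)) \<partial>lborel)"
    by (intro Bochner_Integration.integral_cong refl)
      (simp add: inner_vec_def scaleR_conv_of_real prod.distrib sum_distrib_left flip: exp_sum)
  also have "\<dots> = (\<Prod>i\<in>UNIV. of_real (exp (- (\<sigma> * u $ i)\<^sup>2 / 2)))"
    by (subst integral_prod_cart(1)[OF integrable_normal_char[OF \<sigma>]]) (simp only: integral_normal_char[OF \<sigma>])
  also have "\<dots> = of_real (\<Prod>i\<in>UNIV. exp (- (\<sigma> * u $ i)\<^sup>2 / 2))" by simp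
  also have "(\<Prod>i\<in>UNIV. exp (- (\<sigma> * u $ i)\<^sup>2 / 2)) = exp (\<Sum>i\<in>UNIV. - (\<sigma> * u $ i)\<^sup>2 / 2)"
    by (simp add: exp_sum)
  also have "(\<Sum>i\<in>UNIV. - (\<sigma> * u $ i)\<^sup>2 / 2) = - \<sigma>\<^sup>2 * (norm u)\<^sup>2 / 2"
    by (simp add: norm_vec_def L2_set_def sum_nonneg power_mult_distrib sum_distrib_left sum_negf sum_divide_distrib)
  finally show ?thesis .
qed

locale brownian = prob_space N for N :: "'b measure" +
  fixes B :: "real \<Rightarrow> 'b \<Rightarrow> real ^ 'q"
  assumes bm: "standard_brownian_motion N B"
begin

lemma B_measurable [measurable (raw)]: "0 \<le> t \<Longrightarrow> B t \<in> borel_measurable N"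
  using bm unfolding standard_brownian_motion_def by blast

lemma B_zero: "AE \<omega> in N. B 0 \<omega> = 0"
  using bm unfolding standard_brownian_motion_def by blast

lemma B_continuous: "\<omega> \<in> space N \<Longrightarrow> continuous_on {0..} (\<lambda>t. B t \<omega>)"
  using bm unfolding standard_brownian_motion_def by blast

lemma B_increment: "0 \<le> s \<Longrightarrow> s < t \<Longrightarrow> distributed N lborel (\<lambda>\<omega>. B t \<omega> - B s \<omega>)
            (\<lambda>x. ennreal (\<Prod>i\<in>UNIV. normal_density 0 (sqrt (t - s)) (x $ i)))"
  using bm unfolding standard_brownian_motion_def by blast

lemma B_indep: "0 \<le> s 0 \<Longrightarrow> mono_on {..k} s \<Longrightarrow>
    indep_vars (\<lambda>_. borel) (\<lambda>i \<omega>. B (s (Suc i)) \<omega> - B (s i) \<omega>) {..<k}"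
  for s :: "nat \<Rightarrow> real"
  using bm unfolding standard_brownian_motion_def by blast

definition incr :: "nat \<Rightarrow> nat \<Rightarrow> 'b \<Rightarrow> real ^ 'q" where
  "incr l i \<omega> = B (real (Suc i) / real l) \<omega> - B (real i / real l) \<omega>"

lemma incr_measurable [measurable (raw)]: "incr l i \<in> borel_measurable N"
  unfolding incr_def[abs_def] by measurable

lemma incr_indep: "indep_vars (\<lambda>_. borel) (incr l) {..<l}"
proof -
  have "mono_on {..l} (\<lambda>i. real i / real l)" by (auto simp: mono_on_def divide_right_mono)
  from B_indep[OF _ this] show ?thesis by (simp add: incr_def[abs_def])
qed

lemma incr_char:
  assumes "0 < l"
  shows "(\<integral>\<omega>. iexp (u \<bullet> incr l i \<omega>) \<partial>N) = of_real (exp (- (norm u)\<^sup>2 / l / 2))"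
proof -
  have eq: "real (Suc i) / l - real i / l = 1 / l" by (simp add: diff_divide_distrib[symmetric])
  have "(\<integral>\<omega>. iexp (u \<bullet> incr l i \<omega>) \<partial>N) = of_real (exp (- (sqrt (1 / l))\<^sup>2 * (norm u)\<^sup>2 / 2))"
    unfolding incr_def
    by (rule char_normal_vector[OF B_increment[of "real i / l" "real (Suc i) / l", unfolded eq]])
      (use assms in \<open>auto simp: divide_strict_right_mono\<close>)
  then show ?thesis using assms by (simp add: real_sqrt_divide power_divide)
qed

lemma incr_joint_char:
  assumes "0 < l"
  shows "(\<integral>\<omega>. iexp (\<Sum>i<l. u i \<bullet> incr l i \<omega>) \<partial>N) = of_real (exp (- (\<Sum>i<l. (norm (u i))\<^sup>2) / l / 2))"
proof -
  have "(\<integral>\<omega>. iexp (\<Sum>i<l. u i \<bullet> incr l i \<omega>) \<partial>N) = (\<integral>\<omega>. (\<Prod>i<l. iexp (u i \<bullet> incr l i \<omega>)) \<partial>N)"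
    by (simp add: sum_distrib_left flip: exp_sum)
  also have "\<dots> = (\<Prod>i<l. \<integral>\<omega>. iexp (u i \<bullet> incr l i \<omega>) \<partial>N)"
  proof (rule indep_vars_lebesgue_integral)
    show "indep_vars (\<lambda>_. borel) (\<lambda>i \<omega>. iexp (u i \<bullet> incr l i \<omega>)) {..<l}"
      by (rule indep_vars_compose2[OF incr_indep]) measurable
    show "integrable N (\<lambda>\<omega>. iexp (u i \<bullet> incr l i \<omega>))" for i
      by (rule integrable_const_bound[of _ 1]) auto
  qed simp
  also have "\<dots> = of_real (\<Prod>i<l. exp (- (norm (u i))\<^sup>2 / l / 2))" by (simp add: incr_char[OF assms])
  also have "(\<Prod>i<l. exp (- (norm (u i))\<^sup>2 / l / 2)) = exp (\<Sum>i<l. - (norm (u i))\<^sup>2 / l / 2)" by (simp add: exp_sum)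
  also have "(\<Sum>i<l. - (norm (u i))\<^sup>2 / l / 2) = - (\<Sum>i<l. (norm (u i))\<^sup>2) / l / 2"
    by (simp add: sum_negf sum_divide_distrib)
  finally show ?thesis .
qed

lemma B_eq_sum_incr:
  assumes "0 < l" shows "AE \<omega> in N. \<forall>k. B (real k / l) \<omega> = (\<Sum>i<k. incr l i \<omega>)"
  using B_zero
proof eventually_elim
  case (elim \<omega>)
  have "(\<Sum>i<k. incr l i \<omega>) = B (real k / l) \<omega> - B (real 0 / l) \<omega>" for k
    unfolding incr_def by (rule sum_lessThan_telescope)
  then show ?case using elim by simp
qed

text \<open>The increment has a Lebesgue density, and a hyperplane with nonzero normal is a null
  set.\<close>

lemma incr_hyperplane:
  assumes "a \<noteq> 0" "0 < l" shows "AE y in distr N borel (incr l i). a \<bullet> y \<noteq> c"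
proof -
  have "AE y in lborel. a \<bullet> (y :: real ^ 'q) \<noteq> c"
  proof (rule AE_I')
    have "negligible {y. a \<bullet> y = c}" using assms by (intro negligible_hyperplane) auto
    moreover have "{y. a \<bullet> y = c} \<in> sets borel" by measurable
    ultimately show "{y. a \<bullet> y = c} \<in> null_sets lborel"
      by (simp add: negligible_iff_null_sets null_sets_completion_iff)
  qed auto
  then have *: "AE y in density lborel g. a \<bullet> (y :: real ^ 'q) \<noteq> c" if "g \<in> borel_measurable lborel" for g
    using that by (subst AE_density) auto
  have D: "distributed N lborel (incr l i)
     (\<lambda>x. ennreal (\<Prod>j\<in>UNIV. normal_density 0 (sqrt (real (Suc i) / l - real i / l)) (x $ j)))"
    unfolding incr_def[abs_def] by (rule B_increment) (use assms in \<open>auto simp: divide_strict_right_mono\<close>)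
  have "distr N borel (incr l i) = distr N lborel (incr l i)" by (rule distr_cong) auto
  also have "\<dots> = density lborel (\<lambda>x. ennreal (\<Prod>j\<in>UNIV. normal_density 0 (sqrt (real (Suc i) / l - real i / l)) (x $ j)))"
    by (rule distributed_distr_eq_density[OF D])
  finally show ?thesis using *[OF distributed_borel_measurable[OF D]] by (simp only:)
qed

text \<open>By independence the joint law is a product. For a fixed value \<open>x\<close> of one
  increment the other has to avoid the hyperplane \<open>a \<bullet> y = a \<bullet> x\<close>,
  which it does almost surely; Fubini's theorem concludes.\<close>

lemma incr_diff_hyperplane:
  assumes "a \<noteq> 0" "i < l" "j < l" "i \<noteq> j" shows "AE \<omega> in N. a \<bullet> (incr l j \<omega> - incr l i \<omega>) \<noteq> 0"
proof -
  have "indep_var (PiM {i} (\<lambda>_. borel)) (\<lambda>\<omega>. restrict (\<lambda>k. incr l k \<omega>) {i}) (PiM {j} (\<lambda>_. borel)) (\<lambda>\<omega>. restrict (\<lambda>k. incr l k \<omega>) {j})"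
    by (rule indep_var_restrict[OF incr_indep]) (use assms in auto)
  then have "indep_var borel ((\<lambda>f. f i) \<circ> (\<lambda>\<omega>. restrict (\<lambda>k. incr l k \<omega>) {i})) borel ((\<lambda>f. f j) \<circ> (\<lambda>\<omega>. restrict (\<lambda>k. incr l k \<omega>) {j}))"
    by (rule indep_var_compose) measurable
  then have "indep_var borel (incr l i) borel (incr l j)" by (simp add: comp_def)
  then have eq: "distr N borel (incr l i) \<Otimes>\<^sub>M distr N borel (incr l j) = distr N (borel \<Otimes>\<^sub>M borel) (\<lambda>\<omega>. (incr l i \<omega>, incr l j \<omega>))"
    unfolding indep_var_distribution_eq by blast
  interpret D1: prob_space "distr N borel (incr l i)" by (rule prob_space_distr) measurable
  interpret D2: prob_space "distr N borel (incr l j)" by (rule prob_space_distr) measurable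
  interpret P: pair_sigma_finite "distr N borel (incr l i)" "distr N borel (incr l j)" ..
  have "AE y in distr N borel (incr l j). a \<bullet> (y - x) \<noteq> 0" for x
    using incr_hyperplane[OF assms(1), where l = l and i = j and c = "a \<bullet> x"] assms by (simp add: inner_diff_right)
  then have "AE p in distr N borel (incr l i) \<Otimes>\<^sub>M distr N borel (incr l j). a \<bullet> (snd p - fst p) \<noteq> 0"
  proof (intro P.AE_pair_measure)
    have [measurable]: "(\<lambda>p. a \<bullet> (snd p - fst p)) \<in> borel_measurable (distr N borel (incr l i) \<Otimes>\<^sub>M distr N borel (incr l j))"
      by measurable
    show "{p \<in> space (distr N borel (incr l i) \<Otimes>\<^sub>M distr N borel (incr l j)). a \<bullet> (snd p - fst p) \<noteq> 0}
      \<in> sets (distr N borel (incr l i) \<Otimes>\<^sub>M distr N borel (incr l j))"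
      by measurable
  qed simp
  then show ?thesis unfolding eq by (subst (asm) AE_distr_iff) auto
qed

end

text \<open>Rows are exchanged one at a time: the determinant is an inner product of the new row with a
  cofactor vector that does not vanish.\<close>

lemma AE_det_rows_nonzero:
  fixes \<mu> :: "'q::finite \<Rightarrow> (real ^ 'q) measure"
  assumes \<mu>: "\<And>i. prob_space (\<mu> i)" "\<And>i. sets (\<mu> i) = sets borel"
    and ac: "\<And>i a. a \<noteq> 0 \<Longrightarrow> AE y in \<mu> i. a \<bullet> y \<noteq> 0"
  shows "AE v in PiM UNIV \<mu>. det (\<chi> i. v i) \<noteq> 0"
proof -
  interpret product_prob_space \<mu>
    by (rule product_prob_spaceI) (rule \<mu>(1))
  \<comment> \<open>Rows outside \<open>K\<close> are unit vectors: the induction starts at the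
    identity matrix and ends, at \<open>K = UNIV\<close>, at the matrix of all random rows.\<close>
  define A where "A = (\<lambda>K (v :: 'q \<Rightarrow> real ^ 'q). (\<chi> i. if i \<in> K then v i else axis i 1) :: real ^ 'q ^ 'q)"
  have meas: "(\<lambda>v. det (A K v)) \<in> borel_measurable (PiM K \<mu>)" for K
  proof -
    have "(\<lambda>v. A K v $ i $ j) \<in> borel_measurable (PiM K \<mu>)" for i j
    proof (cases "i \<in> K")
      case True
      then have "(\<lambda>v. v i) \<in> measurable (PiM K \<mu>) (\<mu> i)" by (rule measurable_component_singleton)
      then have "(\<lambda>v. v i) \<in> borel_measurable (PiM K \<mu>)" using \<mu>(2)[of i] by (simp cong: measurable_cong_sets)
      then have "(\<lambda>v. v i $ j) \<in> borel_measurable (PiM K \<mu>)"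
        by (rule measurable_compose) (intro borel_measurable_continuous_onI continuous_intros)
      then show ?thesis using True by (simp add: A_def)
    qed (simp add: A_def)
    then show ?thesis unfolding det_def by (intro borel_measurable_sum borel_measurable_times borel_measurable_prod) auto
  qed
  have "AE v in PiM K \<mu>. det (A K v) \<noteq> 0" if "finite K" for K
    using that
  proof (induction K rule: finite_induct)
    case empty
    have "A {} v = mat 1" for v by (simp add: A_def mat_def axis_def vec_eq_iff)
    then show ?case by simp
  next
    case (insert i K)
    let ?f = "\<lambda>v. indicator {v. det (A (insert i K) v) = 0} v :: ennreal"
    have fm: "?f \<in> borel_measurable (PiM (insert i K) \<mu>)"
      using measurable_sets[OF meas[of "insert i K"], of "{0}"]
      by (intro borel_measurable_indicator') (simp add: vimage_def Int_def conj_commute)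
    have "AE v in PiM K \<mu>. (\<integral>\<^sup>+ y. ?f (v(i := y)) \<partial>\<mu> i) = 0"
      using insert.IH
    proof eventually_elim
      case (elim v)
      define r where "r = (\<lambda>k. if k \<in> K then v k else axis k 1 :: real ^ 'q)"
      define w where "w = (\<chi> j. det (\<chi> k. if k = i then axis j 1 else r k))"
      have det: "det (A (insert i K) (v(i := y))) = w \<bullet> y" for y
      proof -
        have Aeq: "A (insert i K) (v(i := y)) = (\<chi> k. if k = i then y else r k)"
          by (auto simp: A_def r_def vec_eq_iff)
        have "det (A (insert i K) (v(i := y))) = det (\<chi> k. if k = i then (\<Sum>j\<in>UNIV. y $ j *s axis j 1) else r k)"
          unfolding Aeq basis_expansion ..
        also have "\<dots> = (\<Sum>j\<in>UNIV. det (\<chi> k. if k = i then y $ j *s axis j 1 else r k))"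
          by (rule det_linear_row_sum) simp
        also have "\<dots> = (\<Sum>j\<in>UNIV. y $ j * det (\<chi> k. if k = i then axis j 1 else r k))"
          by (simp add: det_row_mul)
        finally show ?thesis by (simp add: w_def inner_vec_def mult.commute)
      qed
      \<comment> \<open>The cofactor vector is nonzero because its \<open>i\<close>-th entry is the
        determinant before the exchange, where row \<open>i\<close> was still
        \<open>axis i 1\<close>.\<close>
      have "w $ i = det (A K v)"
        unfolding w_def using insert.hyps by (auto simp: A_def r_def vec_eq_iff intro!: arg_cong[of _ _ det])
      then have "w \<noteq> 0" using elim by auto
      from ac[OF this, of i] have "AE y in \<mu> i. ?f (v(i := y)) = 0"
        by eventually_elim (simp add: det)
      then have "(\<integral>\<^sup>+ y. ?f (v(i := y)) \<partial>\<mu> i) = (\<integral>\<^sup>+ y. 0 \<partial>\<mu> i)" by (rule nn_integral_cong_AE)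
      then show ?case by simp
    qed
    then have "(\<integral>\<^sup>+ v. (\<integral>\<^sup>+ y. ?f (v(i := y)) \<partial>\<mu> i) \<partial>PiM K \<mu>) = (\<integral>\<^sup>+ v. 0 \<partial>PiM K \<mu>)"
      by (rule nn_integral_cong_AE)
    then have "integral\<^sup>N (PiM (insert i K) \<mu>) ?f = 0"
      by (subst product_nn_integral_insert[OF insert.hyps fm]) simp
    then have "AE v in PiM (insert i K) \<mu>. ?f v = 0" using fm by (subst (asm) nn_integral_0_iff_AE) auto
    then show ?case by eventually_elim (auto simp: indicator_def)
  qed
  from this[of UNIV] show ?thesis by (simp add: A_def)
qed

text \<open>Right endpoints match the grid points \<open>k / n\<close>,
  \<open>k = 1, ..., n\<close>, of the statistic. The error is bounded by \<open>r / 2\<close> times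
  the length covered so far, which makes an induction over cells possible.\<close>

lemma riemann_sum_tendsto:
  fixes g :: "real \<Rightarrow> 'w::banach"
  assumes g: "continuous_on {0..1} g"
  shows "(\<lambda>l. (1 / real l) *\<^sub>R (\<Sum>k<l. g (real (Suc k) / real l))) \<longlonglongrightarrow> integral {0..1} g"
proof (rule LIMSEQ_I)
  fix r :: real assume r: "0 < r"
  have "uniformly_continuous_on {0..1} g" by (rule compact_uniformly_continuous[OF g]) simp
  then obtain d where d: "0 < d" "\<And>x y. x \<in> {0..1} \<Longrightarrow> y \<in> {0..1} \<Longrightarrow> dist x y < d \<Longrightarrow> dist (g x) (g y) < r / 2"
    using r unfolding uniformly_continuous_on_def by (metis half_gt_zero)
  obtain n0 :: nat where n0: "1 / d < real n0" using reals_Archimedean2 by blast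
  have "norm ((1 / real l) *\<^sub>R (\<Sum>k<l. g (real (Suc k) / real l)) - integral {0..1} g) < r" if l: "n0 \<le> l" for l
  proof -
    have "1 / d < real l" using n0 l by (meson of_nat_mono less_le_trans)
    then have l0: "0 < l" and ld: "1 / real l < d"
      using d(1) by (auto simp: divide_less_eq mult.commute intro: gr0I)
    have "norm ((1 / real l) *\<^sub>R (\<Sum>i<k. g (real (Suc i) / real l)) - integral {0..real k / l} g) \<le> r / 2 * (real k / l)"
      if "k \<le> l" for k
      using that
    proof (induction k)
      case (Suc k)
      let ?a = "real k / l" and ?b = "real (Suc k) / l"
      have ab: "0 \<le> ?a" "?a \<le> ?b" "?b \<le> 1" "?b - ?a = 1 / l" using Suc.prems l0
        by (auto simp: divide_right_mono diff_divide_distrib[symmetric])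
      have sb: "{0..?b} \<subseteq> {0..1}" "{?a..?b} \<subseteq> {0..1}"
        using ab by (simp_all only: atLeastatMost_subset_iff) auto
      have gb: "continuous_on {0..?b} g" "continuous_on {?a..?b} g"
        using continuous_on_subset[OF g] sb by blast+
      have comb: "integral {0..?a} g + integral {?a..?b} g = integral {0..?b} g"
        by (rule Henstock_Kurzweil_Integration.integral_combine[OF ab(1,2) integrable_continuous_real[OF gb(1)]])
      have "norm (integral {?a..?b} (\<lambda>t. g ?b - g t)) \<le> r / 2 * (?b - ?a)"
      proof (rule integral_bound[OF ab(2)])
        show "continuous_on {?a..?b} (\<lambda>t. g ?b - g t)" by (intro continuous_intros gb(2))
        fix t assume t: "t \<in> {?a..?b}"
        have "dist ?b t < d" using t ab(4) ld by (auto simp: dist_real_def)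
        then have "dist (g ?b) (g t) < r / 2" using t ab(2) sb(2) by (intro d(2)) (auto simp only: subset_iff atLeastAtMost_iff)
        then show "norm (g ?b - g t) \<le> r / 2" by (simp add: dist_norm)
      qed
      moreover have "integral {?a..?b} (\<lambda>t. g ?b - g t) = (1 / l) *\<^sub>R g ?b - integral {?a..?b} g"
        using integrable_continuous_real[OF gb(2)] ab by (subst Henstock_Kurzweil_Integration.integral_diff) auto
      ultimately have 1: "norm ((1 / l) *\<^sub>R g ?b - integral {?a..?b} g) \<le> r / 2 * (1 / l)" using ab(4) by simp
      have "(1 / real l) *\<^sub>R (\<Sum>i<Suc k. g (real (Suc i) / real l)) - integral {0..?b} g
        = ((1 / real l) *\<^sub>R (\<Sum>i<k. g (real (Suc i) / real l)) - integral {0..?a} g) + ((1 / l) *\<^sub>R g ?b - integral {?a..?b} g)"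
        unfolding comb[symmetric] by (simp add: scaleR_add_right)
      also have "norm \<dots> \<le> r / 2 * (real k / l) + r / 2 * (1 / l)"
        using Suc by (intro norm_triangle_le add_mono 1) auto
      also have "\<dots> = r / 2 * ?b" by (simp add: add_divide_distrib distrib_left)
      finally show ?case .
    qed simp
    from this[of l] show ?thesis using l0 r by simp
  qed
  then show "\<exists>no. \<forall>l\<ge>no. norm ((1 / real l) *\<^sub>R (\<Sum>k<l. g (real (Suc k) / real l)) - integral {0..1} g) < r" by blast
qed

section \<open>Determinants, inverses and congruence of matrices\<close>

lemma
  fixes A :: "real ^ 'q ^ 'q"
  assumes "invertible A"
  shows matrix_inv_right: "A ** matrix_inv A = mat 1" and matrix_inv_left: "matrix_inv A ** A = mat 1"
  using someI_ex[OF assms[unfolded invertible_def]] unfolding matrix_inv_def by auto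

lemma det_eq_0_iff_kernel:
  fixes A :: "real ^ 'q ^ 'q"
  shows "det A = 0 \<longleftrightarrow> (\<exists>x. x \<noteq> 0 \<and> A *v x = 0)"
  using invertible_det_nz[of A] invertible_left_inverse[of A] matrix_left_invertible_ker[of A] by blast

lemma outer_vec: "outer v *v x = (v \<bullet> x) *\<^sub>R v"
  by (simp add: outer_def matrix_vector_mult_def vec_eq_iff inner_vec_def sum_distrib_left mult_ac)

lemma continuous_on_outer [continuous_intros]:
  "continuous_on S f \<Longrightarrow> continuous_on S (\<lambda>x. outer (f x))"
  unfolding outer_def by (intro continuous_intros)

lemma outer_matrix_vector: "outer (C *v v) = C ** outer v ** transpose C"
  by (simp add: outer_def matrix_matrix_mult_def matrix_vector_mult_def transpose_def vec_eq_iff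
      sum_product sum_distrib_left sum_distrib_right mult_ac)

lemma continuous_on_det [continuous_intros]:
  fixes A :: "'a::topological_space \<Rightarrow> real ^ 'q ^ 'q"
  assumes "continuous_on S A" shows "continuous_on S (\<lambda>x. det (A x))"
  unfolding det_def by (intro continuous_intros assms)

text \<open>The numerator that Cramer's rule gives for the quadratic form of the inverse. Being a
  polynomial in the entries it is continuous everywhere, singular matrices included; the only
  possible discontinuity of the quadratic form lies in the division by the determinant.\<close>

definition cramer_num :: "real ^ 'q \<Rightarrow> real ^ 'q ^ 'q \<Rightarrow> real" where
  "cramer_num a U = (\<Sum>k\<in>UNIV. a $ k * det (\<chi> i j. if j = k then a $ i else U $ i $ j))"

lemma continuous_on_cramer_num [continuous_intros]:
  fixes U :: "'a::topological_space \<Rightarrow> real ^ 'q ^ 'q"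
  assumes "continuous_on S a" "continuous_on S U" shows "continuous_on S (\<lambda>x. cramer_num (a x) (U x))"
proof -
  have "continuous_on S (\<lambda>x. if j = k then a x $ i else U x $ i $ j)" for i j k
    using assms by (cases "j = k") (auto intro: continuous_intros)
  then show ?thesis unfolding cramer_num_def
    by (intro continuous_intros assms continuous_on_vec_lambda)
qed

lemma inner_matrix_inv:
  fixes U :: "real ^ 'q ^ 'q"
  assumes "det U \<noteq> 0" shows "a \<bullet> (matrix_inv U *v a) = cramer_num a U / det U"
proof -
  have "invertible U" using assms by (simp add: invertible_det_nz)
  then have "U *v (matrix_inv U *v a) = a" by (simp add: matrix_vector_mul_assoc matrix_inv_right)
  then have *: "matrix_inv U *v a = (\<chi> k. det (\<chi> i j. if j = k then a $ i else U $ i $ j) / det U)"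
    using cramer[OF assms] by blast
  show ?thesis unfolding * by (simp add: inner_vec_def cramer_num_def sum_divide_distrib)
qed

text \<open>If \<open>x\<close> solves \<open>U *v x = a\<close> and \<open>y\<close> solves
  \<open>transpose C *v y = x\<close>, then \<open>y\<close> solves the transformed system, and
  pairing it with \<open>C *v a\<close> gives \<open>a \<bullet> x\<close> again.\<close>

lemma inner_matrix_inv_congruence:
  fixes U C :: "real ^ 'q ^ 'q"
  assumes U: "invertible U" and C: "invertible C"
  shows "invertible (C ** U ** transpose C)"
    and "(C *v a) \<bullet> (matrix_inv (C ** U ** transpose C) *v (C *v a)) = a \<bullet> (matrix_inv U *v a)"
proof -
  have CT: "invertible (transpose C)" using C by (simp add: invertible_det_nz det_transpose)
  show inv: "invertible (C ** U ** transpose C)" using U C CT by (intro invertible_mult)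
  define x where "x = matrix_inv U *v a"
  define y where "y = matrix_inv (transpose C) *v x"
  have Ux: "U *v x = a" unfolding x_def using U by (simp add: matrix_vector_mul_assoc matrix_inv_right)
  have Cy: "transpose C *v y = x" unfolding y_def using CT by (simp add: matrix_vector_mul_assoc matrix_inv_right)
  have "(C ** U ** transpose C) *v y = C *v a"
    by (simp only: matrix_vector_mul_assoc[symmetric] Cy Ux)
  then have "matrix_inv (C ** U ** transpose C) *v (C *v a) = (matrix_inv (C ** U ** transpose C) ** (C ** U ** transpose C)) *v y"
    by (simp only: matrix_vector_mul_assoc[symmetric])
  then have "matrix_inv (C ** U ** transpose C) *v (C *v a) = y" using inv by (simp add: matrix_inv_left)
  then have "(C *v a) \<bullet> (matrix_inv (C ** U ** transpose C) *v (C *v a)) = (C *v a) \<bullet> y" by simp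
  also have "\<dots> = (a v* transpose C) \<bullet> y" by (simp add: vector_transpose_matrix)
  also have "\<dots> = a \<bullet> (transpose C *v y)" by (rule dot_lmul_matrix)
  finally show "(C *v a) \<bullet> (matrix_inv (C ** U ** transpose C) *v (C *v a)) = a \<bullet> (matrix_inv U *v a)"
    unfolding Cy x_def .
qed

section \<open>Nonsingularity of the integrated bridge\<close>

context brownian
begin

text \<open>The grid of \<open>2 * CARD('q)\<close> cells is divided into disjoint pairs, one per
  coordinate, so the row vectors are independent; each avoids a given hyperplane through 0 almost
  surely.\<close>

lemma AE_det_second_differences:
  assumes e: "inj e" "\<And>i::'q. e i < CARD('q)"
  defines "l \<equiv> 2 * CARD('q)"
  shows "AE \<omega> in N. det (\<chi> i. incr l (2 * e i + 1) \<omega> - incr l (2 * e i) \<omega>) \<noteq> 0"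
proof -
  define V where "V = (\<lambda>i \<omega>. incr l (2 * e i + 1) \<omega> - incr l (2 * e i) \<omega>)"
  define K where "K = (\<lambda>i::'q. {2 * e i, 2 * e i + 1})"
  have lt: "2 * e i + 1 < l" for i using e(2)[of i] by (simp add: l_def)
  have [measurable]: "V i \<in> borel_measurable N" for i unfolding V_def by measurable
  have "indep_vars (\<lambda>j. PiM (K j) (\<lambda>_. borel)) (\<lambda>j \<omega>. restrict (\<lambda>i. incr l i \<omega>) (K j)) UNIV"
  proof (rule indep_vars_restrict[OF incr_indep])
    show "K j \<subseteq> {..<l}" for j using lt[of j] by (auto simp: K_def)
    show "disjoint_family_on K UNIV"
    proof (unfold disjoint_family_on_def, intro ballI impI)
      fix i j :: 'q assume "i \<noteq> j"
      then have "e i \<noteq> e j" using e(1) by (auto dest: injD)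
      then show "K i \<inter> K j = {}" unfolding K_def by auto
    qed
  qed
  then have "indep_vars (\<lambda>_. borel) (\<lambda>j \<omega>. (\<lambda>f. f (2 * e j + 1) - f (2 * e j)) (restrict (\<lambda>i. incr l i \<omega>) (K j))) UNIV"
    by (rule indep_vars_compose2) (auto simp: K_def intro!: borel_measurable_diff measurable_component_singleton)
  then have "indep_vars (\<lambda>_. borel) V UNIV" by (simp add: K_def V_def)
  then have eq: "distr N (\<Pi>\<^sub>M i\<in>UNIV. borel) (\<lambda>\<omega>. \<lambda>i\<in>UNIV. V i \<omega>) = (\<Pi>\<^sub>M i\<in>UNIV. distr N borel (V i))"
    by (subst (asm) indep_vars_iff_distr_eq_PiM) auto
  have "AE v in (\<Pi>\<^sub>M i\<in>UNIV. distr N borel (V i)). det (\<chi> i. v i) \<noteq> 0"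
  proof (rule AE_det_rows_nonzero)
    show "prob_space (distr N borel (V i))" for i by (rule prob_space_distr) measurable
    show "AE y in distr N borel (V i). a \<bullet> y \<noteq> 0" if "a \<noteq> 0" for i a
    proof -
      have "AE \<omega> in N. a \<bullet> V i \<omega> \<noteq> 0" unfolding V_def
        using lt[of i] by (intro incr_diff_hyperplane that) auto
      then show ?thesis by (subst AE_distr_iff) auto
    qed
  qed simp
  then have "AE \<omega> in N. det (\<chi> i. (\<lambda>i\<in>UNIV. V i \<omega>) i) \<noteq> 0"
    unfolding eq[symmetric] by (rule AE_distrD[rotated]) measurable
  then show ?thesis by (simp add: V_def)
qed

lemma bridge_continuous: "\<omega> \<in> space N \<Longrightarrow> continuous_on {0..1} (\<lambda>r. bridge B r \<omega>)"
  unfolding bridge_def by (intro continuous_intros continuous_on_subset[OF B_continuous]) auto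

text \<open>A kernel vector \<open>x\<close> makes the integral of
  \<open>(x \<bullet> bridge B r \<omega>)\<^sup>2\<close> vanish, so along \<open>x\<close> the
  path of \<open>B\<close> is linear in time. All its grid increments in that direction are then
  equal, and second differences annihilate the unknown slope
  \<open>x \<bullet> B 1 \<omega>\<close>.\<close>

lemma det_bridge_integral:
  "AE \<omega> in N. det (integral {0..1} (\<lambda>r. outer (bridge B r \<omega>))) \<noteq> 0"
proof -
  obtain e :: "'q \<Rightarrow> nat" where e: "bij_betw e UNIV {0..<CARD('q)}"
    using ex_bij_betw_finite_nat[of "UNIV :: 'q set"] by auto
  have e1: "inj e" using e by (simp add: bij_betw_def)
  have e2: "e i < CARD('q)" for i using e by (auto simp: bij_betw_def)
  let ?l = "2 * CARD('q)"
  from AE_det_second_differences[OF e1 e2] AE_space show ?thesis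
  proof eventually_elim
    case (elim \<omega>)
    let ?U = "integral {0..1} (\<lambda>r. outer (bridge B r \<omega>))"
    show ?case
    proof
      assume "det ?U = 0"
      then obtain x where x: "x \<noteq> 0" "?U *v x = 0" using det_eq_0_iff_kernel by blast
      have bl: "bounded_linear (\<lambda>A::real ^ 'q ^ 'q. x \<bullet> (A *v x))"
        by (intro linear_linear[THEN iffD2] linearI)
          (simp_all add: matrix_vector_mult_add_rdistrib inner_add_right scaleR_matrix_vector_assoc[symmetric])
      have co: "continuous_on {0..1} (\<lambda>r. outer (bridge B r \<omega>))"
        by (intro continuous_intros bridge_continuous elim)
      have "integral {0..1} (\<lambda>r. (x \<bullet> bridge B r \<omega>)\<^sup>2) = integral {0..1} ((\<lambda>A. x \<bullet> (A *v x)) \<circ> (\<lambda>r. outer (bridge B r \<omega>)))"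
        by (simp add: comp_def outer_vec power2_eq_square inner_commute)
      also have "\<dots> = x \<bullet> (?U *v x)" by (rule integral_linear[OF integrable_continuous_real[OF co] bl])
      finally have "integral {0..1} (\<lambda>r. (x \<bullet> bridge B r \<omega>)\<^sup>2) = 0" using x by simp
      moreover have "continuous_on {0..1} (\<lambda>r. (x \<bullet> bridge B r \<omega>)\<^sup>2)"
        by (intro continuous_intros bridge_continuous elim)
      ultimately have *: "\<forall>r\<in>{0..1}. (x \<bullet> bridge B r \<omega>)\<^sup>2 = 0"
        by (intro iffD1[OF integral_eq_0_iff]) (simp_all only: zero_less_one zero_le_power2)
      have lin: "x \<bullet> B r \<omega> = r * (x \<bullet> B 1 \<omega>)" if "r \<in> {0..1}" for r
      proof -
        have "x \<bullet> bridge B r \<omega> = 0" using bspec[OF * that] by simp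
        then show ?thesis by (simp add: bridge_def inner_diff_right)
      qed
      have I: "x \<bullet> incr ?l k \<omega> = (1 / ?l) * (x \<bullet> B 1 \<omega>)" if "k < ?l" for k
      proof -
        have "x \<bullet> incr ?l k \<omega> = real (Suc k) / ?l * (x \<bullet> B 1 \<omega>) - real k / ?l * (x \<bullet> B 1 \<omega>)"
        proof -
          have r: "real (Suc k) / ?l \<in> {0..1}" "real k / ?l \<in> {0..1}" using that by (auto simp: divide_le_eq_1)
          show ?thesis unfolding incr_def inner_diff_right by (simp only: lin[OF r(1)] lin[OF r(2)])
        qed
        also have "\<dots> = (real (Suc k) / ?l - real k / ?l) * (x \<bullet> B 1 \<omega>)" by (rule left_diff_distrib[symmetric])
        also have "real (Suc k) / ?l - real k / ?l = 1 / ?l" unfolding diff_divide_distrib[symmetric] by simp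
        finally show ?thesis .
      qed
      have "(\<chi> i. incr ?l (2 * e i + 1) \<omega> - incr ?l (2 * e i) \<omega>) *v x = 0"
      proof -
        have "(incr ?l (2 * e i + 1) \<omega> - incr ?l (2 * e i) \<omega>) \<bullet> x = 0" for i
          using I[of "2 * e i + 1"] I[of "2 * e i"] e2[of i] by (simp add: inner_diff_right inner_commute[of _ x])
        then show ?thesis by (simp add: matrix_vector_mul_component vec_eq_iff)
      qed
      with x elim(1) show False using det_eq_0_iff_kernel by blast
    qed
  qed
qed

lemma bridge_riemann:
  assumes "\<omega> \<in> space N"
  shows "(\<lambda>l. (1 / real l) *\<^sub>R (\<Sum>k<l. outer (bridge B (real (Suc k) / real l) \<omega>))) \<longlonglongrightarrow> integral {0..1} (\<lambda>r. outer (bridge B r \<omega>))"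
  by (rule riemann_sum_tendsto) (intro continuous_intros bridge_continuous assms)

lemma bridge_measurable [measurable]: "0 \<le> r \<Longrightarrow> bridge B r \<in> borel_measurable N"
  unfolding bridge_def[abs_def] by measurable

lemma outer_measurable [measurable (raw)]: "f \<in> borel_measurable N \<Longrightarrow> (\<lambda>\<omega>. outer (f \<omega>)) \<in> borel_measurable N"
  for f :: "_ \<Rightarrow> real ^ 'q"
  by (rule measurable_compose[where g = outer]) (auto intro!: borel_measurable_continuous_onI continuous_intros)

text \<open>The integral is taken path by path, so measurability in \<open>\<omega>\<close> is
  obtained from the Riemann sums.\<close>

lemma bridge_integral_measurable [measurable]:
  "(\<lambda>\<omega>. integral {0..1} (\<lambda>r. outer (bridge B r \<omega>))) \<in> borel_measurable N"
  by (rule borel_measurable_LIMSEQ_metric[OF _ bridge_riemann]) measurable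

end

section \<open>Quadratic forms in an inverse matrix\<close>

text \<open>Written with determinants instead of \<open>matrix_inv\<close>, so that measurability
  and continuity away from singular matrices are visible; \<open>c\<close> is the value assigned in
  the singular case.\<close>

definition quad :: "real \<Rightarrow> real ^ 'q \<Rightarrow> real ^ 'q ^ 'q \<Rightarrow> real" where
  "quad c a U = (if det U \<noteq> 0 then cramer_num a U / det U else c)"

lemma quad_measurable:
  fixes a :: "'a \<Rightarrow> real ^ 'q"
  assumes [measurable]: "a \<in> borel_measurable M" "U \<in> borel_measurable M"
  shows "(\<lambda>\<omega>. quad c (a \<omega>) (U \<omega>)) \<in> borel_measurable M"
proof -
  have 1: "(\<lambda>\<omega>. det (U \<omega>)) \<in> borel_measurable M"
    by (rule measurable_compose[OF assms(2)]) (intro borel_measurable_continuous_onI continuous_intros)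
  have "(\<lambda>p. cramer_num (fst p) (snd p)) \<in> borel_measurable (borel :: ((real ^ 'q) \<times> (real ^ 'q ^ 'q)) measure)"
    by (intro borel_measurable_continuous_onI continuous_intros)
  from measurable_compose[OF borel_measurable_Pair[OF assms] this]
  have 2: "(\<lambda>\<omega>. cramer_num (a \<omega>) (U \<omega>)) \<in> borel_measurable M" by simp
  note [measurable] = 1 2
  show ?thesis unfolding quad_def by measurable
qed

text \<open>A continuous substitute for the reciprocal: for positive \<open>\<delta>\<close> it
  equals \<open>1 / d\<close> when \<open>\<bar>d\<bar> \<ge> \<delta>\<close> and is linear in
  between.\<close>

definition truncated_inverse :: "real \<Rightarrow> real \<Rightarrow> real" where
  "truncated_inverse \<delta> d = d / max (d\<^sup>2) (\<delta>\<^sup>2)"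

text \<open>The first factor is 0 while the absolute determinant is at most \<open>1 / Suc k\<close>
  and 1 from \<open>2 / Suc k\<close> on; the second is 1 up to norm \<open>k\<close> and 0 from
  norm \<open>Suc k\<close> on. The product keeps away from singular matrices and has bounded
  support.\<close>

definition cutoff :: "nat \<Rightarrow> (real ^ 'q) \<times> (real ^ 'q ^ 'q) \<Rightarrow> real" where
  "cutoff k p = max 0 (min 1 (\<bar>det (snd p)\<bar> * real (Suc k) - 1)) * max 0 (min 1 (real (Suc k) - norm p))"

lemma continuous_on_truncated_inverse: "0 < \<delta> \<Longrightarrow> continuous_on S f \<Longrightarrow> continuous_on S (\<lambda>x. truncated_inverse \<delta> (f x))"
  unfolding truncated_inverse_def by (intro continuous_intros) (auto simp: max_def)

lemma continuous_on_cutoff: "continuous_on S (cutoff k)"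
  unfolding cutoff_def by (intro continuous_intros)

lemma cutoff_bounds: "0 \<le> cutoff k p" "cutoff k p \<le> 1"
  unfolding cutoff_def by (auto intro!: mult_le_one)

lemma cutoff_support: "real (Suc k) < norm p \<Longrightarrow> cutoff k p = 0"
  unfolding cutoff_def by simp

lemma cutoff_tendsto: "det (snd p) \<noteq> 0 \<Longrightarrow> (\<lambda>k. cutoff k p) \<longlonglongrightarrow> 1"
proof -
  assume d: "det (snd p) \<noteq> 0"
  obtain n1 :: nat where n1: "2 / \<bar>det (snd p)\<bar> < real n1" using reals_Archimedean2 by blast
  obtain n2 :: nat where n2: "norm p < real n2" using reals_Archimedean2 by blast
  have "cutoff k p = 1" if "max n1 n2 \<le> k" for k
  proof -
    have "2 / \<bar>det (snd p)\<bar> < real (Suc k)" "norm p \<le> real k"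
      using n1 n2 that by linarith+
    then have "2 \<le> \<bar>det (snd p)\<bar> * real (Suc k)" using d by (simp add: divide_less_eq mult.commute)
    then show ?thesis using \<open>norm p \<le> real k\<close> unfolding cutoff_def by (simp add: min_absorb1)
  qed
  then have "eventually (\<lambda>k. cutoff k p = 1) sequentially" unfolding eventually_sequentially by blast
  then show ?thesis by (rule tendsto_eventually)
qed

text \<open>Where the cutoff is nonzero, the absolute determinant exceeds \<open>1 / Suc k\<close>
  and the truncated inverse is exact.\<close>

lemma quad_cutoff:
  "f (quad c a U) * cutoff k (a, U) = f (cramer_num a U * truncated_inverse (1 / real (Suc k)) (det U)) * cutoff k (a, U)"
proof (cases "1 / real (Suc k) < \<bar>det U\<bar>")
  case True
  then have "(1 / real (Suc k))\<^sup>2 \<le> \<bar>det U\<bar>\<^sup>2" by (intro power_mono) auto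
  then have "truncated_inverse (1 / real (Suc k)) (det U) = 1 / det U"
    unfolding truncated_inverse_def by (simp add: max_absorb1 power2_eq_square)
  moreover have "det U \<noteq> 0" using True by auto
  ultimately show ?thesis by (simp add: quad_def)
next
  case False
  then have "\<bar>det U\<bar> * real (Suc k) \<le> 1" by (simp add: not_less le_divide_eq)
  then have "cutoff k (a, U) = 0" unfolding cutoff_def by simp
  then show ?thesis by simp
qed

text \<open>Replacing a bounded test function of the form by its cut-off version costs at most the
  expectation of \<open>1 - cutoff k\<close>. That expectation converges too, since
  \<open>cutoff k\<close> is itself an admissible test function, and its limit is small for large
  \<open>k\<close> because \<open>U'\<close> is almost surely nonsingular. This controls both the
  mass near singular matrices and the mass at infinity.\<close>

lemma weak_conv_quad:
  fixes a :: "nat \<Rightarrow> 'a \<Rightarrow> real ^ 'q" and a' :: "'b \<Rightarrow> real ^ 'q"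
  assumes M: "prob_space M" and N: "prob_space N"
    and [measurable]: "\<And>n. a n \<in> borel_measurable M" "\<And>n. U n \<in> borel_measurable M"
      "a' \<in> borel_measurable N" "U' \<in> borel_measurable N"
    and det: "AE \<omega> in N. det (U' \<omega>) \<noteq> 0"
    and conv: "\<And>\<Psi> r. continuous_on UNIV \<Psi> \<Longrightarrow> (\<And>p. \<bar>\<Psi> p\<bar> \<le> (1 :: real)) \<Longrightarrow> (\<And>p. r < norm p \<Longrightarrow> \<Psi> p = 0) \<Longrightarrow>
      (\<lambda>n. integral\<^sup>L M (\<lambda>\<omega>. \<Psi> (a n \<omega>, U n \<omega>))) \<longlonglongrightarrow> integral\<^sup>L N (\<lambda>\<omega>. \<Psi> (a' \<omega>, U' \<omega>))"
  shows "weak_conv_m (\<lambda>n. distr M borel (\<lambda>\<omega>. quad c (a n \<omega>) (U n \<omega>))) (distr N borel (\<lambda>\<omega>. quad c (a' \<omega>) (U' \<omega>)))"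
proof -
  interpret M: prob_space M by fact
  interpret N: prob_space N by fact
  have qM [measurable]: "(\<lambda>\<omega>. quad c (a n \<omega>) (U n \<omega>)) \<in> borel_measurable M" for n by (rule quad_measurable) measurable
  have qN [measurable]: "(\<lambda>\<omega>. quad c (a' \<omega>) (U' \<omega>)) \<in> borel_measurable N" by (rule quad_measurable) measurable
  show ?thesis
  proof (rule integral_cts_step_conv_imp_weak_conv)
    show "real_distribution (distr M borel (\<lambda>\<omega>. quad c (a n \<omega>) (U n \<omega>)))" for n
      by (rule M.real_distribution_distr) measurable
    show "real_distribution (distr N borel (\<lambda>\<omega>. quad c (a' \<omega>) (U' \<omega>)))"
      by (rule N.real_distribution_distr) measurable
    \<comment> \<open>Continuous ramps from 1 to 0 suffice as test functions for weak convergence on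
      the line.\<close>
    fix x y :: real assume xy: "x < y"
    define f where "f = cts_step x y"
    have fc: "continuous_on UNIV f" unfolding f_def
      by (rule uniformly_continuous_imp_continuous[OF cts_step_uniformly_continuous[OF xy]])
    have fb: "0 \<le> f z" "f z \<le> 1" for z using xy by (auto simp: f_def cts_step_def)
    have fm [measurable]: "f \<in> borel_measurable borel" by (rule borel_measurable_continuous_onI[OF fc])
    define \<Psi> where "\<Psi> = (\<lambda>k (p :: (real ^ 'q) \<times> (real ^ 'q ^ 'q)). f (cramer_num (fst p) (snd p) * truncated_inverse (1 / real (Suc k)) (det (snd p))) * cutoff k p)"
    have \<Psi>c: "continuous_on UNIV (\<Psi> k)" for k unfolding \<Psi>_def
      by (intro continuous_intros continuous_on_cutoff continuous_on_compose2[OF fc] continuous_on_truncated_inverse) auto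
    have \<Psi>b: "\<bar>\<Psi> k p\<bar> \<le> 1" for k p
      unfolding \<Psi>_def abs_mult using fb cutoff_bounds[of k p] by (intro mult_le_one) auto
    have cc: "\<bar>cutoff k p\<bar> \<le> 1" for k and p :: "(real ^ 'q) \<times> (real ^ 'q ^ 'q)" using cutoff_bounds[of k p] by auto
    have \<Psi>conv: "(\<lambda>n. M.expectation (\<lambda>\<omega>. \<Psi> k (a n \<omega>, U n \<omega>))) \<longlonglongrightarrow> N.expectation (\<lambda>\<omega>. \<Psi> k (a' \<omega>, U' \<omega>))" for k
      by (rule conv[of "\<Psi> k" "real (Suc k)"]) (auto simp: \<Psi>c \<Psi>b, simp add: \<Psi>_def cutoff_support)
    have cconv: "(\<lambda>n. M.expectation (\<lambda>\<omega>. cutoff k (a n \<omega>, U n \<omega>))) \<longlonglongrightarrow> N.expectation (\<lambda>\<omega>. cutoff k (a' \<omega>, U' \<omega>))" for k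
      by (rule conv[of "cutoff k" "real (Suc k)"]) (auto simp: cutoff_support cc continuous_on_cutoff)
    have [measurable]: "cutoff k \<in> borel_measurable (borel :: ((real ^ 'q) \<times> (real ^ 'q ^ 'q)) measure)" "\<Psi> k \<in> borel_measurable borel" for k
      by (intro borel_measurable_continuous_onI continuous_on_cutoff \<Psi>c)+
    have pM [measurable]: "(\<lambda>\<omega>. (a n \<omega>, U n \<omega>)) \<in> borel_measurable M" for n by (rule borel_measurable_Pair) measurable
    have pN [measurable]: "(\<lambda>\<omega>. (a' \<omega>, U' \<omega>)) \<in> borel_measurable N" by (rule borel_measurable_Pair) measurable
    have pw: "\<bar>f (quad c v W) - \<Psi> k (v, W)\<bar> \<le> 1 - cutoff k (v, W)" for k v W
    proof -
      have "f (quad c v W) - \<Psi> k (v, W) = f (quad c v W) * (1 - cutoff k (v, W))"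
        unfolding \<Psi>_def fst_conv snd_conv quad_cutoff[of f c v W k, symmetric] by (simp add: right_diff_distrib)
      then show ?thesis using fb[of "quad c v W"] cutoff_bounds[of k "(v, W)"] by (simp add: abs_mult mult_left_le_one_le)
    qed
    have approx: "\<bar>integral\<^sup>L P (\<lambda>\<omega>. f (quad c (v \<omega>) (W \<omega>))) - integral\<^sup>L P (\<lambda>\<omega>. \<Psi> k (v \<omega>, W \<omega>))\<bar> \<le> 1 - integral\<^sup>L P (\<lambda>\<omega>. cutoff k (v \<omega>, W \<omega>))"
      if P: "prob_space P" and [measurable]: "(\<lambda>\<omega>. quad c (v \<omega>) (W \<omega>)) \<in> borel_measurable P" "(\<lambda>\<omega>. (v \<omega>, W \<omega>)) \<in> borel_measurable P"
      for P :: "'c measure" and v W k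
    proof -
      interpret P: prob_space P by fact
      have i1: "integrable P (\<lambda>\<omega>. f (quad c (v \<omega>) (W \<omega>)))" by (rule P.integrable_const_bound[of _ 1]) (use fb in auto)
      have i2: "integrable P (\<lambda>\<omega>. \<Psi> k (v \<omega>, W \<omega>))" by (rule P.integrable_const_bound[of _ 1]) (use \<Psi>b in auto)
      have i3: "integrable P (\<lambda>\<omega>. cutoff k (v \<omega>, W \<omega>))" by (rule P.integrable_const_bound[of _ 1]) (use cc in auto)
      have "\<bar>integral\<^sup>L P (\<lambda>\<omega>. f (quad c (v \<omega>) (W \<omega>))) - integral\<^sup>L P (\<lambda>\<omega>. \<Psi> k (v \<omega>, W \<omega>))\<bar> = \<bar>integral\<^sup>L P (\<lambda>\<omega>. f (quad c (v \<omega>) (W \<omega>)) - \<Psi> k (v \<omega>, W \<omega>))\<bar>"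
        using i1 i2 by simp
      also have "\<dots> \<le> integral\<^sup>L P (\<lambda>\<omega>. \<bar>f (quad c (v \<omega>) (W \<omega>)) - \<Psi> k (v \<omega>, W \<omega>)\<bar>)" by (rule integral_abs_bound)
      also have "\<dots> \<le> integral\<^sup>L P (\<lambda>\<omega>. 1 - cutoff k (v \<omega>, W \<omega>))"
        using i1 i2 i3 by (intro integral_mono pw) auto
      also have "\<dots> = 1 - integral\<^sup>L P (\<lambda>\<omega>. cutoff k (v \<omega>, W \<omega>))" using i3 by (simp add: P.prob_space)
      finally show ?thesis .
    qed
    have "(\<lambda>k. N.expectation (\<lambda>\<omega>. cutoff k (a' \<omega>, U' \<omega>))) \<longlonglongrightarrow> N.expectation (\<lambda>\<omega>. 1)"
    proof (rule integral_dominated_convergence[where w = "\<lambda>_. 1"])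
      show "AE \<omega> in N. (\<lambda>k. cutoff k (a' \<omega>, U' \<omega>)) \<longlonglongrightarrow> 1"
        using det by eventually_elim (simp add: cutoff_tendsto)
    qed (use cc in auto)
    then have c1: "(\<lambda>k. N.expectation (\<lambda>\<omega>. cutoff k (a' \<omega>, U' \<omega>))) \<longlonglongrightarrow> 1" by (simp add: N.prob_space)
    have "(\<lambda>n. M.expectation (\<lambda>\<omega>. f (quad c (a n \<omega>) (U n \<omega>)))) \<longlonglongrightarrow> N.expectation (\<lambda>\<omega>. f (quad c (a' \<omega>) (U' \<omega>)))"
    proof (rule LIMSEQ_I)
      fix r :: real assume r: "0 < r"
      have "\<forall>\<^sub>F k in sequentially. 1 - r / 6 < N.expectation (\<lambda>\<omega>. cutoff k (a' \<omega>, U' \<omega>))"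
        by (rule order_tendstoD(1)[OF c1]) (use r in simp)
      then obtain k where k: "1 - r / 6 < N.expectation (\<lambda>\<omega>. cutoff k (a' \<omega>, U' \<omega>))" using eventually_happens by force
      obtain n1 where n1: "\<And>n. n1 \<le> n \<Longrightarrow> \<bar>M.expectation (\<lambda>\<omega>. \<Psi> k (a n \<omega>, U n \<omega>)) - N.expectation (\<lambda>\<omega>. \<Psi> k (a' \<omega>, U' \<omega>))\<bar> < r / 6"
        using LIMSEQ_D[OF \<Psi>conv[of k], of "r / 6"] r by auto
      obtain n2 where n2: "\<And>n. n2 \<le> n \<Longrightarrow> \<bar>M.expectation (\<lambda>\<omega>. cutoff k (a n \<omega>, U n \<omega>)) - N.expectation (\<lambda>\<omega>. cutoff k (a' \<omega>, U' \<omega>))\<bar> < r / 6"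
        using LIMSEQ_D[OF cconv[of k], of "r / 6"] r by auto
      show "\<exists>no. \<forall>n\<ge>no. norm (M.expectation (\<lambda>\<omega>. f (quad c (a n \<omega>) (U n \<omega>))) - N.expectation (\<lambda>\<omega>. f (quad c (a' \<omega>) (U' \<omega>)))) < r"
      proof (intro exI[of _ "max n1 n2"] allI impI)
        fix n assume "max n1 n2 \<le> n"
        then show "norm (M.expectation (\<lambda>\<omega>. f (quad c (a n \<omega>) (U n \<omega>))) - N.expectation (\<lambda>\<omega>. f (quad c (a' \<omega>) (U' \<omega>)))) < r"
          using n1[of n] n2[of n] k r approx[OF M qM pM, of n k] approx[OF N qN pN, of k] unfolding real_norm_def by linarith
      qed
    qed
    then show "(\<lambda>n. integral\<^sup>L (distr M borel (\<lambda>\<omega>. quad c (a n \<omega>) (U n \<omega>))) (cts_step x y)) \<longlonglongrightarrow> integral\<^sup>L (distr N borel (\<lambda>\<omega>. quad c (a' \<omega>) (U' \<omega>))) (cts_step x y)"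
      unfolding f_def[symmetric] by (simp add: integral_distr)
  qed
qed

section \<open>Partial sums and their limit distribution\<close>

lemma transpose_inner: "(A *v x) \<bullet> y = x \<bullet> (transpose A *v y)" for A :: "real ^ 'n ^ 'm"
  by (metis dot_lmul_matrix vector_transpose_matrix transpose_transpose)

text \<open>A basis orthonormal for the form \<open>\<Sigma>\<close> is built one vector at a time; the matrix with these
  rows inverts the square root.\<close>

lemma positive_definite_factor:
  fixes \<Sigma> :: "real ^ 'q ^ 'q"
  assumes "positive_definite \<Sigma>"
  obtains C :: "real ^ 'q ^ 'q" where "invertible C" "C ** transpose C = \<Sigma>"
proof -
  have sym: "transpose \<Sigma> = \<Sigma>" and pos: "\<And>x. x \<noteq> 0 \<Longrightarrow> 0 < x \<bullet> (\<Sigma> *v x)"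
    using assms by (auto simp: positive_definite_def)
  have symf: "x \<bullet> (\<Sigma> *v y) = y \<bullet> (\<Sigma> *v x)" for x y
    using transpose_inner[of \<Sigma> x y] by (simp add: sym inner_commute)
  have "\<exists>v :: 'q \<Rightarrow> real ^ 'q. \<forall>i\<in>K. \<forall>j\<in>K. v i \<bullet> (\<Sigma> *v v j) = (if i = j then 1 else 0)" if "finite K" for K
    using that
  proof (induction K rule: finite_induct)
    case (insert k K)
    then obtain v :: "'q \<Rightarrow> real ^ 'q" where v: "\<forall>i\<in>K. \<forall>j\<in>K. v i \<bullet> (\<Sigma> *v v j) = (if i = j then 1 else 0)" by blast
    let ?S = "(\<lambda>i. \<Sigma> *v v i) ` K"
    \<comment> \<open>Fewer than \<open>CARD('q)\<close> vectors do not span, so some nonzero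
      \<open>w\<close> is orthogonal to every \<open>\<Sigma> *v v i\<close>, which is orthogonality
      to \<open>v i\<close> for the form.\<close>
    have "dim ?S \<le> card K" using dim_le_card'[of ?S] card_image_le[of K "\<lambda>i. \<Sigma> *v v i"] insert.hyps(1) by simp
    also have "card K < card (UNIV :: 'q set)" using insert.hyps(2) by (intro psubset_card_mono) auto
    finally have "dim ?S < DIM(real ^ 'q)" by simp
    then have "span ?S \<noteq> UNIV" using dim_eq_full[of ?S] by auto
    then obtain w where w: "w \<noteq> 0" "\<And>x. x \<in> span ?S \<Longrightarrow> orthogonal w x"
      using orthogonal_to_subspace_exists[OF \<open>dim ?S < DIM(real ^ 'q)\<close>] by blast
    have wv: "w \<bullet> (\<Sigma> *v v i) = 0" if "i \<in> K" for i
      using w(2)[OF span_base[of "\<Sigma> *v v i"]] that by (auto simp: orthogonal_def)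
    define c where "c = 1 / sqrt (w \<bullet> (\<Sigma> *v w))"
    have "(c *\<^sub>R w) \<bullet> (\<Sigma> *v (c *\<^sub>R w)) = c\<^sup>2 * (w \<bullet> (\<Sigma> *v w))"
      by (simp add: matrix_vector_mult_scaleR power2_eq_square)
    also have "\<dots> = 1" using pos[OF w(1)] by (simp add: c_def power_divide)
    finally have 1: "(c *\<^sub>R w) \<bullet> (\<Sigma> *v (c *\<^sub>R w)) = 1" .
    have 2: "(c *\<^sub>R w) \<bullet> (\<Sigma> *v v i) = 0" "v i \<bullet> (\<Sigma> *v (c *\<^sub>R w)) = 0" if "i \<in> K" for i
      using wv[OF that] symf[of "v i" w] by (simp_all add: matrix_vector_mult_scaleR)
    have "\<forall>i\<in>insert k K. \<forall>j\<in>insert k K. (v(k := c *\<^sub>R w)) i \<bullet> (\<Sigma> *v (v(k := c *\<^sub>R w)) j) = (if i = j then 1 else 0)"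
      using v 1 2 insert.hyps(2) by auto
    then show ?case by blast
  qed simp
  from this[of UNIV] obtain v :: "'q \<Rightarrow> real ^ 'q" where v: "\<And>i j. v i \<bullet> (\<Sigma> *v v j) = (if i = j then 1 else 0)" by auto
  define A where "A = (\<chi> i. v i)"
  have "(A ** \<Sigma> ** transpose A) $ i $ j = v i \<bullet> (\<Sigma> *v v j)" for i j
  proof -
    have "(A ** \<Sigma> ** transpose A) $ i $ j = (\<Sum>l\<in>UNIV. (\<Sum>k\<in>UNIV. v i $ k * \<Sigma> $ k $ l) * v j $ l)"
      by (simp add: matrix_matrix_mult_def transpose_def A_def)
    also have "\<dots> = (\<Sum>k\<in>UNIV. \<Sum>l\<in>UNIV. v i $ k * \<Sigma> $ k $ l * v j $ l)"
      unfolding sum_distrib_right by (rule sum.swap)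
    also have "\<dots> = v i \<bullet> (\<Sigma> *v v j)"
      by (simp add: inner_vec_def matrix_vector_mult_def sum_distrib_left mult.assoc)
    finally show ?thesis .
  qed
  then have I: "A ** \<Sigma> ** transpose A = mat 1" by (simp add: vec_eq_iff mat_def v)
  then have "A ** (\<Sigma> ** transpose A) = mat 1" by (simp add: matrix_mul_assoc)
  then have "invertible A" by (auto simp: invertible_right_inverse)
  define C where "C = matrix_inv A"
  have CA: "C ** A = mat 1" "A ** C = mat 1"
    unfolding C_def using matrix_inv_left[OF \<open>invertible A\<close>] matrix_inv_right[OF \<open>invertible A\<close>] by auto
  have "transpose A ** transpose C = mat 1" by (metis CA(1) matrix_transpose_mul transpose_mat)
  then have "C ** transpose C = C ** (A ** \<Sigma> ** transpose A) ** transpose C" by (simp add: I)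
  also have "\<dots> = (C ** A) ** \<Sigma> ** (transpose A ** transpose C)" by (simp only: matrix_mul_assoc)
  also have "\<dots> = \<Sigma>" by (simp add: CA \<open>transpose A ** transpose C = mat 1\<close>)
  finally show ?thesis using CA by (intro that[of C]) (auto simp: invertible_def)
qed

lemma inner_transpose_transpose:
  fixes C :: "real ^ 'q ^ 'q"
  assumes "C ** transpose C = \<Sigma>"
  shows "(norm (transpose C *v u))\<^sup>2 = u \<bullet> (\<Sigma> *v u)"
proof -
  have "u \<bullet> (\<Sigma> *v u) = u \<bullet> (C *v (transpose C *v u))" unfolding assms[symmetric] by (simp only: matrix_vector_mul_assoc)
  also have "\<dots> = (transpose C *v u) \<bullet> (transpose C *v u)"
    using transpose_inner[of C "transpose C *v u" u] by (simp add: inner_commute)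
  finally show ?thesis by (simp add: power2_norm_eq_inner)
qed

text \<open>The mixed second difference of the Brownian covariance kernel \<open>min\<close>: over a
  grid it is the covariance of increments, diagonal with entries \<open>1 / l\<close>.\<close>

lemma min_second_difference:
  assumes "0 < l"
  shows "min (real (Suc i) / l) (real (Suc j) / l) - min (real (Suc i) / l) (real j / l)
     - min (real i / l) (real (Suc j) / l) + min (real i / l) (real j / l) = (if i = j then 1 / real l else 0)"
proof -
  have "min (a / real l) (b / real l) = min a b / real l" for a b using assms by (simp add: min_divide_distrib_right)
  moreover have "min (real (Suc i)) (real (Suc j)) - min (real (Suc i)) (real j) - min (real i) (real (Suc j)) + min (real i) (real j)
      = (if i = j then 1 else 0)"
    by (cases i j rule: linorder_cases) (auto simp: min_def)
  ultimately show ?thesis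
    by (simp only: diff_divide_distrib[symmetric] add_divide_distrib[symmetric]) simp
qed

lemma abs_nat_diff_le: "k \<le> n \<Longrightarrow> k' \<le> n \<Longrightarrow> \<bar>real k - real k'\<bar> \<le> real n"
  by (auto simp: abs_le_iff)

text \<open>\<open>i div l\<close> takes each value below \<open>n\<close> exactly \<open>l\<close>
  times.\<close>

lemma sum_lessThan_mult_div:
  fixes f :: "nat \<Rightarrow> 'v::real_vector"
  assumes "0 < l"
  shows "(\<Sum>i<n * l. f (i div l)) = real l *\<^sub>R (\<Sum>k<n. f k)"
proof -
  have "(\<Sum>i<n * l. f (i div l)) = (\<Sum>k<n. \<Sum>i\<in>{k * l..<k * l + l}. f (i div l))"
    by (rule sum.nat_group[symmetric])
  also have "\<dots> = (\<Sum>k<n. \<Sum>i\<in>{k * l..<k * l + l}. f k)"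
  proof (intro sum.cong refl)
    fix k i assume "i \<in> {k * l..<k * l + l}"
    then have "i div l = k" by (intro div_nat_eqI) (auto simp: mult.commute)
    then show "f (i div l) = f k" by simp
  qed
  finally show ?thesis by (simp add: scaleR_sum_right sum_constant_scaleR)
qed

section \<open>Increments of the partial sums over a fixed grid\<close>

locale null_process_limit = predictable_mean_zero M F Z m \<tau> \<eta> C \<alpha> + BM: brownian N B
  for M :: "'a measure" and F and Z :: "nat \<Rightarrow> 'a \<Rightarrow> real ^ 'q" and m \<tau> \<eta> C \<alpha>
    and N :: "'b measure" and B :: "real \<Rightarrow> 'b \<Rightarrow> real ^ 'q" +
  fixes \<Sigma> :: "real ^ 'q ^ 'q"
  assumes pd: "positive_definite \<Sigma>"
    and cov: "\<And>r s. r \<in> {0..1} \<Longrightarrow> s \<in> {0..1} \<Longrightarrow>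
           (\<lambda>n. (1 / real n) *\<^sub>R cross_cov M (partial_sum m Z n r) (partial_sum m Z n s))
             \<longlonglongrightarrow> min r s *\<^sub>R \<Sigma>"
begin

definition Zsum :: "nat \<Rightarrow> 'a \<Rightarrow> real ^ 'q" where "Zsum k \<omega> = (\<Sum>t\<in>{m..<m + k}. Z t \<omega>)"

definition moment_const :: real where "moment_const = CARD('q) * (2 * \<tau> * (1 + C))"

lemma moment_const_nonneg: "0 \<le> moment_const" unfolding moment_const_def using C by simp

lemma partial_sum_eq: "partial_sum m Z n r = Zsum (nat \<lfloor>real n * r\<rfloor>)"
  by (simp add: partial_sum_def Zsum_def fun_eq_iff)

lemma Zsum_measurable [measurable (raw)]: "Zsum k \<in> borel_measurable M"
  unfolding Zsum_def[abs_def] by (intro borel_measurable_sum) auto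

lemma
  assumes "finite I" "I \<subseteq> {m..}"
  shows Z_sum_square_integrable: "integrable M (\<lambda>\<omega>. (norm (\<Sum>t\<in>I. Z t \<omega>))\<^sup>2)"
    and Z_sum_square_le: "expectation (\<lambda>\<omega>. (norm (\<Sum>t\<in>I. Z t \<omega>))\<^sup>2) \<le> moment_const * card I"
proof -
  have a: "norm (axis j (1::real) :: real ^ 'q) \<le> 1" for j by simp
  have x: "(\<Sum>t\<in>I. Z t \<omega>) $ j = (\<Sum>t\<in>I. weighted (\<lambda>_. axis j 1) t \<omega>)" for j \<omega>
    unfolding weighted_def[OF a] by (simp add: inner_axis' sum_component)
  have eq: "(norm (\<Sum>t\<in>I. Z t \<omega>))\<^sup>2 = (\<Sum>j\<in>UNIV. (\<Sum>t\<in>I. weighted (\<lambda>_. axis j 1) t \<omega>)\<^sup>2)" for \<omega>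
    unfolding x[symmetric] by (simp add: norm_vec_def L2_set_def sum_nonneg)
  note i = weighted_sum_square_integrable[OF a assms]
  show "integrable M (\<lambda>\<omega>. (norm (\<Sum>t\<in>I. Z t \<omega>))\<^sup>2)" unfolding eq by (intro Bochner_Integration.integrable_sum i)
  have "expectation (\<lambda>\<omega>. (norm (\<Sum>t\<in>I. Z t \<omega>))\<^sup>2) = (\<Sum>j\<in>UNIV. expectation (\<lambda>\<omega>. (\<Sum>t\<in>I. weighted (\<lambda>_. axis j 1) t \<omega>)\<^sup>2))"
    unfolding eq by (intro Bochner_Integration.integral_sum i)
  also have "\<dots> \<le> (\<Sum>j\<in>(UNIV :: 'q set). 2 * \<tau> * card I * (1\<^sup>2 * (1 + C)))"
    by (intro sum_mono weighted_sum_square_le[OF a assms])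
  also have "\<dots> = moment_const * card I" by (simp add: moment_const_def)
  finally show "expectation (\<lambda>\<omega>. (norm (\<Sum>t\<in>I. Z t \<omega>))\<^sup>2) \<le> moment_const * card I" .
qed

lemma Zsum_diff: "k' \<le> k \<Longrightarrow> Zsum k \<omega> - Zsum k' \<omega> = (\<Sum>t\<in>{m + k'..<m + k}. Z t \<omega>)"
  unfolding Zsum_def using sum_diff_nat_ivl[of m "m + k'" "m + k" "\<lambda>t. Z t \<omega>"] by simp

lemma
  shows Zsum_diff_integrable: "integrable M (\<lambda>\<omega>. (norm (Zsum k \<omega> - Zsum k' \<omega>))\<^sup>2)"
    and Zsum_diff_le: "expectation (\<lambda>\<omega>. (norm (Zsum k \<omega> - Zsum k' \<omega>))\<^sup>2) \<le> moment_const * \<bar>real k - real k'\<bar>"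
proof -
  have *: "integrable M (\<lambda>\<omega>. (norm (Zsum k \<omega> - Zsum k' \<omega>))\<^sup>2) \<and> expectation (\<lambda>\<omega>. (norm (Zsum k \<omega> - Zsum k' \<omega>))\<^sup>2) \<le> moment_const * \<bar>real k - real k'\<bar>"
    if "k' \<le> k" for k k'
  proof -
    have "{m + k'..<m + k} \<subseteq> {m..}" by auto
    with Z_sum_square_integrable[of "{m + k'..<m + k}"] Z_sum_square_le[of "{m + k'..<m + k}"] that
    show ?thesis by (simp add: Zsum_diff)
  qed
  have "integrable M (\<lambda>\<omega>. (norm (Zsum k \<omega> - Zsum k' \<omega>))\<^sup>2) \<and> expectation (\<lambda>\<omega>. (norm (Zsum k \<omega> - Zsum k' \<omega>))\<^sup>2) \<le> moment_const * \<bar>real k - real k'\<bar>"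
    using *[of k' k] *[of k k'] by (cases "k' \<le> k") (auto simp: norm_minus_commute abs_minus_commute)
  then show "integrable M (\<lambda>\<omega>. (norm (Zsum k \<omega> - Zsum k' \<omega>))\<^sup>2)"
    "expectation (\<lambda>\<omega>. (norm (Zsum k \<omega> - Zsum k' \<omega>))\<^sup>2) \<le> moment_const * \<bar>real k - real k'\<bar>" by auto
qed

lemma Zsum_zero: "Zsum 0 \<omega> = 0" by (simp add: Zsum_def)

lemma
  shows Zsum_square_integrable: "integrable M (\<lambda>\<omega>. (norm (Zsum k \<omega>))\<^sup>2)"
    and Zsum_square_le: "expectation (\<lambda>\<omega>. (norm (Zsum k \<omega>))\<^sup>2) \<le> moment_const * k"
  using Zsum_diff_integrable[of k 0] Zsum_diff_le[of k 0] by (simp_all add: Zsum_zero)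

lemma Zsum_product_integrable: "integrable M (\<lambda>\<omega>. (u \<bullet> Zsum k \<omega>) * (w \<bullet> Zsum k' \<omega>))"
proof (rule Bochner_Integration.integrable_bound)
  show "integrable M (\<lambda>\<omega>. norm u * norm w * ((norm (Zsum k \<omega>))\<^sup>2 + (norm (Zsum k' \<omega>))\<^sup>2))"
    using Zsum_square_integrable by simp
  have "norm ((u \<bullet> Zsum k \<omega>) * (w \<bullet> Zsum k' \<omega>)) \<le> norm (norm u * norm w * ((norm (Zsum k \<omega>))\<^sup>2 + (norm (Zsum k' \<omega>))\<^sup>2))" for \<omega>
  proof -
    have "norm ((u \<bullet> Zsum k \<omega>) * (w \<bullet> Zsum k' \<omega>)) \<le> (norm u * norm (Zsum k \<omega>)) * (norm w * norm (Zsum k' \<omega>))"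
      unfolding real_norm_def abs_mult by (intro mult_mono Cauchy_Schwarz_ineq2) auto
    also have "\<dots> = norm u * norm w * (norm (Zsum k \<omega>) * norm (Zsum k' \<omega>))" by (simp add: mult_ac)
    also have "norm (Zsum k \<omega>) * norm (Zsum k' \<omega>) \<le> (norm (Zsum k \<omega>))\<^sup>2 + (norm (Zsum k' \<omega>))\<^sup>2"
    proof -
      have "0 \<le> norm (Zsum k \<omega>) * norm (Zsum k' \<omega>)" by simp
      then show ?thesis using sum_squares_bound[of "norm (Zsum k \<omega>)" "norm (Zsum k' \<omega>)"] by linarith
    qed
    then have "norm u * norm w * (norm (Zsum k \<omega>) * norm (Zsum k' \<omega>)) \<le> norm u * norm w * ((norm (Zsum k \<omega>))\<^sup>2 + (norm (Zsum k' \<omega>))\<^sup>2)"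
      by (intro mult_left_mono) auto
    finally show ?thesis by simp
  qed
  then show "AE \<omega> in M. norm ((u \<bullet> Zsum k \<omega>) * (w \<bullet> Zsum k' \<omega>)) \<le> norm (norm u * norm w * ((norm (Zsum k \<omega>))\<^sup>2 + (norm (Zsum k' \<omega>))\<^sup>2))"
    by simp
qed measurable

lemma Zsum_expectation: "expectation (\<lambda>\<omega>. Zsum k \<omega> $ i) = 0"
proof -
  have a: "norm (axis i (1::real) :: real ^ 'q) \<le> 1" by simp
  have i: "integrable M (\<lambda>\<omega>. Z t \<omega> $ i)" if "m \<le> t" for t
    using weighted_integrable[OF a that] unfolding weighted_def[OF a, abs_def] by (simp add: inner_axis')
  have "expectation (\<lambda>\<omega>. Z t \<omega> $ i) = 0" if "m \<le> t" for t
    using Z_orth[OF that, of "\<lambda>_. 1" "axis i 1"] i[OF that] by (simp add: inner_axis')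
  then show ?thesis unfolding Zsum_def sum_component using i by (subst Bochner_Integration.integral_sum) auto
qed

text \<open>The means vanish by orthogonality to constants, so the covariances of the hypothesis are
  plain second moments.\<close>

lemma cross_cov_Zsum: "u \<bullet> (cross_cov M (Zsum k) (Zsum k') *v w) = expectation (\<lambda>\<omega>. (u \<bullet> Zsum k \<omega>) * (w \<bullet> Zsum k' \<omega>))"
proof -
  have i: "integrable M (\<lambda>\<omega>. Zsum k \<omega> $ i * Zsum k' \<omega> $ j)" for i j
    using Zsum_product_integrable[of "axis i 1" k "axis j 1" k'] by (simp add: inner_axis')
  have "expectation (\<lambda>\<omega>. (u \<bullet> Zsum k \<omega>) * (w \<bullet> Zsum k' \<omega>)) = expectation (\<lambda>\<omega>. \<Sum>i\<in>UNIV. \<Sum>j\<in>UNIV. u $ i * w $ j * (Zsum k \<omega> $ i * Zsum k' \<omega> $ j))"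
    by (simp add: inner_vec_def sum_product mult_ac)
  also have "\<dots> = (\<Sum>i\<in>UNIV. \<Sum>j\<in>UNIV. u $ i * w $ j * expectation (\<lambda>\<omega>. Zsum k \<omega> $ i * Zsum k' \<omega> $ j))"
    using i by (simp add: Bochner_Integration.integral_sum)
  also have "\<dots> = u \<bullet> (cross_cov M (Zsum k) (Zsum k') *v w)"
    by (simp add: cross_cov_def Zsum_expectation inner_vec_def matrix_vector_mult_def sum_distrib_left mult_ac)
  finally show ?thesis by simp
qed

lemma Zsum_product_tendsto:
  assumes "r \<in> {0..1}" "s \<in> {0..1}"
  shows "(\<lambda>n. expectation (\<lambda>\<omega>. (u \<bullet> partial_sum m Z n r \<omega>) * (w \<bullet> partial_sum m Z n s \<omega>)) / n) \<longlonglongrightarrow> min r s * (u \<bullet> (\<Sigma> *v w))"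
proof -
  have bl: "bounded_linear (\<lambda>A::real ^ 'q ^ 'q. u \<bullet> (A *v w))"
    by (intro linear_linear[THEN iffD2] linearI)
      (simp_all add: matrix_vector_mult_add_rdistrib inner_add_right scaleR_matrix_vector_assoc[symmetric])
  from bounded_linear.tendsto[OF bl cov[OF assms]] show ?thesis
    unfolding partial_sum_eq by (simp add: scaleR_matrix_vector_assoc[symmetric] cross_cov_Zsum)
qed

definition Delta :: "nat \<Rightarrow> nat \<Rightarrow> nat \<Rightarrow> 'a \<Rightarrow> real ^ 'q" where
  "Delta l n i \<omega> = partial_sum m Z n (real (Suc i) / l) \<omega> - partial_sum m Z n (real i / l) \<omega>"

text \<open>Expanding the increments expresses the variance through second differences of
  covariances of partial sums. In the limit the kernel \<open>min\<close> makes different increments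
  uncorrelated.\<close>

lemma Delta_variance_tendsto:
  assumes l: "0 < l"
  shows "(\<lambda>n. expectation (\<lambda>\<omega>. (\<Sum>i<l. u i \<bullet> Delta l n i \<omega>)\<^sup>2) / n) \<longlonglongrightarrow> (\<Sum>i<l. u i \<bullet> (\<Sigma> *v u i)) / l"
proof -
  define g where "g = (\<lambda>n u w i j. expectation (\<lambda>\<omega>. (u \<bullet> partial_sum m Z n (real i / l) \<omega>) * (w \<bullet> partial_sum m Z n (real j / l) \<omega>)))"
  have "expectation (\<lambda>\<omega>. (u \<bullet> Delta l n i \<omega>) * (w \<bullet> Delta l n j \<omega>))
     = g n u w (Suc i) (Suc j) - g n u w (Suc i) j - g n u w i (Suc j) + g n u w i j" for n u w i j
  proof -
    have "(u \<bullet> Delta l n i \<omega>) * (w \<bullet> Delta l n j \<omega>)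
      = (u \<bullet> partial_sum m Z n (real (Suc i) / l) \<omega>) * (w \<bullet> partial_sum m Z n (real (Suc j) / l) \<omega>)
       - (u \<bullet> partial_sum m Z n (real (Suc i) / l) \<omega>) * (w \<bullet> partial_sum m Z n (real j / l) \<omega>)
       - (u \<bullet> partial_sum m Z n (real i / l) \<omega>) * (w \<bullet> partial_sum m Z n (real (Suc j) / l) \<omega>)
       + (u \<bullet> partial_sum m Z n (real i / l) \<omega>) * (w \<bullet> partial_sum m Z n (real j / l) \<omega>)" for \<omega>
      unfolding Delta_def inner_diff_right by (simp add: algebra_simps)
    then show ?thesis unfolding g_def partial_sum_eq by (simp add: Zsum_product_integrable)
  qed
  moreover have "integrable M (\<lambda>\<omega>. (u \<bullet> Delta l n i \<omega>) * (w \<bullet> Delta l n j \<omega>))" for n u w i j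
    unfolding Delta_def inner_diff_right left_diff_distrib right_diff_distrib partial_sum_eq
    by (intro Bochner_Integration.integrable_diff Zsum_product_integrable)
  ultimately have eq: "expectation (\<lambda>\<omega>. (\<Sum>i<l. u i \<bullet> Delta l n i \<omega>)\<^sup>2) / n
    = (\<Sum>i<l. \<Sum>j<l. g n (u i) (u j) (Suc i) (Suc j) / n - g n (u i) (u j) (Suc i) j / n - g n (u i) (u j) i (Suc j) / n + g n (u i) (u j) i j / n)" for n
    unfolding power2_eq_square sum_product
    by (simp add: Bochner_Integration.integral_sum sum_divide_distrib add_divide_distrib diff_divide_distrib)
  have gl: "(\<lambda>n. g n u w i j / n) \<longlonglongrightarrow> min (real i / l) (real j / l) * (u \<bullet> (\<Sigma> *v w))" if "i \<le> l" "j \<le> l" for u w i j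
    unfolding g_def by (rule Zsum_product_tendsto) (use that l in \<open>auto simp: divide_le_eq_1\<close>)
  have "(\<lambda>n. expectation (\<lambda>\<omega>. (\<Sum>i<l. u i \<bullet> Delta l n i \<omega>)\<^sup>2) / n) \<longlonglongrightarrow>
     (\<Sum>i<l. \<Sum>j<l. min (real (Suc i) / l) (real (Suc j) / l) * (u i \<bullet> (\<Sigma> *v u j)) - min (real (Suc i) / l) (real j / l) * (u i \<bullet> (\<Sigma> *v u j))
       - min (real i / l) (real (Suc j) / l) * (u i \<bullet> (\<Sigma> *v u j)) + min (real i / l) (real j / l) * (u i \<bullet> (\<Sigma> *v u j)))"
    unfolding eq by (intro tendsto_sum tendsto_add tendsto_diff gl) auto
  also have "(\<Sum>i<l. \<Sum>j<l. min (real (Suc i) / l) (real (Suc j) / l) * (u i \<bullet> (\<Sigma> *v u j)) - min (real (Suc i) / l) (real j / l) * (u i \<bullet> (\<Sigma> *v u j))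
       - min (real i / l) (real (Suc j) / l) * (u i \<bullet> (\<Sigma> *v u j)) + min (real i / l) (real j / l) * (u i \<bullet> (\<Sigma> *v u j)))
     = (\<Sum>i<l. \<Sum>j<l. (if i = j then 1 / real l else 0) * (u i \<bullet> (\<Sigma> *v u j)))"
    unfolding left_diff_distrib[symmetric] distrib_right[symmetric] min_second_difference[OF l] ..
  also have "\<dots> = (\<Sum>i<l. (1 / real l) * (u i \<bullet> (\<Sigma> *v u i)))"
    by (intro sum.cong refl) (simp add: if_distrib[of "\<lambda>x. x * _"] cong: if_cong)
  also have "\<dots> = (\<Sum>i<l. u i \<bullet> (\<Sigma> *v u i)) / l" by (simp add: sum_divide_distrib)
  finally show ?thesis .
qed

text \<open>The linear combination of increments is one sum over \<open>{m..<m + n}\<close> whose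
  weight at \<open>t\<close> is the \<open>u i\<close> of the cell that contains \<open>t\<close>.
  The norms of these weights are bounded independently of \<open>n\<close>, as the scalar limit
  theorem demands.\<close>

lemma Delta_char_tendsto:
  assumes l: "0 < l"
  shows "(\<lambda>n. integral\<^sup>L M (\<lambda>\<omega>. iexp ((\<Sum>i<l. u i \<bullet> Delta l n i \<omega>) / sqrt n))) \<longlonglongrightarrow> of_real (exp (- ((\<Sum>i<l. u i \<bullet> (\<Sigma> *v u i)) / l) / 2))"
proof -
  define b where "b = (\<lambda>n i. nat \<lfloor>real n * (real i / l)\<rfloor>)"
  define I where "I = (\<lambda>n i. {m + b n i..<m + b n (Suc i)})"
  define a where "a = (\<lambda>n t. \<Sum>i<l. if t \<in> I n i then u i else 0)"
  have bmono: "b n i \<le> b n (Suc i)" for n i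
    unfolding b_def by (intro nat_mono floor_mono mult_left_mono divide_right_mono) auto
  have bn: "b n i \<le> n" if "i \<le> l" for n i
  proof -
    have "real n * (real i / l) \<le> real n * 1" using that l by (intro mult_left_mono) (auto simp: divide_le_eq_1)
    then show ?thesis unfolding b_def by (simp add: nat_le_iff floor_le_iff)
  qed
  have "norm (a n t) \<le> (\<Sum>i<l. norm (u i))" for n t
    unfolding a_def by (rule order_trans[OF norm_sum]) (auto intro!: sum_mono)
  moreover have eq: "(\<Sum>t\<in>{m..<m + n}. a n t \<bullet> Z t \<omega>) = (\<Sum>i<l. u i \<bullet> Delta l n i \<omega>)" for n \<omega>
  proof -
    have "(\<Sum>t\<in>{m..<m + n}. a n t \<bullet> Z t \<omega>) = (\<Sum>t\<in>{m..<m + n}. \<Sum>i<l. if t \<in> I n i then u i \<bullet> Z t \<omega> else 0)"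
      unfolding a_def inner_sum_left by (intro sum.cong refl) auto
    also have "\<dots> = (\<Sum>i<l. \<Sum>t\<in>{m..<m + n}. if t \<in> I n i then u i \<bullet> Z t \<omega> else 0)" by (rule sum.swap)
    also have "\<dots> = (\<Sum>i<l. u i \<bullet> Delta l n i \<omega>)"
    proof (intro sum.cong refl)
      fix i assume i: "i \<in> {..<l}"
      have "I n i \<subseteq> {m..<m + n}" using bn[of "Suc i" n] i unfolding I_def by auto
      then have "(\<Sum>t\<in>{m..<m + n}. if t \<in> I n i then u i \<bullet> Z t \<omega> else 0) = (\<Sum>t\<in>I n i. u i \<bullet> Z t \<omega>)"
        by (simp add: sum.If_cases Int_absorb1)
      also have "\<dots> = u i \<bullet> (Zsum (b n (Suc i)) \<omega> - Zsum (b n i) \<omega>)"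
        unfolding Zsum_diff[OF bmono] I_def inner_sum_right ..
      finally show "(\<Sum>t\<in>{m..<m + n}. if t \<in> I n i then u i \<bullet> Z t \<omega> else 0) = u i \<bullet> Delta l n i \<omega>"
        unfolding Delta_def partial_sum_eq b_def .
    qed
    finally show ?thesis .
  qed
  ultimately show ?thesis
    using char_weighted_sum_tendsto[of a "\<Sum>i<l. norm (u i)" "(\<Sum>i<l. u i \<bullet> (\<Sigma> *v u i)) / l"] Delta_variance_tendsto[OF l, of u]
    by simp
qed

definition scaled_Delta :: "nat \<Rightarrow> nat \<Rightarrow> 'a \<Rightarrow> nat \<Rightarrow> real ^ 'q" where
  "scaled_Delta l n \<omega> i = (if i < l then (1 / sqrt n) *\<^sub>R Delta l n i \<omega> else 0)"

lemma Delta_measurable [measurable (raw)]: "Delta l n i \<in> borel_measurable M"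
  unfolding Delta_def[abs_def] partial_sum_eq by measurable

lemma scaled_Delta_measurable [measurable (raw)]: "(\<lambda>\<omega>. scaled_Delta l n \<omega> i) \<in> borel_measurable M"
  unfolding scaled_Delta_def by measurable

lemma floor_ratio_bounds:
  assumes "i \<le> l" "0 < l"
  shows "nat \<lfloor>real n * (real i / l)\<rfloor> \<le> n"
    and "real (nat \<lfloor>real n * (real i / l)\<rfloor>) \<le> real n * (real i / l)"
    and "real n * (real i / l) < real (nat \<lfloor>real n * (real i / l)\<rfloor>) + 1"
proof -
  have "real n * (real i / l) \<le> real n * 1" using assms by (intro mult_left_mono) (auto simp: divide_le_eq_1)
  then show "nat \<lfloor>real n * (real i / l)\<rfloor> \<le> n" by (simp add: nat_le_iff floor_le_iff)
  have "0 \<le> real n * (real i / l)" by simp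
  then show "real (nat \<lfloor>real n * (real i / l)\<rfloor>) \<le> real n * (real i / l)"
    "real n * (real i / l) < real (nat \<lfloor>real n * (real i / l)\<rfloor>) + 1" by linarith+
qed

lemma scaled_Delta_tight:
  assumes "0 < l" "0 < e"
  shows "\<exists>K. \<forall>n. prob {\<omega>\<in>space M. \<exists>i<l. K < norm (scaled_Delta l n \<omega> i)} \<le> e"
proof -
  \<comment> \<open>Chebyshev's inequality with a union bound over the \<open>l\<close> coordinates;
    the summand 1 keeps \<open>K\<close> positive when \<open>moment_const\<close> is 0.\<close>
  define K where "K = sqrt (real l * moment_const / e) + 1"
  have K: "0 < K" "real l * moment_const / e \<le> K\<^sup>2"
  proof -
    have "0 \<le> real l * moment_const / e" using assms moment_const_nonneg by simp
    then have s: "0 \<le> sqrt (real l * moment_const / e)" "(sqrt (real l * moment_const / e))\<^sup>2 = real l * moment_const / e"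
      by (rule real_sqrt_ge_zero, rule real_sqrt_pow2)
    show "0 < K" unfolding K_def using s(1) by linarith
    have "(sqrt (real l * moment_const / e))\<^sup>2 \<le> K\<^sup>2" unfolding K_def using s(1) by (intro power_mono) auto
    then show "real l * moment_const / e \<le> K\<^sup>2" unfolding s(2) .
  qed
  have "prob {\<omega>\<in>space M. \<exists>i<l. K < norm (scaled_Delta l n \<omega> i)} \<le> e" for n
  proof -
    have 1: "prob {\<omega>\<in>space M. K < norm (scaled_Delta l n \<omega> i)} \<le> moment_const / K\<^sup>2" if "i < l" for i
    proof -
      have sq: "(norm (scaled_Delta l n \<omega> i))\<^sup>2 = (1 / n) * (norm (Delta l n i \<omega>))\<^sup>2" for \<omega>
        using that by (simp add: scaled_Delta_def power_mult_distrib power_divide)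
      have i: "integrable M (\<lambda>\<omega>. (norm (scaled_Delta l n \<omega> i))\<^sup>2)"
        unfolding sq Delta_def partial_sum_eq using Zsum_diff_integrable by simp
      let ?k = "nat \<lfloor>real n * (real (Suc i) / l)\<rfloor>" and ?k' = "nat \<lfloor>real n * (real i / l)\<rfloor>"
      have le: "?k \<le> n" "?k' \<le> n" by (rule floor_ratio_bounds(1); use that assms in simp)+
      have "expectation (\<lambda>\<omega>. (norm (scaled_Delta l n \<omega> i))\<^sup>2) \<le> (1 / n) * (moment_const * \<bar>real ?k - real ?k'\<bar>)"
        unfolding sq Delta_def partial_sum_eq integral_mult_right_zero by (intro mult_left_mono Zsum_diff_le) auto
      also have "\<dots> \<le> (1 / n) * (moment_const * n)"
        by (intro mult_left_mono abs_nat_diff_le le moment_const_nonneg) simp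
      also have "\<dots> \<le> moment_const" using moment_const_nonneg by (cases "n = 0") auto
      finally have E: "expectation (\<lambda>\<omega>. (norm (scaled_Delta l n \<omega> i))\<^sup>2) \<le> moment_const" .
      have "prob {\<omega>\<in>space M. K < norm (scaled_Delta l n \<omega> i)} \<le> prob {\<omega>\<in>space M. K\<^sup>2 \<le> (norm (scaled_Delta l n \<omega> i))\<^sup>2}"
        using K by (intro finite_measure_mono) (auto intro!: power_mono)
      also have "\<dots> \<le> expectation (\<lambda>\<omega>. (norm (scaled_Delta l n \<omega> i))\<^sup>2) / K\<^sup>2"
        using integral_Markov_inequality_measure[OF i, of "space M" "K\<^sup>2"] K by (simp add: zero_less_power)
      also have "\<dots> \<le> moment_const / K\<^sup>2" using E by (intro divide_right_mono) auto
      finally show ?thesis .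
    qed
    have "prob {\<omega>\<in>space M. \<exists>i<l. K < norm (scaled_Delta l n \<omega> i)} = prob (\<Union>i\<in>{..<l}. {\<omega>\<in>space M. K < norm (scaled_Delta l n \<omega> i)})"
      by (rule arg_cong[of _ _ prob]) auto
    also have "\<dots> \<le> (\<Sum>i<l. prob {\<omega>\<in>space M. K < norm (scaled_Delta l n \<omega> i)})"
      by (rule finite_measure_subadditive_finite) auto
    also have "\<dots> \<le> (\<Sum>i<l. moment_const / K\<^sup>2)" using 1 by (intro sum_mono) auto
    also have "\<dots> = real l * moment_const / K\<^sup>2" by simp
    also have "\<dots> \<le> e" using K assms by (simp add: divide_le_eq mult.commute)
    finally show ?thesis .
  qed
  then show ?thesis by blast
qed

text \<open>\<open>(norm (transpose K *v u i))\<^sup>2\<close> equals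
  \<open>u i \<bullet> (\<Sigma> *v u i)\<close>, so applying the factor \<open>K\<close> of
  \<open>\<Sigma>\<close> to independent Brownian increments produces exactly the limiting
  characteristic function of the data.\<close>

lemma scaled_Delta_weak_limit:
  fixes \<Phi> :: "(nat \<Rightarrow> real ^ 'q) \<Rightarrow> real"
  assumes l: "0 < l" and K: "K ** transpose K = \<Sigma>"
    and \<Phi>: "continuous_on UNIV \<Phi>" "\<And>x. \<bar>\<Phi> x\<bar> \<le> c"
  shows "(\<lambda>n. expectation (\<lambda>\<omega>. \<Phi> (scaled_Delta l n \<omega>))) \<longlonglongrightarrow> integral\<^sup>L N (\<lambda>\<omega>. \<Phi> (\<lambda>i. if i < l then K *v BM.incr l i \<omega> else 0))"
proof (rule levy_continuity_finite_dimensional[where X = "scaled_Delta l" and Y = "\<lambda>\<omega> i. if i < l then K *v BM.incr l i \<omega> else 0" and l = l and c = c])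
  show "prob_space M" "prob_space N" by unfold_locales
  show "(\<lambda>\<omega>. if i < l then K *v BM.incr l i \<omega> else 0) \<in> borel_measurable N" for i
  proof -
    have "(\<lambda>\<omega>. K *v BM.incr l i \<omega>) \<in> borel_measurable N"
      by (rule measurable_compose[OF BM.incr_measurable]) (intro borel_measurable_continuous_onI continuous_intros)
    then show ?thesis by simp
  qed
  show "\<exists>K. \<forall>n. prob {\<omega>\<in>space M. \<exists>i<l. K < norm (scaled_Delta l n \<omega> i)} \<le> e" if "0 < e" for e
    by (rule scaled_Delta_tight[OF l that])
  fix u :: "nat \<Rightarrow> real ^ 'q"
  have "(\<Sum>i<l. u i \<bullet> scaled_Delta l n \<omega> i) = (\<Sum>i<l. u i \<bullet> Delta l n i \<omega>) / sqrt n" for n \<omega>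
    by (simp add: scaled_Delta_def sum_divide_distrib)
  moreover have "(\<Sum>i<l. u i \<bullet> (if i < l then K *v BM.incr l i \<omega> else 0)) = (\<Sum>i<l. (transpose K *v u i) \<bullet> BM.incr l i \<omega>)" for \<omega>
    by (intro sum.cong refl) (simp only: lessThan_iff if_True transpose_inner[of "transpose K"] transpose_transpose)
  ultimately show "(\<lambda>n. integral\<^sup>L M (\<lambda>\<omega>. iexp (\<Sum>i<l. u i \<bullet> scaled_Delta l n \<omega> i))) \<longlonglongrightarrow> integral\<^sup>L N (\<lambda>\<omega>. iexp (\<Sum>i<l. u i \<bullet> (if i < l then K *v BM.incr l i \<omega> else 0)))"
    using Delta_char_tendsto[OF l, of u] by (simp only: BM.incr_joint_char[OF l] inner_transpose_transpose[OF K] minus_divide_left)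
qed (use \<Phi> in \<open>auto simp: scaled_Delta_def\<close>)

end

section \<open>Comparison of the statistic with a fixed grid\<close>

lemma norm_add_square_le: "(norm (v + w))\<^sup>2 \<le> 2 * (norm v)\<^sup>2 + 2 * (norm w)\<^sup>2" for v w :: "'v::real_normed_vector"
proof -
  have "(norm (v + w))\<^sup>2 \<le> (norm v + norm w)\<^sup>2" by (intro power_mono norm_triangle_ineq) auto
  also have "\<dots> \<le> 2 * (norm v)\<^sup>2 + 2 * (norm w)\<^sup>2"
    using sum_squares_bound[of "norm v" "norm w"] by (simp add: power2_sum)
  finally show ?thesis .
qed

text \<open>Entrywise, the difference is \<open>a $ i * (a - b) $ j + (a - b) $ i * b $ j\<close>.
  The resulting product of norms is split with a free weight \<open>s\<close>, so that expectations
  of squares are enough; the dimension factor comes from summing over all entries.\<close>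

lemma norm_outer_diff_le:
  fixes a b :: "real ^ 'q"
  assumes s: "0 < s"
  shows "norm (outer a - outer b) \<le> (real CARD('q))\<^sup>2 * ((norm (a - b))\<^sup>2 / s + s * ((norm a)\<^sup>2 + (norm b)\<^sup>2))"
proof -
  let ?e = "(norm (a - b))\<^sup>2 / s + s * ((norm a)\<^sup>2 + (norm b)\<^sup>2)"
  have e: "norm (a - b) * (norm a + norm b) \<le> ?e"
  proof -
    have "2 * (norm (a - b) * (s * (norm a + norm b))) \<le> (norm (a - b))\<^sup>2 + (s * (norm a + norm b))\<^sup>2"
      using sum_squares_bound[of "norm (a - b)" "s * (norm a + norm b)"] by (simp add: mult.assoc)
    also have "(s * (norm a + norm b))\<^sup>2 \<le> s\<^sup>2 * (2 * ((norm a)\<^sup>2 + (norm b)\<^sup>2))"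
      unfolding power_mult_distrib using sum_squares_bound[of "norm a" "norm b"] by (intro mult_left_mono) (auto simp: power2_sum)
    finally have "s * (2 * (norm (a - b) * (norm a + norm b))) \<le> s * ((norm (a - b))\<^sup>2 / s + 2 * (s * ((norm a)\<^sup>2 + (norm b)\<^sup>2)))"
      using s by (simp add: distrib_left power2_eq_square mult_ac)
    then have "2 * (norm (a - b) * (norm a + norm b)) \<le> (norm (a - b))\<^sup>2 / s + 2 * (s * ((norm a)\<^sup>2 + (norm b)\<^sup>2))"
      using s by (simp only: mult_le_cancel_left_pos)
    moreover have "0 \<le> (norm (a - b))\<^sup>2 / s" using s by simp
    ultimately show ?thesis by linarith
  qed
  have "norm ((outer a - outer b) $ i $ j) \<le> ?e" for i j
  proof -
    have "(outer a - outer b) $ i $ j = a $ i * (a - b) $ j + (a - b) $ i * b $ j"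
      by (simp add: outer_def algebra_simps)
    also have "norm \<dots> \<le> \<bar>a $ i\<bar> * \<bar>(a - b) $ j\<bar> + \<bar>(a - b) $ i\<bar> * \<bar>b $ j\<bar>"
      by (metis abs_mult abs_triangle_ineq real_norm_def)
    also have "\<dots> \<le> norm a * norm (a - b) + norm (a - b) * norm b"
      by (intro add_mono mult_mono component_le_norm_cart) auto
    also have "\<dots> \<le> ?e" using e by (simp add: algebra_simps)
    finally show ?thesis .
  qed
  then have "norm ((outer a - outer b) $ i) \<le> (\<Sum>j\<in>(UNIV :: 'q set). ?e)" for i
    by (intro order_trans[OF norm_le_l1_cart] sum_mono) auto
  then have "(\<Sum>i\<in>UNIV. norm ((outer a - outer b) $ i)) \<le> (\<Sum>i\<in>(UNIV :: 'q set). \<Sum>j\<in>(UNIV :: 'q set). ?e)"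
    by (rule sum_mono)
  moreover have "norm (outer a - outer b) \<le> (\<Sum>i\<in>UNIV. norm ((outer a - outer b) $ i))"
    unfolding norm_vec_def[of "outer a - outer b"] by (rule L2_set_le_sum) simp
  ultimately show ?thesis by (simp add: power2_eq_square mult.assoc)
qed

text \<open>With \<open>x\<close> the increments over a grid of \<open>l\<close> cells this is the
  averaged outer product of the tied-down partial sums. It is evaluated both at the scaled
  increments of the data and at transformed Brownian increments.\<close>

definition grid_var :: "nat \<Rightarrow> (nat \<Rightarrow> real ^ 'q) \<Rightarrow> real ^ 'q ^ 'q" where
  "grid_var l x = (1 / real l) *\<^sub>R (\<Sum>k<l. outer ((\<Sum>i<Suc k. x i) - (real (Suc k) / l) *\<^sub>R (\<Sum>i<l. x i)))"

lemma continuous_on_grid_var: "continuous_on UNIV (grid_var l)"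
  unfolding grid_var_def by (intro continuous_intros continuous_on_product_coordinates)

context null_process_limit
begin

text \<open>The centring weight \<open>\<theta>\<close> and the summation index \<open>p\<close> are
  separate arguments: for the statistic \<open>\<theta> = p / n\<close> exactly, for the coarse grid
  \<open>p\<close> is \<open>\<theta> * n\<close> rounded down.\<close>

definition tied_sum :: "nat \<Rightarrow> real \<Rightarrow> nat \<Rightarrow> 'a \<Rightarrow> real ^ 'q" where
  "tied_sum n \<theta> p \<omega> = (1 / sqrt n) *\<^sub>R (Zsum p \<omega> - \<theta> *\<^sub>R Zsum n \<omega>)"

lemma tied_sum_measurable [measurable (raw)]: "tied_sum n \<theta> p \<in> borel_measurable M"
  unfolding tied_sum_def[abs_def] by measurable

lemma tied_sum_diff: "tied_sum n \<theta> p \<omega> - tied_sum n \<theta>' p' \<omega> = (1 / sqrt n) *\<^sub>R ((Zsum p \<omega> - Zsum p' \<omega>) + (\<theta>' - \<theta>) *\<^sub>R Zsum n \<omega>)"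
  unfolding tied_sum_def by (simp add: algebra_simps)

lemma
  assumes n: "0 < n"
  shows tied_sum_diff_integrable: "integrable M (\<lambda>\<omega>. (norm (tied_sum n \<theta> p \<omega> - tied_sum n \<theta>' p' \<omega>))\<^sup>2)"
    and tied_sum_diff_le: "expectation (\<lambda>\<omega>. (norm (tied_sum n \<theta> p \<omega> - tied_sum n \<theta>' p' \<omega>))\<^sup>2)
      \<le> 2 * moment_const * (\<bar>real p - real p'\<bar> / n + (\<theta> - \<theta>')\<^sup>2)"
proof -
  have le: "(norm (tied_sum n \<theta> p \<omega> - tied_sum n \<theta>' p' \<omega>))\<^sup>2 \<le> (2 / n) * ((norm (Zsum p \<omega> - Zsum p' \<omega>))\<^sup>2 + (\<theta> - \<theta>')\<^sup>2 * (norm (Zsum n \<omega>))\<^sup>2)" for \<omega>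
  proof -
    have "(norm (tied_sum n \<theta> p \<omega> - tied_sum n \<theta>' p' \<omega>))\<^sup>2 = (1 / n) * (norm ((Zsum p \<omega> - Zsum p' \<omega>) + (\<theta>' - \<theta>) *\<^sub>R Zsum n \<omega>))\<^sup>2"
      unfolding tied_sum_diff by (simp add: power_mult_distrib power_divide)
    also have "\<dots> \<le> (1 / n) * (2 * (norm (Zsum p \<omega> - Zsum p' \<omega>))\<^sup>2 + 2 * (norm ((\<theta>' - \<theta>) *\<^sub>R Zsum n \<omega>))\<^sup>2)"
      by (intro mult_left_mono norm_add_square_le) auto
    also have "\<dots> = (2 / n) * ((norm (Zsum p \<omega> - Zsum p' \<omega>))\<^sup>2 + (\<theta> - \<theta>')\<^sup>2 * (norm (Zsum n \<omega>))\<^sup>2)"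
      by (simp add: power_mult_distrib power2_commute[of \<theta>' \<theta>] add_divide_distrib)
    finally show ?thesis .
  qed
  have i: "integrable M (\<lambda>\<omega>. (2 / n) * ((norm (Zsum p \<omega> - Zsum p' \<omega>))\<^sup>2 + (\<theta> - \<theta>')\<^sup>2 * (norm (Zsum n \<omega>))\<^sup>2))"
    by (intro integrable_mult_right Bochner_Integration.integrable_add Zsum_diff_integrable Zsum_square_integrable)
  show 1: "integrable M (\<lambda>\<omega>. (norm (tied_sum n \<theta> p \<omega> - tied_sum n \<theta>' p' \<omega>))\<^sup>2)"
    by (rule Bochner_Integration.integrable_bound[OF i])
      (measurable, use le in \<open>auto intro: order_trans[OF _ abs_ge_self]\<close>)
  have "expectation (\<lambda>\<omega>. (norm (tied_sum n \<theta> p \<omega> - tied_sum n \<theta>' p' \<omega>))\<^sup>2)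
    \<le> expectation (\<lambda>\<omega>. (2 / n) * ((norm (Zsum p \<omega> - Zsum p' \<omega>))\<^sup>2 + (\<theta> - \<theta>')\<^sup>2 * (norm (Zsum n \<omega>))\<^sup>2))"
    by (rule integral_mono[OF 1 i le])
  also have "\<dots> = (2 / n) * (expectation (\<lambda>\<omega>. (norm (Zsum p \<omega> - Zsum p' \<omega>))\<^sup>2) + (\<theta> - \<theta>')\<^sup>2 * expectation (\<lambda>\<omega>. (norm (Zsum n \<omega>))\<^sup>2))"
    using Zsum_diff_integrable Zsum_square_integrable by simp
  also have "\<dots> \<le> (2 / n) * (moment_const * \<bar>real p - real p'\<bar> + (\<theta> - \<theta>')\<^sup>2 * (moment_const * n))"
    by (intro mult_left_mono add_mono Zsum_diff_le Zsum_square_le) auto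
  also have "\<dots> = 2 * moment_const * (\<bar>real p - real p'\<bar> / n + (\<theta> - \<theta>')\<^sup>2)"
    using n by (simp add: field_simps)
  finally show "expectation (\<lambda>\<omega>. (norm (tied_sum n \<theta> p \<omega> - tied_sum n \<theta>' p' \<omega>))\<^sup>2)
      \<le> 2 * moment_const * (\<bar>real p - real p'\<bar> / n + (\<theta> - \<theta>')\<^sup>2)" .
qed

lemma
  assumes n: "0 < n" and p: "p \<le> n" and \<theta>: "0 \<le> \<theta>" "\<theta> \<le> 1"
  shows tied_sum_integrable: "integrable M (\<lambda>\<omega>. (norm (tied_sum n \<theta> p \<omega>))\<^sup>2)"
    and tied_sum_le: "expectation (\<lambda>\<omega>. (norm (tied_sum n \<theta> p \<omega>))\<^sup>2) \<le> 4 * moment_const"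
proof -
  have eq: "tied_sum n \<theta> p \<omega> = tied_sum n \<theta> p \<omega> - tied_sum n 0 0 \<omega>" for \<omega> by (simp add: tied_sum_def Zsum_zero)
  show "integrable M (\<lambda>\<omega>. (norm (tied_sum n \<theta> p \<omega>))\<^sup>2)" by (subst eq) (rule tied_sum_diff_integrable[OF n])
  have "expectation (\<lambda>\<omega>. (norm (tied_sum n \<theta> p \<omega>))\<^sup>2) \<le> 2 * moment_const * (\<bar>real p - real 0\<bar> / n + (\<theta> - 0)\<^sup>2)"
    by (subst eq) (rule tied_sum_diff_le[OF n])
  also have "\<dots> \<le> 2 * moment_const * (1 + 1)"
    using moment_const_nonneg n p \<theta> by (intro mult_left_mono add_mono) (auto simp: power_le_one)
  finally show "expectation (\<lambda>\<omega>. (norm (tied_sum n \<theta> p \<omega>))\<^sup>2) \<le> 4 * moment_const" by simp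
qed

lemma
  assumes n: "0 < n" and p: "p \<le> n" "p' \<le> n" and \<theta>: "0 \<le> \<theta>" "\<theta> \<le> 1" "0 \<le> \<theta>'" "\<theta>' \<le> 1" and s: "0 < s"
    and h: "\<bar>real p - real p'\<bar> / n + (\<theta> - \<theta>')\<^sup>2 \<le> h"
  shows outer_tied_sum_diff_integrable: "integrable M (\<lambda>\<omega>. norm (outer (tied_sum n \<theta> p \<omega>) - outer (tied_sum n \<theta>' p' \<omega>)))"
    and outer_tied_sum_diff_le: "expectation (\<lambda>\<omega>. norm (outer (tied_sum n \<theta> p \<omega>) - outer (tied_sum n \<theta>' p' \<omega>)))
      \<le> (real CARD('q))\<^sup>2 * (2 * moment_const * h / s + 8 * moment_const * s)"
proof -
  let ?f = "\<lambda>\<omega>. (real CARD('q))\<^sup>2 * ((norm (tied_sum n \<theta> p \<omega> - tied_sum n \<theta>' p' \<omega>))\<^sup>2 / s + s * ((norm (tied_sum n \<theta> p \<omega>))\<^sup>2 + (norm (tied_sum n \<theta>' p' \<omega>))\<^sup>2))"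
  have i: "integrable M ?f"
    using tied_sum_diff_integrable[OF n] tied_sum_integrable[OF n p(1) \<theta>(1,2)] tied_sum_integrable[OF n p(2) \<theta>(3,4)] by simp
  have om: "(\<lambda>\<omega>. outer (tied_sum n \<theta> p \<omega>)) \<in> borel_measurable M" for \<theta> p
    by (rule measurable_compose[OF tied_sum_measurable]) (intro borel_measurable_continuous_onI continuous_intros)
  show 1: "integrable M (\<lambda>\<omega>. norm (outer (tied_sum n \<theta> p \<omega>) - outer (tied_sum n \<theta>' p' \<omega>)))"
  proof (rule Bochner_Integration.integrable_bound[OF i])
    show "(\<lambda>\<omega>. norm (outer (tied_sum n \<theta> p \<omega>) - outer (tied_sum n \<theta>' p' \<omega>))) \<in> borel_measurable M"
      by (intro measurable_compose[OF _ borel_measurable_norm] borel_measurable_diff om)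
    show "AE \<omega> in M. norm (norm (outer (tied_sum n \<theta> p \<omega>) - outer (tied_sum n \<theta>' p' \<omega>))) \<le> norm (?f \<omega>)"
      unfolding real_norm_def abs_norm_cancel by (intro AE_I2 order_trans[OF norm_outer_diff_le[OF s] abs_ge_self])
  qed
  have "expectation (\<lambda>\<omega>. norm (outer (tied_sum n \<theta> p \<omega>) - outer (tied_sum n \<theta>' p' \<omega>))) \<le> expectation ?f"
    by (rule integral_mono[OF 1 i norm_outer_diff_le[OF s]])
  also have "\<dots> = (real CARD('q))\<^sup>2 * (expectation (\<lambda>\<omega>. (norm (tied_sum n \<theta> p \<omega> - tied_sum n \<theta>' p' \<omega>))\<^sup>2) / s
      + s * (expectation (\<lambda>\<omega>. (norm (tied_sum n \<theta> p \<omega>))\<^sup>2) + expectation (\<lambda>\<omega>. (norm (tied_sum n \<theta>' p' \<omega>))\<^sup>2)))"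
    using tied_sum_diff_integrable[OF n] tied_sum_integrable[OF n p(1) \<theta>(1,2)] tied_sum_integrable[OF n p(2) \<theta>(3,4)] by simp
  also have "\<dots> \<le> (real CARD('q))\<^sup>2 * (2 * moment_const * h / s + s * (4 * moment_const + 4 * moment_const))"
  proof (intro mult_left_mono add_mono divide_right_mono tied_sum_le n p \<theta>)
    have "expectation (\<lambda>\<omega>. (norm (tied_sum n \<theta> p \<omega> - tied_sum n \<theta>' p' \<omega>))\<^sup>2) \<le> 2 * moment_const * (\<bar>real p - real p'\<bar> / n + (\<theta> - \<theta>')\<^sup>2)"
      by (rule tied_sum_diff_le[OF n])
    also have "\<dots> \<le> 2 * moment_const * h" using h moment_const_nonneg by (intro mult_left_mono) auto
    finally show "expectation (\<lambda>\<omega>. (norm (tied_sum n \<theta> p \<omega> - tied_sum n \<theta>' p' \<omega>))\<^sup>2) \<le> 2 * moment_const * h" .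
  qed (use s in auto)
  finally show "expectation (\<lambda>\<omega>. norm (outer (tied_sum n \<theta> p \<omega>) - outer (tied_sum n \<theta>' p' \<omega>)))
      \<le> (real CARD('q))\<^sup>2 * (2 * moment_const * h / s + 8 * moment_const * s)" by (simp add: mult_ac)
qed

lemma T_stat_eq:
  assumes "0 < n" "k \<le> n" shows "T_stat m Z n (real k / real n) \<omega> = tied_sum n (real k / n) k \<omega>"
proof -
  have f: "nat \<lfloor>real n * (real k / real n)\<rfloor> = k" using assms by simp
  have "(\<Sum>t\<in>{m..<m + k}. Z t \<omega> - Zbar m Z n \<omega>) = Zsum k \<omega> - (real k / n) *\<^sub>R Zsum n \<omega>"
    by (simp add: sum_subtractf Zsum_def Zbar_def sum_constant_scaleR del: sum_constant)
  then show ?thesis unfolding T_stat_def f tied_sum_def by simp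
qed

lemma U_stat_eq:
  assumes "0 < n"
  shows "U_stat m Z n \<omega> = (1 / real n) *\<^sub>R (\<Sum>k<n. outer (tied_sum n (real (Suc k) / n) (Suc k) \<omega>))"
proof -
  have "(\<Sum>k=1..n. outer (T_stat m Z n (real k / real n) \<omega>)) = (\<Sum>k=1..n. outer (tied_sum n (real k / n) k \<omega>))"
    using assms by (intro sum.cong refl) (simp add: T_stat_eq)
  also have "\<dots> = (\<Sum>k<n. outer (tied_sum n (real (Suc k) / n) (Suc k) \<omega>))"
    by (rule sum.reindex_bij_witness[of _ Suc "\<lambda>k. k - 1"]) auto
  finally show ?thesis by (simp add: U_stat_def)
qed

lemma sum_scaled_Delta:
  assumes "k \<le> l" shows "(\<Sum>i<k. scaled_Delta l n \<omega> i) = (1 / sqrt n) *\<^sub>R Zsum (nat \<lfloor>real n * (real k / l)\<rfloor>) \<omega>"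
proof -
  have "(\<Sum>i<k. scaled_Delta l n \<omega> i) = (1 / sqrt n) *\<^sub>R (\<Sum>i<k. Delta l n i \<omega>)"
    using assms unfolding scaleR_sum_right by (intro sum.cong refl) (simp add: scaled_Delta_def)
  also have "(\<Sum>i<k. Delta l n i \<omega>) = partial_sum m Z n (real k / l) \<omega> - partial_sum m Z n (real 0 / l) \<omega>"
    unfolding Delta_def by (rule sum_lessThan_telescope)
  also have "\<dots> = Zsum (nat \<lfloor>real n * (real k / l)\<rfloor>) \<omega>" by (simp add: partial_sum_eq Zsum_zero)
  finally show ?thesis .
qed

lemma sum_scaled_Delta_full: "0 < l \<Longrightarrow> (\<Sum>i<l. scaled_Delta l n \<omega> i) = (1 / sqrt n) *\<^sub>R Zsum n \<omega>"
  by (simp add: sum_scaled_Delta)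

lemma grid_var_scaled_Delta:
  assumes "0 < l"
  shows "grid_var l (scaled_Delta l n \<omega>) = (1 / real l) *\<^sub>R (\<Sum>k<l. outer (tied_sum n (real (Suc k) / l) (nat \<lfloor>real n * (real (Suc k) / l)\<rfloor>) \<omega>))"
proof -
  have "(\<Sum>i<Suc k. scaled_Delta l n \<omega> i) - (real (Suc k) / l) *\<^sub>R (\<Sum>i<l. scaled_Delta l n \<omega> i) = tied_sum n (real (Suc k) / l) (nat \<lfloor>real n * (real (Suc k) / l)\<rfloor>) \<omega>"
    if "k < l" for k
    unfolding sum_scaled_Delta_full[OF assms] sum_scaled_Delta[OF Suc_leI[OF that]] tied_sum_def by (simp only: scaleR_diff_right scaleR_left_commute)
  then show ?thesis unfolding grid_var_def by (intro arg_cong2[of _ _ _ _ scaleR] refl sum.cong) (simp only: lessThan_iff)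
qed

text \<open>Both averages are written as averages over \<open>n * l\<close> indices, which avoids counting the
  indices that fall into one cell of the coarse grid.\<close>

lemma
  assumes n: "0 < n" and l: "0 < l" and s: "0 < s"
  shows grid_error_integrable: "integrable M (\<lambda>\<omega>. norm (U_stat m Z n \<omega> - grid_var l (scaled_Delta l n \<omega>)))"
    and grid_error: "expectation (\<lambda>\<omega>. norm (U_stat m Z n \<omega> - grid_var l (scaled_Delta l n \<omega>)))
      \<le> (real CARD('q))\<^sup>2 * (6 * moment_const * (1 / real n + 1 / real l) / s + 8 * moment_const * s)"
proof -
  define h where "h = 1 / real n + 1 / real l"
  define f where "f = (\<lambda>k \<omega>. outer (tied_sum n (real (Suc k) / n) (Suc k) \<omega>))"
  define g where "g = (\<lambda>k \<omega>. outer (tied_sum n (real (Suc k) / l) (nat \<lfloor>real n * (real (Suc k) / l)\<rfloor>) \<omega>))"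
  define E where "E = (real CARD('q))\<^sup>2 * (2 * moment_const * (3 * h) / s + 8 * moment_const * s)"
  \<comment> \<open>In the common refinement with \<open>n * l\<close> cells, index \<open>i\<close>
    belongs to one cell of each grid. The right endpoints of both lie beyond
    \<open>i / (n * l)\<close> by at most one cell width of their own grid, hence within
    \<open>h\<close> of each other.\<close>
  have main: "integrable M (\<lambda>\<omega>. norm (f (i div l) \<omega> - g (i div n) \<omega>)) \<and> expectation (\<lambda>\<omega>. norm (f (i div l) \<omega> - g (i div n) \<omega>)) \<le> E"
    if i: "i < n * l" for i
  proof -
    let ?k = "Suc (i div l)" and ?j = "Suc (i div n)"
    let ?p = "nat \<lfloor>real n * (real ?j / l)\<rfloor>"
    have kj: "?k \<le> n" "?j \<le> l" using i n l by (simp_all add: Suc_le_eq less_mult_imp_div_less mult.commute)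
    have k1: "real i / (real n * real l) < real ?k / n" "real ?k / n \<le> real i / (real n * real l) + 1 / n"
    proof -
      have "i < ?k * l" using dividend_less_div_times[OF l, of i] by simp
      then have "real i < real ?k * l" by (metis of_nat_less_iff of_nat_mult)
      then show "real i / (real n * real l) < real ?k / n" using n l by (simp add: field_simps)
      have "i div l * l \<le> i" by simp
      then have "real (i div l) * l \<le> real i" by (metis of_nat_le_iff of_nat_mult)
      then show "real ?k / n \<le> real i / (real n * real l) + 1 / n" using n l by (simp add: field_simps)
    qed
    have j1: "real i / (real n * real l) < real ?j / l" "real ?j / l \<le> real i / (real n * real l) + 1 / l"
    proof -
      have "i < ?j * n" using dividend_less_div_times[OF n, of i] by simp
      then have "real i < real ?j * n" by (metis of_nat_less_iff of_nat_mult)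
      then show "real i / (real n * real l) < real ?j / l" using n l by (simp add: field_simps)
      have "i div n * n \<le> i" by simp
      then have "real (i div n) * n \<le> real i" by (metis of_nat_le_iff of_nat_mult)
      then show "real ?j / l \<le> real i / (real n * real l) + 1 / l" using n l by (simp add: field_simps)
    qed
    have pos: "0 < 1 / real n" "0 < 1 / real l" using n l by auto
    have d: "\<bar>real ?k / n - real ?j / l\<bar> \<le> h" unfolding h_def using k1 j1 pos by linarith
    have le1: "0 \<le> real ?k / n" "real ?k / n \<le> 1" "0 \<le> real ?j / l" "real ?j / l \<le> 1"
      using kj by (auto simp: divide_le_eq_1 simp del: of_nat_Suc)
    \<comment> \<open>Both times lie in [0, 1], so the square is at most the distance.\<close>
    have sq: "(real ?k / n - real ?j / l)\<^sup>2 \<le> h"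
    proof -
      have "(real ?k / n - real ?j / l)\<^sup>2 = \<bar>real ?k / n - real ?j / l\<bar> * \<bar>real ?k / n - real ?j / l\<bar>" by (simp add: power2_eq_square)
      also have "\<dots> \<le> 1 * \<bar>real ?k / n - real ?j / l\<bar>" using le1 by (intro mult_right_mono) linarith+
      finally show ?thesis using d unfolding mult_1_left by (rule order_trans)
    qed
    note fl = floor_ratio_bounds[OF kj(2) l, of n]
    \<comment> \<open>Rounding down costs at most 1, that is \<open>1 / n \<le> h\<close> after
      division; together with the square this gives the three \<open>h\<close>.\<close>
    have "\<bar>real ?k - real ?p\<bar> \<le> real n * h + 1"
    proof -
      have eq: "real ?k - real n * (real ?j / l) = real n * (real ?k / n - real ?j / l)"
        using n by (simp add: right_diff_distrib del: of_nat_Suc)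
      have "\<bar>real ?k - real n * (real ?j / l)\<bar> = real n * \<bar>real ?k / n - real ?j / l\<bar>"
        unfolding eq abs_mult by simp
      also have "\<dots> \<le> real n * h" by (intro mult_left_mono d) simp
      finally show ?thesis using fl(2,3) by linarith
    qed
    then have "\<bar>real ?k - real ?p\<bar> / n \<le> (real n * h + 1) / n" by (intro divide_right_mono) auto
    also have "\<dots> = h + 1 / n" using n by (simp add: add_divide_distrib)
    also have "\<dots> \<le> h + h" unfolding h_def using pos by linarith
    finally have hh: "\<bar>real ?k - real ?p\<bar> / n + (real ?k / n - real ?j / l)\<^sup>2 \<le> 3 * h" using sq by linarith
    note outer_tied_sum_diff_integrable[OF n kj(1) fl(1) le1 s hh] outer_tied_sum_diff_le[OF n kj(1) fl(1) le1 s hh]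
    then show ?thesis unfolding f_def g_def E_def by blast
  qed
  have fs: "(\<Sum>i<n * l. f (i div l) \<omega>) = real l *\<^sub>R (\<Sum>k<n. f k \<omega>)" for \<omega>
    by (rule sum_lessThan_mult_div[OF l])
  have gs: "(\<Sum>i<n * l. g (i div n) \<omega>) = real n *\<^sub>R (\<Sum>k<l. g k \<omega>)" for \<omega>
    unfolding mult.commute[of n l] by (rule sum_lessThan_mult_div[OF n])
  have Ueq: "U_stat m Z n \<omega> = (1 / (real n * real l)) *\<^sub>R (\<Sum>i<n * l. f (i div l) \<omega>)" for \<omega>
    unfolding fs U_stat_eq[OF n] unfolding f_def using l by simp
  have Geq: "grid_var l (scaled_Delta l n \<omega>) = (1 / (real n * real l)) *\<^sub>R (\<Sum>i<n * l. g (i div n) \<omega>)" for \<omega>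
    unfolding gs grid_var_scaled_Delta[OF l] unfolding g_def using n by simp
  have le: "norm (U_stat m Z n \<omega> - grid_var l (scaled_Delta l n \<omega>)) \<le> (1 / (real n * real l)) * (\<Sum>i<n * l. norm (f (i div l) \<omega> - g (i div n) \<omega>))" for \<omega>
    unfolding Ueq Geq scaleR_diff_right[symmetric] sum_subtractf[symmetric] norm_scaleR
    using n l by (intro mult_mono norm_sum) (auto intro: sum_nonneg)
  have i: "integrable M (\<lambda>\<omega>. (1 / (real n * real l)) * (\<Sum>i<n * l. norm (f (i div l) \<omega> - g (i div n) \<omega>)))"
    using main by (intro integrable_mult_right Bochner_Integration.integrable_sum) auto
  have om: "(\<lambda>\<omega>. outer (tied_sum n \<theta> p \<omega>)) \<in> borel_measurable M" for \<theta> p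
    by (rule measurable_compose[OF tied_sum_measurable]) (intro borel_measurable_continuous_onI continuous_intros)
  show 1: "integrable M (\<lambda>\<omega>. norm (U_stat m Z n \<omega> - grid_var l (scaled_Delta l n \<omega>)))"
  proof (rule Bochner_Integration.integrable_bound[OF i])
    show "(\<lambda>\<omega>. norm (U_stat m Z n \<omega> - grid_var l (scaled_Delta l n \<omega>))) \<in> borel_measurable M"
      unfolding Ueq Geq f_def g_def
      by (intro measurable_compose[OF _ borel_measurable_norm] borel_measurable_diff borel_measurable_scaleR borel_measurable_const borel_measurable_sum om)
    show "AE \<omega> in M. norm (norm (U_stat m Z n \<omega> - grid_var l (scaled_Delta l n \<omega>))) \<le> norm ((1 / (real n * real l)) * (\<Sum>i<n * l. norm (f (i div l) \<omega> - g (i div n) \<omega>)))"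
      unfolding real_norm_def abs_norm_cancel by (intro AE_I2 order_trans[OF le abs_ge_self])
  qed
  have "expectation (\<lambda>\<omega>. norm (U_stat m Z n \<omega> - grid_var l (scaled_Delta l n \<omega>)))
     \<le> expectation (\<lambda>\<omega>. (1 / (real n * real l)) * (\<Sum>i<n * l. norm (f (i div l) \<omega> - g (i div n) \<omega>)))"
    by (rule integral_mono[OF 1 i le])
  also have "\<dots> = (1 / (real n * real l)) * (\<Sum>i<n * l. expectation (\<lambda>\<omega>. norm (f (i div l) \<omega> - g (i div n) \<omega>)))"
    unfolding integral_mult_right_zero using main by (subst Bochner_Integration.integral_sum) auto
  also have "\<dots> \<le> (1 / (real n * real l)) * (\<Sum>i<n * l. E)"
    using main by (intro mult_left_mono sum_mono) auto
  also have "\<dots> = E" using n l by simp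
  finally show "expectation (\<lambda>\<omega>. norm (U_stat m Z n \<omega> - grid_var l (scaled_Delta l n \<omega>)))
      \<le> (real CARD('q))\<^sup>2 * (6 * moment_const * (1 / real n + 1 / real l) / s + 8 * moment_const * s)"
    unfolding E_def h_def by (simp only: mult.assoc[symmetric] mult.commute[of _ 3]) (simp add: mult_ac)
qed

end

text \<open>The ball is enlarged by 1 and the distance kept below 1: if one of two close points is
  in the original ball, both lie in the larger compact one, and otherwise both values are 0.\<close>

lemma uniformly_continuous_bounded_support:
  fixes \<Psi> :: "'v::euclidean_space \<Rightarrow> real"
  assumes \<Psi>: "continuous_on UNIV \<Psi>" "\<And>p. r < norm p \<Longrightarrow> \<Psi> p = 0" and e: "0 < e"
  obtains d where "0 < d" "\<And>p p'. dist p p' < d \<Longrightarrow> \<bar>\<Psi> p - \<Psi> p'\<bar> < e"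
proof -
  have "uniformly_continuous_on (cball 0 (r + 1)) \<Psi>"
    by (intro compact_uniformly_continuous continuous_on_subset[OF \<Psi>(1)]) auto
  then obtain d where d: "0 < d" "\<And>p p'. p \<in> cball 0 (r + 1) \<Longrightarrow> p' \<in> cball 0 (r + 1) \<Longrightarrow> dist p p' < d \<Longrightarrow> dist (\<Psi> p) (\<Psi> p') < e"
    using e unfolding uniformly_continuous_on_def by metis
  show ?thesis
  proof (rule that[of "min d 1"])
    fix p p' :: 'v assume pp: "dist p p' < min d 1"
    have "norm p \<le> norm p' + dist p p'" "norm p' \<le> norm p + dist p p'"
      using norm_triangle_sub[of p p'] norm_triangle_sub[of p' p] by (auto simp: dist_norm norm_minus_commute)
    show "\<bar>\<Psi> p - \<Psi> p'\<bar> < e"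
    proof (cases "norm p \<le> r \<or> norm p' \<le> r")
      case True
      then have "p \<in> cball 0 (r + 1)" "p' \<in> cball 0 (r + 1)"
        using pp \<open>norm p \<le> norm p' + dist p p'\<close> \<open>norm p' \<le> norm p + dist p p'\<close> by auto
      then show ?thesis using d(2)[of p p'] pp by (simp add: dist_real_def)
    next
      case False
      then show ?thesis using \<Psi>(2) e by simp
    qed
  qed (use d in auto)
qed

lemma quad_nonsingular: "det U \<noteq> 0 \<Longrightarrow> quad c a U = a \<bullet> (matrix_inv U *v a)"
  by (simp add: quad_def inner_matrix_inv)

text \<open>For a singular matrix the defining choice ranges over an empty predicate, so the outcome
  is the same for all of them. With this \<open>limit_var\<close> is measurable on the exceptional
  event too.\<close>

lemma matrix_inv_singular:
  fixes A :: "real ^ 'q ^ 'q"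
  assumes "\<not> invertible A" shows "matrix_inv A = matrix_inv 0"
proof -
  have "\<not> invertible (0 :: real ^ 'q ^ 'q)"
    unfolding invertible_det_nz det_eq_0_iff_kernel not_not
    by (intro exI[of _ "axis undefined 1"]) (simp add: axis_eq_0_iff)
  moreover have "matrix_inv A = (SOME _. False)" if "\<not> invertible A" for A :: "real ^ 'q ^ 'q"
    using that unfolding matrix_inv_def invertible_def by (intro arg_cong[of _ _ Eps] ext) blast
  ultimately show ?thesis using assms by metis
qed

lemma continuous_on_congruence:
  fixes A :: "'a::topological_space \<Rightarrow> real ^ 'q ^ 'q"
  assumes "continuous_on S A" shows "continuous_on S (\<lambda>x. K ** A x ** transpose K)"
  unfolding matrix_matrix_mult_def by (intro continuous_intros assms)

lemma congruence_scaleR_sum: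
  fixes K :: "real ^ 'q ^ 'q"
  shows "K ** (c *\<^sub>R (\<Sum>k\<in>S. A k)) ** transpose K = c *\<^sub>R (\<Sum>k\<in>S. K ** A k ** transpose K)"
proof -
  have "linear (\<lambda>A::real ^ 'q ^ 'q. K ** A ** transpose K)"
    by (rule linearI) 
      (simp_all add: matrix_matrix_mult_def vec_eq_iff sum.distrib distrib_left distrib_right sum_distrib_left sum_distrib_right mult_ac)
  note lin = this
  show ?thesis unfolding linear_cmul[OF lin] linear_sum[OF lin] ..
qed

section \<open>Joint limit and conclusion for the statistic\<close>

context null_process_limit
begin

lemma U_stat_measurable: "U_stat m Z n \<in> borel_measurable M"
proof (cases "0 < n")
  case True
  have om: "(\<lambda>\<omega>. outer (tied_sum n \<theta> p \<omega>)) \<in> borel_measurable M" for \<theta> p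
    by (rule measurable_compose[OF tied_sum_measurable]) (intro borel_measurable_continuous_onI continuous_intros)
  show ?thesis unfolding U_stat_eq[OF True, abs_def]
    by (intro borel_measurable_scaleR borel_measurable_const borel_measurable_sum om)
qed (simp add: U_stat_def[abs_def])

text \<open>For a fixed grid the limit in \<open>n\<close> is a finite-dimensional one; refining the
  grid turns the Brownian side into the integral over the bridge. The two limits may be combined
  because the error of a fine grid is small for all large \<open>n\<close> simultaneously.\<close>

lemma joint_limit:
  fixes \<Psi> :: "(real ^ 'q) \<times> (real ^ 'q ^ 'q) \<Rightarrow> real"
  assumes K: "K ** transpose K = \<Sigma>"
    and \<Psi>: "continuous_on UNIV \<Psi>" "\<And>p. \<bar>\<Psi> p\<bar> \<le> 1" "\<And>p. R < norm p \<Longrightarrow> \<Psi> p = 0"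
  shows "(\<lambda>n. expectation (\<lambda>\<omega>. \<Psi> ((1 / sqrt n) *\<^sub>R Zsum n \<omega>, U_stat m Z n \<omega>)))
    \<longlonglongrightarrow> integral\<^sup>L N (\<lambda>\<omega>. \<Psi> (K *v B 1 \<omega>, K ** integral {0..1} (\<lambda>r. outer (bridge B r \<omega>)) ** transpose K))"
    (is "_ \<longlonglongrightarrow> ?L")
proof -
  have \<Psi>m: "\<Psi> \<in> borel_measurable borel" by (rule borel_measurable_continuous_onI[OF \<Psi>(1)])
  define Um where "Um = (\<lambda>l \<omega>. (1 / real l) *\<^sub>R (\<Sum>k<l. outer (bridge B (real (Suc k) / l) \<omega>)))"
  define G where "G = (\<lambda>l. integral\<^sup>L N (\<lambda>\<omega>. \<Psi> (K *v B 1 \<omega>, K ** Um l \<omega> ** transpose K)))"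
  have B1: "(\<lambda>\<omega>. K *v B 1 \<omega>) \<in> borel_measurable N"
    by (rule measurable_compose[OF BM.B_measurable]) (auto intro!: borel_measurable_continuous_onI continuous_intros)
  have Km: "(\<lambda>\<omega>. K ** V \<omega> ** transpose K) \<in> borel_measurable N" if "V \<in> borel_measurable N" for V
    by (rule measurable_compose[OF that]) (intro borel_measurable_continuous_onI continuous_on_congruence continuous_intros)
  have Umm: "Um l \<in> borel_measurable N" for l
    unfolding Um_def by (intro borel_measurable_scaleR borel_measurable_const borel_measurable_sum BM.outer_measurable BM.bridge_measurable) auto
  have \<Psi>N: "(\<lambda>\<omega>. \<Psi> (K *v B 1 \<omega>, K ** V \<omega> ** transpose K)) \<in> borel_measurable N" if "V \<in> borel_measurable N" for V
    by (rule measurable_compose[OF borel_measurable_Pair[OF B1 Km[OF that]] \<Psi>m])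
  have Glim: "G \<longlonglongrightarrow> ?L"
    unfolding G_def
  proof (rule integral_dominated_convergence[where w = "\<lambda>_. 1"])
    show "AE \<omega> in N. (\<lambda>l. \<Psi> (K *v B 1 \<omega>, K ** Um l \<omega> ** transpose K)) \<longlonglongrightarrow> \<Psi> (K *v B 1 \<omega>, K ** integral {0..1} (\<lambda>r. outer (bridge B r \<omega>)) ** transpose K)"
    proof (rule AE_I2)
      fix \<omega> assume "\<omega> \<in> space N"
      from BM.bridge_riemann[OF this] have *: "(\<lambda>l. Um l \<omega>) \<longlonglongrightarrow> integral {0..1} (\<lambda>r. outer (bridge B r \<omega>))" unfolding Um_def .
      have "continuous_on UNIV (\<lambda>V. \<Psi> (K *v B 1 \<omega>, K ** V ** transpose K))"
        by (rule continuous_on_compose2[OF \<Psi>(1)]) (auto intro!: continuous_intros continuous_on_congruence)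
      then show "(\<lambda>l. \<Psi> (K *v B 1 \<omega>, K ** Um l \<omega> ** transpose K)) \<longlonglongrightarrow> \<Psi> (K *v B 1 \<omega>, K ** integral {0..1} (\<lambda>r. outer (bridge B r \<omega>)) ** transpose K)"
        using * by (rule continuous_on_tendsto_compose) auto
    qed
  qed (use \<Psi>N[OF Umm] \<Psi>N[OF BM.bridge_integral_measurable] \<Psi>(2) in auto)
  \<comment> \<open>At fixed \<open>l\<close> the test function depends on the increments alone.
    Linearity moves \<open>K\<close> out of the sums and turns each outer product into a congruence
    by \<open>K\<close>.\<close>
  have grid: "(\<lambda>n. expectation (\<lambda>\<omega>. \<Psi> ((1 / sqrt n) *\<^sub>R Zsum n \<omega>, grid_var l (scaled_Delta l n \<omega>)))) \<longlonglongrightarrow> G l" if l: "0 < l" for l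
  proof -
    define \<Phi> where "\<Phi> = (\<lambda>x. \<Psi> (\<Sum>i<l. x i, grid_var l x))"
    have "continuous_on UNIV \<Phi>" unfolding \<Phi>_def
      by (rule continuous_on_compose2[OF \<Psi>(1)]) (auto intro!: continuous_intros continuous_on_grid_var continuous_on_product_coordinates)
    from scaled_Delta_weak_limit[OF l K this, of 1]
    have "(\<lambda>n. expectation (\<lambda>\<omega>. \<Phi> (scaled_Delta l n \<omega>))) \<longlonglongrightarrow> integral\<^sup>L N (\<lambda>\<omega>. \<Phi> (\<lambda>i. if i < l then K *v BM.incr l i \<omega> else 0))"
      using \<Psi>(2) by (simp add: \<Phi>_def)
    moreover have "integral\<^sup>L N (\<lambda>\<omega>. \<Phi> (\<lambda>i. if i < l then K *v BM.incr l i \<omega> else 0)) = G l"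
      unfolding G_def
    proof (rule integral_cong_AE)
      show "AE \<omega> in N. \<Phi> (\<lambda>i. if i < l then K *v BM.incr l i \<omega> else 0) = \<Psi> (K *v B 1 \<omega>, K ** Um l \<omega> ** transpose K)"
        using BM.B_eq_sum_incr[OF l]
      proof eventually_elim
        case (elim \<omega>)
        have S: "(\<Sum>i<k. if i < l then K *v BM.incr l i \<omega> else 0) = K *v B (real k / l) \<omega>" if "k \<le> l" for k
        proof -
          have "(\<Sum>i<k. if i < l then K *v BM.incr l i \<omega> else 0) = (\<Sum>i<k. K *v BM.incr l i \<omega>)"
            using that by (intro sum.cong) auto
          also have "\<dots> = K *v (\<Sum>i<k. BM.incr l i \<omega>)" by (simp add: linear_sum[OF matrix_vector_mul_linear])
          finally show ?thesis using elim by simp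
        qed
        have S1: "(\<Sum>i<l. if i < l then K *v BM.incr l i \<omega> else 0) = K *v B 1 \<omega>" using S[of l] l by simp
        have "outer ((\<Sum>i<Suc k. if i < l then K *v BM.incr l i \<omega> else 0) - (real (Suc k) / l) *\<^sub>R (\<Sum>i<l. if i < l then K *v BM.incr l i \<omega> else 0))
           = K ** outer (bridge B (real (Suc k) / l) \<omega>) ** transpose K" if "k < l" for k
        proof -
          have "K *v B (real (Suc k) / l) \<omega> - (real (Suc k) / l) *\<^sub>R (K *v B 1 \<omega>) = K *v bridge B (real (Suc k) / l) \<omega>"
            unfolding bridge_def by (simp add: matrix_vector_mult_diff_distrib matrix_vector_mult_scaleR)
          then show ?thesis unfolding S1 S[OF Suc_leI[OF that]] by (simp only: outer_matrix_vector)
        qed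
        then have "grid_var l (\<lambda>i. if i < l then K *v BM.incr l i \<omega> else 0) = K ** Um l \<omega> ** transpose K"
          unfolding grid_var_def Um_def congruence_scaleR_sum
          by (intro arg_cong2[of _ _ _ _ scaleR] refl sum.cong) (simp only: lessThan_iff)
        then show ?case unfolding \<Phi>_def S1 by simp
      qed
      show "(\<lambda>\<omega>. \<Phi> (\<lambda>i. if i < l then K *v BM.incr l i \<omega> else 0)) \<in> borel_measurable N"
      proof (rule measurable_compose[OF _ borel_measurable_continuous_onI[OF \<open>continuous_on UNIV \<Phi>\<close>]])
        have "(\<lambda>\<omega>. K *v BM.incr l i \<omega>) \<in> borel_measurable N" for i
          by (rule measurable_compose[OF BM.incr_measurable]) (intro borel_measurable_continuous_onI continuous_intros)
        then show "(\<lambda>\<omega> i. if i < l then K *v BM.incr l i \<omega> else 0) \<in> borel_measurable N"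
          by (intro measurable_coordinatewise_then_product) auto
      qed
    qed (rule \<Psi>N[OF Umm])
    ultimately show ?thesis unfolding \<Phi>_def sum_scaled_Delta_full[OF l] by simp
  qed
  show ?thesis
  proof (rule LIMSEQ_I)
    fix r :: real assume r: "0 < r"
    have r8: "0 < r / 8" using r by simp
    obtain d where d: "0 < d" "\<And>p p'. dist p p' < d \<Longrightarrow> \<bar>\<Psi> p - \<Psi> p'\<bar> < r / 8"
      using uniformly_continuous_bounded_support[OF \<Psi>(1,3) r8] by blast
    define Q where "Q = (2 / d) * (real CARD('q))\<^sup>2"
    have Q: "0 \<le> Q" unfolding Q_def using d by simp
    have ap: "0 \<le> Q * (8 * moment_const)" using Q moment_const_nonneg by simp
    \<comment> \<open>The term with \<open>8 * moment_const * s\<close> depends on neither grid, so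
      \<open>s\<close> is fixed before \<open>l\<close> and \<open>n\<close>, which then control the
      terms divided by \<open>s\<close>.\<close>
    define s where "s = r / 8 / (Q * (8 * moment_const) + 1)"
    have s: "0 < s" unfolding s_def using r ap by simp
    have "s * (Q * (8 * moment_const) + 1) = r / 8"
      using nonzero_eq_divide_eq[of "Q * (8 * moment_const) + 1" s "r / 8"] s_def ap by linarith
    then have s1: "Q * (8 * moment_const * s) \<le> r / 8" using s by (simp add: algebra_simps)
    have c: "(\<lambda>k. Q * (6 * moment_const * (1 / real k) / s)) \<longlonglongrightarrow> 0"
    proof -
      have "(\<lambda>k. Q * (6 * moment_const * (1 / real k) / s)) \<longlonglongrightarrow> Q * (6 * moment_const * 0 / s)"
        by (intro tendsto_intros lim_const_over_n) (use s in auto)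
      then show ?thesis by simp
    qed
    have "\<forall>\<^sub>F k in sequentially. Q * (6 * moment_const * (1 / real k) / s) < r / 8" "\<forall>\<^sub>F k in sequentially. dist (G k) ?L < r / 8"
      by (rule order_tendstoD(2)[OF c], use r in simp) (rule tendstoD[OF Glim], use r in simp)
    then have "\<forall>\<^sub>F k in sequentially. Q * (6 * moment_const * (1 / real k) / s) < r / 8 \<and> dist (G k) ?L < r / 8 \<and> 0 < k"
      by (intro eventually_conj eventually_gt_at_top)
    then obtain l where l: "Q * (6 * moment_const * (1 / real l) / s) < r / 8" "\<bar>G l - ?L\<bar> < r / 8" "0 < l"
      using eventually_happens by (force simp: dist_real_def)
    have "\<forall>\<^sub>F n in sequentially. Q * (6 * moment_const * (1 / real n) / s) < r / 8"
      "\<forall>\<^sub>F n in sequentially. dist (expectation (\<lambda>\<omega>. \<Psi> ((1 / sqrt n) *\<^sub>R Zsum n \<omega>, grid_var l (scaled_Delta l n \<omega>)))) (G l) < r / 8"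
      by (rule order_tendstoD(2)[OF c], use r in simp) (rule tendstoD[OF grid[OF l(3)]], use r in simp)
    then have "\<forall>\<^sub>F n in sequentially. Q * (6 * moment_const * (1 / real n) / s) < r / 8
       \<and> dist (expectation (\<lambda>\<omega>. \<Psi> ((1 / sqrt n) *\<^sub>R Zsum n \<omega>, grid_var l (scaled_Delta l n \<omega>)))) (G l) < r / 8 \<and> 0 < n"
      by (intro eventually_conj eventually_gt_at_top)
    then obtain n0 where n0: "\<And>n. n0 \<le> n \<Longrightarrow> Q * (6 * moment_const * (1 / real n) / s) < r / 8
       \<and> \<bar>expectation (\<lambda>\<omega>. \<Psi> ((1 / sqrt n) *\<^sub>R Zsum n \<omega>, grid_var l (scaled_Delta l n \<omega>))) - G l\<bar> < r / 8 \<and> 0 < n"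
      unfolding eventually_sequentially dist_real_def by blast
    have "norm (expectation (\<lambda>\<omega>. \<Psi> ((1 / sqrt n) *\<^sub>R Zsum n \<omega>, U_stat m Z n \<omega>)) - ?L) < r" if "n0 \<le> n" for n
    proof -
      have n: "0 < n" using n0[OF that] by simp
      let ?D = "\<lambda>\<omega>. norm (U_stat m Z n \<omega> - grid_var l (scaled_Delta l n \<omega>))"
      let ?a = "\<lambda>\<omega>. (1 / sqrt n) *\<^sub>R Zsum n \<omega>"
      have am: "?a \<in> borel_measurable M" by measurable
      have Xm: "(\<lambda>\<omega>. grid_var l (scaled_Delta l n \<omega>)) \<in> borel_measurable M"
        by (rule measurable_compose[OF measurable_coordinatewise_then_product[OF scaled_Delta_measurable] borel_measurable_continuous_onI[OF continuous_on_grid_var]])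
      have i: "integrable M (\<lambda>\<omega>. \<Psi> (?a \<omega>, U_stat m Z n \<omega>))" "integrable M (\<lambda>\<omega>. \<Psi> (?a \<omega>, grid_var l (scaled_Delta l n \<omega>)))"
        using measurable_compose[OF borel_measurable_Pair[OF am U_stat_measurable] \<Psi>m] measurable_compose[OF borel_measurable_Pair[OF am Xm] \<Psi>m] \<Psi>(2)
        by (auto intro!: integrable_const_bound[of _ 1])
      \<comment> \<open>Close matrices are handled by uniform continuity; otherwise the trivial
        bound 2 is at most \<open>(2 / d) * ?D \<omega>\<close>, which is Markov's inequality in
        pointwise form.\<close>
      have pw: "\<bar>\<Psi> (?a \<omega>, U_stat m Z n \<omega>) - \<Psi> (?a \<omega>, grid_var l (scaled_Delta l n \<omega>))\<bar> \<le> r / 8 + (2 / d) * ?D \<omega>" for \<omega>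
      proof (cases "?D \<omega> < d")
        case True
        then have "dist (?a \<omega>, U_stat m Z n \<omega>) (?a \<omega>, grid_var l (scaled_Delta l n \<omega>)) < d" by (simp add: dist_Pair_Pair dist_norm)
        moreover have "0 \<le> (2 / d) * ?D \<omega>" using d(1) by simp
        ultimately show ?thesis using d(2) by fastforce
      next
        case False
        then have "2 \<le> (2 / d) * ?D \<omega>" using d(1) by (simp add: field_simps)
        moreover have "\<bar>\<Psi> (?a \<omega>, U_stat m Z n \<omega>) - \<Psi> (?a \<omega>, grid_var l (scaled_Delta l n \<omega>))\<bar> \<le> 2"
          using \<Psi>(2)[of "(?a \<omega>, U_stat m Z n \<omega>)"] \<Psi>(2)[of "(?a \<omega>, grid_var l (scaled_Delta l n \<omega>))"] by linarith
        ultimately show ?thesis using r by linarith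
      qed
      have Di: "integrable M (\<lambda>\<omega>. r / 8 + (2 / d) * ?D \<omega>)"
        by (intro Bochner_Integration.integrable_add integrable_const integrable_mult_right grid_error_integrable[OF n l(3) s])
      have "\<bar>expectation (\<lambda>\<omega>. \<Psi> (?a \<omega>, U_stat m Z n \<omega>)) - expectation (\<lambda>\<omega>. \<Psi> (?a \<omega>, grid_var l (scaled_Delta l n \<omega>)))\<bar>
        = \<bar>expectation (\<lambda>\<omega>. \<Psi> (?a \<omega>, U_stat m Z n \<omega>) - \<Psi> (?a \<omega>, grid_var l (scaled_Delta l n \<omega>)))\<bar>" using i by simp
      also have "\<dots> \<le> expectation (\<lambda>\<omega>. \<bar>\<Psi> (?a \<omega>, U_stat m Z n \<omega>) - \<Psi> (?a \<omega>, grid_var l (scaled_Delta l n \<omega>))\<bar>)" by (rule integral_abs_bound)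
      also have "\<dots> \<le> expectation (\<lambda>\<omega>. r / 8 + (2 / d) * ?D \<omega>)"
        by (rule integral_mono[OF _ Di pw]) (intro integrable_abs Bochner_Integration.integrable_diff i)
      also have "\<dots> = r / 8 + (2 / d) * expectation ?D"
        using grid_error_integrable[OF n l(3) s] by (simp add: prob_space)
      also have "\<dots> \<le> r / 8 + (2 / d) * ((real CARD('q))\<^sup>2 * (6 * moment_const * (1 / real n + 1 / real l) / s + 8 * moment_const * s))"
        using d(1) by (intro add_left_mono mult_left_mono grid_error n l(3) s) auto
      also have "\<dots> = r / 8 + (Q * (6 * moment_const * (1 / real n) / s) + Q * (6 * moment_const * (1 / real l) / s) + Q * (8 * moment_const * s))"
        unfolding Q_def by (simp add: distrib_left distrib_right add_divide_distrib mult_ac)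
      finally have "\<bar>expectation (\<lambda>\<omega>. \<Psi> (?a \<omega>, U_stat m Z n \<omega>)) - expectation (\<lambda>\<omega>. \<Psi> (?a \<omega>, grid_var l (scaled_Delta l n \<omega>)))\<bar>
        \<le> r / 8 + (Q * (6 * moment_const * (1 / real n) / s) + Q * (6 * moment_const * (1 / real l) / s) + Q * (8 * moment_const * s))" .
      then show ?thesis using n0[OF that] l s1 r unfolding real_norm_def by linarith
    qed
    then show "\<exists>no. \<forall>n\<ge>no. norm (expectation (\<lambda>\<omega>. \<Psi> ((1 / sqrt n) *\<^sub>R Zsum n \<omega>, U_stat m Z n \<omega>)) - ?L) < r" by blast
  qed
qed

lemma Q_stat_eq: "Q_stat c m Z n \<omega> = quad c ((1 / sqrt n) *\<^sub>R Zsum n \<omega>) (U_stat m Z n \<omega>)"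
proof (cases "invertible (U_stat m Z n \<omega>)")
  case True
  have Zb: "(1 / sqrt n) *\<^sub>R Zsum n \<omega> = sqrt n *\<^sub>R Zbar m Z n \<omega>"
    by (simp add: Zsum_def Zbar_def sqrt_divide_self_eq inverse_eq_divide)
  have "quad c ((1 / sqrt n) *\<^sub>R Zsum n \<omega>) (U_stat m Z n \<omega>) = (sqrt n *\<^sub>R Zbar m Z n \<omega>) \<bullet> (matrix_inv (U_stat m Z n \<omega>) *v (sqrt n *\<^sub>R Zbar m Z n \<omega>))"
    using True unfolding Zb invertible_det_nz by (rule quad_nonsingular)
  also have "\<dots> = real n * (Zbar m Z n \<omega> \<bullet> (matrix_inv (U_stat m Z n \<omega>) *v Zbar m Z n \<omega>))"
    by (simp add: matrix_vector_mult_scaleR mult.assoc[symmetric])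
  finally show ?thesis using True by (simp add: Q_stat_def)
qed (simp add: Q_stat_def quad_def invertible_det_nz)

lemma limit_var_measurable: "limit_var B \<in> borel_measurable N"
proof -
  define V where "V = (\<lambda>\<omega>. integral {0..1} (\<lambda>r. outer (bridge B r \<omega>)))"
  have Vm: "V \<in> borel_measurable N" unfolding V_def by (rule BM.bridge_integral_measurable)
  have B1: "B 1 \<in> borel_measurable N" by (rule BM.B_measurable) simp
  have eq: "limit_var B = (\<lambda>\<omega>. if det (V \<omega>) \<noteq> 0 then quad 0 (B 1 \<omega>) (V \<omega>) else B 1 \<omega> \<bullet> (matrix_inv 0 *v B 1 \<omega>))"
  proof
    fix \<omega>
    have lv: "limit_var B \<omega> = B 1 \<omega> \<bullet> (matrix_inv (V \<omega>) *v B 1 \<omega>)" by (simp add: limit_var_def V_def)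
    show "limit_var B \<omega> = (if det (V \<omega>) \<noteq> 0 then quad 0 (B 1 \<omega>) (V \<omega>) else B 1 \<omega> \<bullet> (matrix_inv 0 *v B 1 \<omega>))"
      unfolding lv using matrix_inv_singular[of "V \<omega>"] by (simp add: quad_nonsingular invertible_det_nz)
  qed
  have [measurable]: "(\<lambda>\<omega>. det (V \<omega>)) \<in> borel_measurable N"
    by (rule measurable_compose[OF Vm]) (intro borel_measurable_continuous_onI continuous_intros)
  have [measurable]: "(\<lambda>\<omega>. B 1 \<omega> \<bullet> (matrix_inv 0 *v B 1 \<omega>)) \<in> borel_measurable N"
    by (rule measurable_compose[OF B1]) (intro borel_measurable_continuous_onI continuous_intros)
  have [measurable]: "(\<lambda>\<omega>. quad 0 (B 1 \<omega>) (V \<omega>)) \<in> borel_measurable N" by (rule quad_measurable[OF B1 Vm])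
  show ?thesis unfolding eq by measurable
qed

text \<open>The limit is first obtained for the Brownian motion transformed by a factor
  \<open>K\<close> of \<open>\<Sigma>\<close>. Invariance of the form under congruence then removes
  \<open>K\<close> where the integrated bridge is nonsingular; the default \<open>c\<close> concerns
  the complementary null event.\<close>

theorem Q_stat_weak_limit: "weak_conv_m (\<lambda>n. distr M borel (Q_stat c m Z n)) (distr N borel (limit_var B))"
proof -
  obtain K :: "real ^ 'q ^ 'q" where K: "invertible K" "K ** transpose K = \<Sigma>" by (rule positive_definite_factor[OF pd])
  define V where "V = (\<lambda>\<omega>. integral {0..1} (\<lambda>r. outer (bridge B r \<omega>)))"
  have Vm: "V \<in> borel_measurable N" unfolding V_def by (rule BM.bridge_integral_measurable)
  have B1: "(\<lambda>\<omega>. K *v B 1 \<omega>) \<in> borel_measurable N"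
    by (rule measurable_compose[OF BM.B_measurable]) (auto intro!: borel_measurable_continuous_onI continuous_intros)
  have KV: "(\<lambda>\<omega>. K ** V \<omega> ** transpose K) \<in> borel_measurable N"
    by (rule measurable_compose[OF Vm]) (intro borel_measurable_continuous_onI continuous_on_congruence continuous_intros)
  have det: "AE \<omega> in N. det (V \<omega>) \<noteq> 0" unfolding V_def by (rule BM.det_bridge_integral)
  have qm: "(\<lambda>\<omega>. quad c (K *v B 1 \<omega>) (K ** V \<omega> ** transpose K)) \<in> borel_measurable N" by (rule quad_measurable[OF B1 KV])
  have "weak_conv_m (\<lambda>n. distr M borel (\<lambda>\<omega>. quad c ((1 / sqrt n) *\<^sub>R Zsum n \<omega>) (U_stat m Z n \<omega>)))
     (distr N borel (\<lambda>\<omega>. quad c (K *v B 1 \<omega>) (K ** V \<omega> ** transpose K)))"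
  proof (rule weak_conv_quad)
    show "prob_space M" "prob_space N" by unfold_locales
    show "(\<lambda>\<omega>. (1 / sqrt n) *\<^sub>R Zsum n \<omega>) \<in> borel_measurable M" for n by measurable
    show "AE \<omega> in N. det (K ** V \<omega> ** transpose K) \<noteq> 0"
      using det by eventually_elim (use K(1) in \<open>simp add: det_mul det_transpose invertible_det_nz\<close>)
    fix \<Psi> :: "(real ^ 'q) \<times> (real ^ 'q ^ 'q) \<Rightarrow> real" and r
    assume "continuous_on UNIV \<Psi>" "\<And>p. \<bar>\<Psi> p\<bar> \<le> 1" "\<And>p. r < norm p \<Longrightarrow> \<Psi> p = 0"
    from joint_limit[OF K(2) this]
    show "(\<lambda>n. expectation (\<lambda>\<omega>. \<Psi> ((1 / sqrt n) *\<^sub>R Zsum n \<omega>, U_stat m Z n \<omega>))) \<longlonglongrightarrow> integral\<^sup>L N (\<lambda>\<omega>. \<Psi> (K *v B 1 \<omega>, K ** V \<omega> ** transpose K))"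
      unfolding V_def .
  qed (rule U_stat_measurable B1 KV)+
  moreover have "distr N borel (\<lambda>\<omega>. quad c (K *v B 1 \<omega>) (K ** V \<omega> ** transpose K)) = distr N borel (limit_var B)"
  proof (rule distr_cong_AE)
    show "AE \<omega> in N. quad c (K *v B 1 \<omega>) (K ** V \<omega> ** transpose K) = limit_var B \<omega>"
      using det
    proof eventually_elim
      case (elim \<omega>)
      then have V: "invertible (V \<omega>)" by (simp add: invertible_det_nz)
      note inv = inner_matrix_inv_congruence[OF V K(1)]
      then have "det (K ** V \<omega> ** transpose K) \<noteq> 0" by (simp add: invertible_det_nz)
      then have "quad c (K *v B 1 \<omega>) (K ** V \<omega> ** transpose K) = (K *v B 1 \<omega>) \<bullet> (matrix_inv (K ** V \<omega> ** transpose K) *v (K *v B 1 \<omega>))"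
        by (rule quad_nonsingular)
      then show ?case unfolding inv(2) by (simp add: limit_var_def V_def)
    qed
  qed (use qm limit_var_measurable in auto)
  ultimately show ?thesis by (simp add: Q_stat_eq[abs_def])
qed

end

section \<open>From the forecasting setting to the abstract sequence\<close>

theorem theorem3p3:
  fixes M :: "'a measure" and N :: "'b measure"
    and Y :: "nat \<Rightarrow> 'a \<Rightarrow> real" and X :: "nat \<Rightarrow> 'a \<Rightarrow> real ^ 'p"
    and f g :: "nat \<Rightarrow> 'a \<Rightarrow> real" and L :: "real \<Rightarrow> real \<Rightarrow> real"
    and h :: "nat \<Rightarrow> 'a \<Rightarrow> real ^ 'q"
    and B :: "real \<Rightarrow> 'b \<Rightarrow> real ^ 'q"
    and \<Sigma> :: "real ^ 'q ^ 'q" and \<eta> c :: real and m \<tau> :: nat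
  defines "W \<equiv> observed Y X"
    and "Z \<equiv> test_seq h (loss_diff L Y \<tau> f g)"
  assumes "prob_space M"
    and "1 < CARD('q)" and "1 < \<tau>" and "1 \<le> m"
    and "\<forall>t\<ge>1. Y t \<in> borel_measurable M" and "\<forall>t\<ge>1. X t \<in> borel_measurable M"
    and "(\<lambda>(y, z). L y z) \<in> borel_measurable (borel \<Otimes>\<^sub>M borel)"
    and "\<forall>t\<ge>m. f t \<in> borel_measurable (info M W t)"
    and "\<forall>t\<ge>m. g t \<in> borel_measurable (info M W t)"
    and "rolling_window_forecast M W m f" and "rolling_window_forecast M W m g"
    and "\<forall>t\<ge>m. h t \<in> borel_measurable (info M W t)"
    and "0 < \<eta>"
    and "strongly_mixing M m Z"
    and "summable (\<lambda>k. alpha_mixing_coeff M m Z (Suc k) powr (\<eta> / (2 + \<eta>)))"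
    and "(SUP t\<in>{m..}. \<integral>\<^sup>+\<omega>. ennreal (norm (Z t \<omega>) powr (2 + \<eta>)) \<partial>M) < \<infinity>"
    and "positive_definite \<Sigma>"
    and "\<forall>r\<in>{0..1}. \<forall>s\<in>{0..1}.
           (\<lambda>n. (1 / real n) *\<^sub>R cross_cov M (partial_sum m Z n r) (partial_sum m Z n s))
             \<longlonglongrightarrow> min r s *\<^sub>R \<Sigma>"
    and "null_hypothesis M (info M W) m (loss_diff L Y \<tau> f g)"
    and "standard_brownian_motion N B"
  shows "weak_conv_m (\<lambda>n. distr M borel (Q_stat c m Z n)) (distr N borel (limit_var B))"
proof -
  interpret M: prob_space M by fact
  define F where "F = info M W"
  define D where "D = loss_diff L Y \<tau> f g"
  note Ym = assms(7)[rule_format] and Xm = assms(8)[rule_format]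
  have WM: "W t \<in> borel_measurable M" if "1 \<le> t" for t
    unfolding W_def observed_def[abs_def] by (rule borel_measurable_Pair) (use Ym Xm that in auto)
  have spF: "space (F t) = space M" for t unfolding F_def info_def by simp
  have WF: "W s \<in> borel_measurable (F t)" if "1 \<le> s" "s \<le> t" for s t
    unfolding F_def info_def by (rule generated_by_measurable) (use that in auto)
  have sub: "subalgebra M (F t)" for t
    unfolding F_def info_def by (rule subalgebra_generated_by) (auto intro: WM)
  have mono: "sets (F s) \<subseteq> sets (F t)" if "s \<le> t" for s t
    unfolding F_def[abs_def] info_def[of M W s]
    by (rule generated_by_subset) (use that WF[unfolded F_def] spF[unfolded F_def] in auto)
  have F_mono: "k \<in> borel_measurable (F t)" if "k \<in> borel_measurable (F s)" "s \<le> t" for k :: "'a \<Rightarrow> 'c::topological_space" and s t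
    using that mono[OF that(2)] spF by (auto simp: measurable_def)
  have D_F: "D t \<in> borel_measurable (F (t + \<tau>))" if t: "m \<le> t" for t
  proof -
    \<comment> \<open>\<open>Y\<close> is recovered from the observation at time
      \<open>t + \<tau>\<close>; the index is at least 1, where the information set begins.\<close>
    have "(\<lambda>\<omega>. fst (W (t + \<tau>) \<omega>)) \<in> borel_measurable (F (t + \<tau>))"
      by (rule measurable_compose[OF WF borel_measurable_continuous_onI]) (use t \<open>1 \<le> m\<close> in \<open>auto intro: continuous_intros\<close>)
    then have Y_F: "Y (t + \<tau>) \<in> borel_measurable (F (t + \<tau>))" by (simp add: W_def observed_def)
    have L: "(\<lambda>\<omega>. L (Y (t + \<tau>) \<omega>) (k \<omega>)) \<in> borel_measurable (F (t + \<tau>))" if "k \<in> borel_measurable (F t)" for k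
      using measurable_compose[OF measurable_Pair[OF Y_F F_mono[OF that]] assms(9)] by simp
    show ?thesis unfolding D_def loss_diff_def[abs_def]
      by (intro borel_measurable_diff L) (use assms(10,11) t in \<open>auto simp: F_def\<close>)
  qed
  have h_F: "h t \<in> borel_measurable (F t)" if "m \<le> t" for t using assms(14) that by (simp add: F_def)
  have Z_eq: "Z t = (\<lambda>\<omega>. D t \<omega> *\<^sub>R h t \<omega>)" for t by (simp add: Z_def test_seq_def[abs_def] D_def)
  have Z_F: "Z t \<in> borel_measurable (F (t + \<tau>))" if "m \<le> t" for t
    unfolding Z_eq by (intro borel_measurable_scaleR D_F that F_mono[OF h_F[OF that]]) simp
  have ZM: "Z t \<in> borel_measurable M" if "m \<le> t" for t by (rule measurable_from_subalg[OF sub Z_F[OF that]])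
  \<comment> \<open>The finite supremum of the moments becomes the constant \<open>C\<close>,
    converted by \<open>enn2real\<close>.\<close>
  define S where "S = (SUP t\<in>{m..}. \<integral>\<^sup>+\<omega>. ennreal (norm (Z t \<omega>) powr (2 + \<eta>)) \<partial>M)"
  have S: "S < \<infinity>" using assms(18) unfolding S_def .
  interpret B: brownian N B
    using assms(22) by (intro brownian.intro brownian_axioms.intro) (auto simp: standard_brownian_motion_def)
  interpret null_process_limit M F Z m \<tau> \<eta> "enn2real S" "alpha_mixing_coeff M m Z" N B \<Sigma>
  proof unfold_locales
    show "subalgebra M (F t)" for t by (rule sub)
    show "sets (F s) \<subseteq> sets (F t)" if "s \<le> t" for s t by (rule mono[OF that])
    show "Z t \<in> borel_measurable (F (t + \<tau>))" if "m \<le> t" for t by (rule Z_F[OF that])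
    show "0 < \<eta>" by fact
    show "(\<integral>\<^sup>+\<omega>. ennreal (norm (Z t \<omega>) powr (2 + \<eta>)) \<partial>M) \<le> ennreal (enn2real S)" if "m \<le> t" for t
      using that S unfolding S_def by (subst ennreal_enn2real) (auto intro: SUP_upper)
    show "0 \<le> enn2real S" by simp
    \<comment> \<open>The test function \<open>h t\<close> is known at the origin and joins
      \<open>U\<close>; conditioning on \<open>F t\<close> then leaves the conditional mean of the
      loss differential, which is 0 almost surely.\<close>
    show "M.expectation (\<lambda>\<omega>. U \<omega> * (u \<bullet> Z t \<omega>)) = 0"
      if t: "m \<le> t" and U: "U \<in> borel_measurable (F t)" and i: "integrable M (\<lambda>\<omega>. U \<omega> * (u \<bullet> Z t \<omega>))" for t U u
    proof -
      interpret sub: finite_measure_subalgebra M "F t"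
        by unfold_locales (use sub[of t] in \<open>auto simp: subalgebra_def\<close>)
      have eq: "U \<omega> * (u \<bullet> Z t \<omega>) = (U \<omega> * (u \<bullet> h t \<omega>)) * D t \<omega>" for \<omega> by (simp add: Z_eq)
      have Uh: "(\<lambda>\<omega>. U \<omega> * (u \<bullet> h t \<omega>)) \<in> borel_measurable (F t)"
        by (intro borel_measurable_times borel_measurable_inner borel_measurable_const U h_F t)
      have DM: "D t \<in> borel_measurable M" by (rule measurable_from_subalg[OF sub D_F[OF t]])
      have "M.expectation (\<lambda>\<omega>. U \<omega> * (u \<bullet> Z t \<omega>)) = M.expectation (\<lambda>\<omega>. (U \<omega> * (u \<bullet> h t \<omega>)) * real_cond_exp M (F t) (D t) \<omega>)"
        unfolding eq by (rule sub.real_cond_exp_intg(2)[OF i[unfolded eq] Uh DM, symmetric])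
      also have "\<dots> = M.expectation (\<lambda>\<omega>. 0)"
      proof (rule integral_cong_AE)
        have "AE \<omega> in M. real_cond_exp M (F t) (D t) \<omega> = 0"
          using assms(21) t unfolding null_hypothesis_def F_def D_def by auto
        then show "AE \<omega> in M. (U \<omega> * (u \<bullet> h t \<omega>)) * real_cond_exp M (F t) (D t) \<omega> = 0" by eventually_elim simp
      qed (use measurable_from_subalg[OF sub Uh] in auto)
      finally show ?thesis by simp
    qed
    show "\<bar>M.prob (A \<inter> A') - M.prob A * M.prob A'\<bar> \<le> alpha_mixing_coeff M m Z k"
      if "m \<le> s" "A \<in> sets (generated_by M Z {m..s})" "A' \<in> sets (generated_by M Z {s + k..})" for s k A A'
      unfolding alpha_mixing_coeff_def
    proof (rule cSup_upper)
      have "\<bar>M.prob (A \<inter> A') - M.prob A * M.prob A'\<bar> \<le> 1" for A A'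
      proof -
        have "M.prob A * M.prob A' \<le> 1" by (intro mult_le_one) auto
        moreover have "0 \<le> M.prob A * M.prob A'" by simp
        ultimately show ?thesis using M.prob_le_1[of "A \<inter> A'"] measure_nonneg[of M "A \<inter> A'"] by linarith
      qed
      then show "bdd_above {\<bar>M.prob (A \<inter> B) - M.prob A * M.prob B\<bar> |t A B. m \<le> t \<and> A \<in> sets (generated_by M Z {m..t}) \<and> B \<in> sets (generated_by M Z {t + k..})}"
        by (intro bdd_aboveI[of _ 1]) blast
    qed (use that in blast)
    show "alpha_mixing_coeff M m Z \<longlonglongrightarrow> 0" using assms(16) by (simp add: strongly_mixing_def)
    show "positive_definite \<Sigma>" by fact
    show "(\<lambda>n. (1 / real n) *\<^sub>R cross_cov M (partial_sum m Z n r) (partial_sum m Z n s)) \<longlonglongrightarrow> min r s *\<^sub>R \<Sigma>"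
      if "r \<in> {0..1}" "s \<in> {0..1}" for r s using assms(20) that by blast
  qed
  show ?thesis by (rule Q_stat_weak_limit)
qed

end
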